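(* Let $(R,\mathfrak m)$ be a Noetherian local unique factorization domain of dimension three and let $M$ be a finitely generated faithful $R$-module. Put $n=\dim M$. Then for every ideal $I$ of $R$ such that $d:=\dim(M/IM)>1$ and $\operatorname{cd}(I,M)=n-d+1$, the top local cohomology module $\operatorname{H}^{\operatorname{cd}(I,M)}_I(M)$ is not Artinian.
   Context: For an ideal $I$ of a Noetherian ring $R$ and an $R$-module $M$, $\operatorname{H}^i_I(M)$ denotes the $i$-th local cohomology module of $M$ with support in $I$. The cohomological dimension of $M$ with respect to $I$, denoted $\operatorname{cd}(I,M)$, is the supremum of the set of integers $i$ with $\operatorname{H}^i_I(M)\neq 0$. The dimension of a module is its Krull dimension. An $R$-module $M$ is faithful if $\operatorname{Ann}_R M=0$. *)

theory Defs
  imports "HOL-Algebra.Algebra" "HOL-Library.Extended_Real"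
begin

definition local_ring :: "('a, 'r) ring_scheme \<Rightarrow> 'a set \<Rightarrow> bool" where
  "local_ring R m \<longleftrightarrow> cring R \<and> {J. maximalideal J R} = {m}"

text \<open>Krull dimension takes values in \<^typ>\<open>ereal\<close>, where the supremum of the empty set
  is \<open>- \<infinity>\<close>; so the zero ring and the zero module have dimension \<open>- \<infinity>\<close>.\<close>

definition krull_dim :: "('a, 'r) ring_scheme \<Rightarrow> ereal" where
  "krull_dim R = (SUP k \<in> {k. \<exists>P :: nat \<Rightarrow> 'a set.
     (\<forall>i\<le>k. primeideal (P i) R) \<and> (\<forall>i<k. P i \<subset> P (Suc i))}. ereal (real k))"

definition annihilator :: "('a, 'r) ring_scheme \<Rightarrow> ('a, 'b, 'm) module_scheme \<Rightarrow> 'a set" where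
  "annihilator R M = {a \<in> carrier R. \<forall>x \<in> carrier M. a \<odot>\<^bsub>M\<^esub> x = \<zero>\<^bsub>M\<^esub>}"

definition faithful_module :: "('a, 'r) ring_scheme \<Rightarrow> ('a, 'b, 'm) module_scheme \<Rightarrow> bool" where
  "faithful_module R M \<longleftrightarrow> annihilator R M = {\<zero>\<^bsub>R\<^esub>}"

definition module_dim :: "('a, 'r) ring_scheme \<Rightarrow> ('a, 'b, 'm) module_scheme \<Rightarrow> ereal" where
  "module_dim R M = krull_dim (R Quot annihilator R M)"

definition submodule_span ::
    "('a, 'r) ring_scheme \<Rightarrow> ('a, 'b, 'm) module_scheme \<Rightarrow> 'b set \<Rightarrow> 'b set" where
  "submodule_span R M S = \<Inter> {N. submodule N R M \<and> S \<subseteq> N}"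

definition finitely_generated_module ::
    "('a, 'r) ring_scheme \<Rightarrow> ('a, 'b, 'm) module_scheme \<Rightarrow> bool" where
  "finitely_generated_module R M \<longleftrightarrow>
     (\<exists>S. finite S \<and> S \<subseteq> carrier M \<and> submodule_span R M S = carrier M)"

definition artinian_module :: "('a, 'r) ring_scheme \<Rightarrow> ('a, 'b, 'm) module_scheme \<Rightarrow> bool" where
  "artinian_module R M \<longleftrightarrow>
     (\<forall>N :: nat \<Rightarrow> 'b set. (\<forall>k. submodule (N k) R M \<and> N (Suc k) \<subseteq> N k)
        \<longrightarrow> (\<exists>k. \<forall>j\<ge>k. N j = N k))"

text \<open>The record type of modules extends that of rings; the fields \<open>mult\<close> and \<open>one\<close>
  play no role in the locale \<^locale>\<open>module\<close> and are left unspecified here.\<close>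

definition quot_module :: "('a, 'b, 'm) module_scheme \<Rightarrow> 'b set \<Rightarrow> ('a, 'b set) module" where
  "quot_module M N =
     \<lparr>carrier = a_rcosets\<^bsub>M\<^esub> N, monoid.mult = undefined, one = undefined,
      ring.zero = N, add = set_add M,
      smult = (\<lambda>a S. \<Union>x\<in>S. N +>\<^bsub>M\<^esub> (a \<odot>\<^bsub>M\<^esub> x))\<rparr>"

definition ideal_smult ::
    "('a, 'r) ring_scheme \<Rightarrow> 'a set \<Rightarrow> ('a, 'b, 'm) module_scheme \<Rightarrow> 'b set" where
  "ideal_smult R I M = submodule_span R M {a \<odot>\<^bsub>M\<^esub> x | a x. a \<in> I \<and> x \<in> carrier M}"

definition module_hom ::
    "('a, 'r) ring_scheme \<Rightarrow> ('a, 'b, 'm) module_scheme \<Rightarrow> ('a, 'c, 'n) module_scheme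
      \<Rightarrow> ('b \<Rightarrow> 'c) set" where
  "module_hom R M N = {h \<in> carrier M \<rightarrow> carrier N.
     (\<forall>x \<in> carrier M. \<forall>y \<in> carrier M. h (x \<oplus>\<^bsub>M\<^esub> y) = h x \<oplus>\<^bsub>N\<^esub> h y) \<and>
     (\<forall>a \<in> carrier R. \<forall>x \<in> carrier M. h (a \<odot>\<^bsub>M\<^esub> x) = a \<odot>\<^bsub>N\<^esub> h x)}"

text \<open>A definition cannot quantify over types, so the lifting property is required against
  all monomorphisms of modules whose elements lie in the element type of \<open>R\<close>.  These include
  the inclusions of the ideals into \<open>R\<close>, so by Baer's criterion the lifting property
  then holds against monomorphisms of arbitrary modules.\<close>

definition injective_module :: "('a, 'r) ring_scheme \<Rightarrow> ('a, 'e, 'm) module_scheme \<Rightarrow> bool" where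
  "injective_module R E \<longleftrightarrow> module R E \<and>
     (\<forall>(A :: ('a, 'a) module) (B :: ('a, 'a) module) i f.
        module R A \<and> module R B \<and> i \<in> module_hom R A B \<and> inj_on i (carrier A) \<and>
        f \<in> module_hom R A E
        \<longrightarrow> (\<exists>g \<in> module_hom R B E. \<forall>x \<in> carrier A. g (i x) = f x))"

text \<open>Cochain complexes are indexed by \<^typ>\<open>nat\<close>, the \<open>i\<close>-th differential being
  \<open>\<delta> i : C i \<rightarrow> C (i + 1)\<close>.\<close>

definition cocycles :: "(nat \<Rightarrow> ('a, 'e) module) \<Rightarrow> (nat \<Rightarrow> 'e \<Rightarrow> 'e) \<Rightarrow> nat \<Rightarrow> 'e set" where
  "cocycles C \<delta> i = {x \<in> carrier (C i). \<delta> i x = \<zero>\<^bsub>C (Suc i)\<^esub>}"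

definition coboundaries :: "(nat \<Rightarrow> ('a, 'e) module) \<Rightarrow> (nat \<Rightarrow> 'e \<Rightarrow> 'e) \<Rightarrow> nat \<Rightarrow> 'e set" where
  "coboundaries C \<delta> i =
     (case i of 0 \<Rightarrow> {\<zero>\<^bsub>C 0\<^esub>} | Suc j \<Rightarrow> \<delta> j ` carrier (C j))"

definition cohomology_module ::
    "(nat \<Rightarrow> ('a, 'e) module) \<Rightarrow> (nat \<Rightarrow> 'e \<Rightarrow> 'e) \<Rightarrow> nat \<Rightarrow> ('a, 'e set) module" where
  "cohomology_module C \<delta> i =
     quot_module ((C i)\<lparr>carrier := cocycles C \<delta> i\<rparr>) (coboundaries C \<delta> i)"

text \<open>Exactness of \<open>0 \<rightarrow> M \<rightarrow> E 0 \<rightarrow> E 1 \<rightarrow> \<dots>\<close>, with augmentation \<open>\<epsilon>\<close>.\<close>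

definition injective_resolution ::
    "('a, 'r) ring_scheme \<Rightarrow> ('a, 'b, 'm) module_scheme \<Rightarrow> ('b \<Rightarrow> 'e)
      \<Rightarrow> (nat \<Rightarrow> ('a, 'e) module) \<Rightarrow> (nat \<Rightarrow> 'e \<Rightarrow> 'e) \<Rightarrow> bool" where
  "injective_resolution R M \<epsilon> E \<delta> \<longleftrightarrow>
     (\<forall>i. injective_module R (E i)) \<and>
     (\<forall>i. \<delta> i \<in> module_hom R (E i) (E (Suc i))) \<and>
     \<epsilon> \<in> module_hom R M (E 0) \<and> inj_on \<epsilon> (carrier M) \<and>
     \<epsilon> ` carrier M = cocycles E \<delta> 0 \<and>
     (\<forall>i. \<delta> i ` carrier (E i) = cocycles E \<delta> (Suc i))"

text \<open>\<open>\<Gamma>\<^sub>I(M)\<close>, the elements annihilated by a power of \<open>I\<close>.\<close>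

definition torsion_module ::
    "('a, 'r) ring_scheme \<Rightarrow> 'a set \<Rightarrow> ('a, 'b, 'm) module_scheme
      \<Rightarrow> ('a, 'b, 'm) module_scheme" where
  "torsion_module R I M = M\<lparr>carrier := {x \<in> carrier M. \<exists>t :: nat.
     \<forall>a \<in> I [^]\<^bsub>ideals_set R\<^esub> t. a \<odot>\<^bsub>M\<^esub> x = \<zero>\<^bsub>M\<^esub>}\<rparr>"

text \<open>Local cohomology is the right derived functor of \<open>\<Gamma>\<^sub>I\<close>: if \<open>(E, \<delta>)\<close> is an injective
  resolution of \<open>M\<close>, then \<open>H\<^sup>i\<^sub>I(M)\<close> is the \<open>i\<close>-th cohomology module of \<open>\<Gamma>\<^sub>I(E)\<close>.
  Up to isomorphism it does not depend on the resolution, which is kept as a parameter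
  because there is no canonical type of elements for it.  The module \<open>M\<close> enters through
  the resolution only.\<close>

definition local_cohomology ::
    "('a, 'r) ring_scheme \<Rightarrow> 'a set \<Rightarrow> (nat \<Rightarrow> ('a, 'e) module) \<Rightarrow> (nat \<Rightarrow> 'e \<Rightarrow> 'e)
      \<Rightarrow> nat \<Rightarrow> ('a, 'e set) module" where
  "local_cohomology R I E \<delta> i = cohomology_module (\<lambda>j. torsion_module R I (E j)) \<delta> i"

definition cohomological_dim ::
    "('a, 'r) ring_scheme \<Rightarrow> 'a set \<Rightarrow> (nat \<Rightarrow> ('a, 'e) module) \<Rightarrow> (nat \<Rightarrow> 'e \<Rightarrow> 'e) \<Rightarrow> ereal" where
  "cohomological_dim R I E \<delta> =
     (SUP i \<in> {i. carrier (local_cohomology R I E \<delta> i) \<noteq> {\<zero>\<^bsub>local_cohomology R I E \<delta> i\<^esub>}}.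
        ereal (real i))"

end

theory Submission
  imports Defs
begin

text \<open>The hypotheses force \<open>d = 2\<close> and \<open>cd(I, M) = 2\<close>.  Since \<open>R\<close> is factorial, \<open>I = f J\<close> with
  \<open>J\<close> contained in no principal prime, and \<open>f\<close> is not a unit: otherwise \<open>I\<close> itself lies
  in no principal prime, and a chain of primes \<open>A \<subset> B \<subset> C\<close> over \<open>I\<close> extends below \<open>A\<close> by two steps.  If a power of \<open>f\<close> were in \<open>J\<close>, then
  \<open>\<Gamma>\<^sub>I = \<Gamma>\<^bsub>(f)\<^esub>\<close> and \<open>H\<^sup>2\<^sub>I(M)\<close> would vanish; so there is a prime \<open>P\<close> of height two with \<open>J \<subseteq> P\<close>
  and \<open>f \<notin> P\<close>.  An Artinian \<open>H\<^sup>2\<^sub>I(M)\<close> would consist of elements killed by powers of \<open>f\<close>, hence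
  would vanish at \<open>P\<close>, contradicting Grothendieck's non-vanishing theorem there.

  The contradiction is obtained without localization.  Take a nonzero functional \<open>\<phi> : M \<rightarrow> R\<close>, an
  element \<open>u\<close> with \<open>\<phi> u \<noteq> 0\<close>, and relatively prime \<open>x, y \<in> J\<close> with \<open>x \<in> J \<phi>(u)\<close>.  The class
  of \<open>u / (x y)\<close> in \<open>H\<^sup>2\<^bsub>(x, y)\<^esub>(M)\<close> gives, up to a factor outside \<open>P\<close>, a class in \<open>H\<^sup>2\<^sub>I(M)\<close>.  If
  \<open>f\<^sup>k\<close> kills it, a diagram chase yields \<open>c (x y)\<^sup>N u \<in> x\<^bsup>N+1\<^esup> M + y\<^bsup>N+1\<^esup> M\<close> for some
  \<open>c \<notin> P\<close>; applying \<open>\<phi>\<close> and cancelling gives \<open>c \<in> P\<close>.\<close>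

section \<open>Noetherian rings and factorial domains\<close>

lemma (in noetherian_ring) maximal_element_in_ideal_family:
  assumes "F \<noteq> {}" and "\<And>J. J \<in> F \<Longrightarrow> ideal J R"
  obtains P where "P \<in> F" and "\<And>J. \<lbrakk> J \<in> F; P \<subseteq> J \<rbrakk> \<Longrightarrow> J = P"
proof -
  have "\<exists>P\<in>F. \<forall>J\<in>F. P \<subseteq> J \<longrightarrow> J = P"
  proof (rule subset_Zorn)
    fix C assume C: "subset.chain F C"
    show "\<exists>U\<in>F. \<forall>J\<in>C. J \<subseteq> U"
    proof (cases "C = {}")
      case True
      then show ?thesis using assms(1) by auto
    next
      case False
      have "subset.chain {J. ideal J R} C"
        using C assms(2) unfolding pred_on.chain_def by auto
      then have "\<Union>C \<in> C" using ideal_chain_is_trivial False by blast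
      moreover have "C \<subseteq> F" using C unfolding pred_on.chain_def by simp
      ultimately show ?thesis by (intro bexI[of _ "\<Union>C"]) auto
    qed
  qed
  then show thesis using that by blast
qed

lemma (in cring) mem_cgenideal_iff:
  assumes "b \<in> carrier R"
  shows "a \<in> PIdl b \<longleftrightarrow> b divides a"
  using assms unfolding cgenideal_def factor_def by (auto simp: m_comm)

lemma (in cring) mem_set_add_cgenideal_iff:
  assumes "b \<in> carrier R"
  shows "a \<in> J <+>\<^bsub>R\<^esub> PIdl b \<longleftrightarrow> (\<exists>j\<in>J. \<exists>r\<in>carrier R. a = j \<oplus> r \<otimes> b)"
  unfolding set_add_def' cgenideal_def by blast

lemma (in cring) subset_set_add_cgenideal:
  assumes "ideal J R" and "b \<in> carrier R"
  shows "J \<subseteq> J <+>\<^bsub>R\<^esub> PIdl b" and "b \<in> J <+>\<^bsub>R\<^esub> PIdl b"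
proof -
  interpret J: ideal J R by fact
  show "J \<subseteq> J <+>\<^bsub>R\<^esub> PIdl b"
  proof
    fix j assume "j \<in> J"
    then have "j = j \<oplus> \<zero> \<otimes> b" using assms(2) J.Icarr by simp
    then show "j \<in> J <+>\<^bsub>R\<^esub> PIdl b"
      using mem_set_add_cgenideal_iff[OF assms(2)] \<open>j \<in> J\<close> by blast
  qed
  have "b = \<zero> \<oplus> \<one> \<otimes> b" using assms(2) by simp
  then show "b \<in> J <+>\<^bsub>R\<^esub> PIdl b"
    using mem_set_add_cgenideal_iff[OF assms(2)] J.zero_closed by blast
qed

lemma (in cring) prime_ideal_avoiding_mult_closed:
  assumes "noetherian_ring R" and "ideal J R" and "T \<subseteq> carrier R" and "\<one> \<in> T"
    and "\<And>s t. \<lbrakk> s \<in> T; t \<in> T \<rbrakk> \<Longrightarrow> s \<otimes> t \<in> T" and "J \<inter> T = {}"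
  obtains P where "primeideal P R" and "J \<subseteq> P" and "P \<inter> T = {}"
proof -
  interpret noetherian_ring R by fact
  define F where "F = {K. ideal K R \<and> J \<subseteq> K \<and> K \<inter> T = {}}"
  have "F \<noteq> {}" using assms(2,6) by (auto simp: F_def)
  then obtain P where P: "P \<in> F" and max: "\<And>K. \<lbrakk> K \<in> F; P \<subseteq> K \<rbrakk> \<Longrightarrow> K = P"
    by (rule maximal_element_in_ideal_family) (auto simp: F_def)
  interpret P: ideal P R using P by (simp add: F_def)
  have meets: "\<exists>t\<in>T. \<exists>p\<in>P. \<exists>r\<in>carrier R. t = p \<oplus> r \<otimes> a"
    if a: "a \<in> carrier R" "a \<notin> P" for a
  proof -
    have "P <+>\<^bsub>R\<^esub> PIdl a \<notin> F"
      using max[of "P <+>\<^bsub>R\<^esub> PIdl a"] subset_set_add_cgenideal[OF P.ideal_axioms a(1)] a(2) by auto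
    moreover have "ideal (P <+>\<^bsub>R\<^esub> PIdl a) R"
      using add_ideals[OF P.ideal_axioms cgenideal_ideal[OF a(1)]] .
    moreover have "J \<subseteq> P <+>\<^bsub>R\<^esub> PIdl a"
      using P subset_set_add_cgenideal(1)[OF P.ideal_axioms a(1)] by (auto simp: F_def)
    ultimately obtain t where "t \<in> T" "t \<in> P <+>\<^bsub>R\<^esub> PIdl a" by (auto simp: F_def)
    then show ?thesis unfolding mem_set_add_cgenideal_iff[OF a(1)] by blast
  qed
  have "primeideal P R"
  proof (rule primeidealI[OF P.ideal_axioms is_cring])
    show "carrier R \<noteq> P" using assms(4) P by (auto simp: F_def)
    fix a b assume ab: "a \<in> carrier R" "b \<in> carrier R" "a \<otimes> b \<in> P"
    show "a \<in> P \<or> b \<in> P"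
    proof (rule ccontr)
      assume "\<not> (a \<in> P \<or> b \<in> P)"
      then have "a \<notin> P" "b \<notin> P" by simp_all
      then obtain s p r t q u where s: "s \<in> T" "p \<in> P" "r \<in> carrier R" "s = p \<oplus> r \<otimes> a"
        and t: "t \<in> T" "q \<in> P" "u \<in> carrier R" "t = q \<oplus> u \<otimes> b"
        using meets[OF ab(1)] meets[OF ab(2)] by blast
      have pq: "p \<in> carrier R" "q \<in> carrier R" using s t P.Icarr by auto
      have "s \<otimes> t = (p \<otimes> (q \<oplus> u \<otimes> b) \<oplus> (r \<otimes> a) \<otimes> q) \<oplus> (r \<otimes> u) \<otimes> (a \<otimes> b)"
        unfolding s(4) t(4) using pq s(3) t(3) ab by algebra
      moreover have "\<dots> \<in> P"
        using pq s(2,3) t(2,3) ab by (intro P.a_closed P.I_l_closed[OF ab(3)] P.I_l_closed[OF t(2)] P.I_r_closed[OF s(2)]) auto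
      ultimately have "s \<otimes> t \<in> P \<inter> T" using assms(5)[OF s(1) t(1)] by simp
      then show False using P by (auto simp: F_def)
    qed
  qed
  then show thesis using that P by (auto simp: F_def)
qed

lemma (in noetherian_ring) proper_ideal_subset_maximal_ideal:
  assumes "local_ring R \<mm>" and "ideal J R" and "J \<noteq> carrier R"
  shows "J \<subseteq> \<mm>"
proof -
  define F where "F = {K. ideal K R \<and> J \<subseteq> K \<and> K \<noteq> carrier R}"
  have "F \<noteq> {}" using assms(2,3) by (auto simp: F_def)
  then obtain P where P: "P \<in> F" and max: "\<And>K. \<lbrakk> K \<in> F; P \<subseteq> K \<rbrakk> \<Longrightarrow> K = P"
    by (rule maximal_element_in_ideal_family) (auto simp: F_def)
  have "maximalideal P R"
  proof (rule maximalidealI)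
    fix K assume "ideal K R" "P \<subseteq> K" "K \<subseteq> carrier R"
    then show "K = P \<or> K = carrier R" using max[of K] P by (auto simp: F_def)
  qed (use P in \<open>auto simp: F_def\<close>)
  then show ?thesis using assms(1) P by (auto simp: F_def local_ring_def)
qed

lemma (in cring) mem_maximal_ideal_iff:
  assumes "noetherian_ring R" and "local_ring R \<mm>" and "a \<in> carrier R"
  shows "a \<in> \<mm> \<longleftrightarrow> a \<notin> Units R"
proof
  have m: "maximalideal \<mm> R" using assms(2) by (auto simp: local_ring_def)
  interpret m: ideal \<mm> R using m by (simp add: maximalideal_def)
  show "a \<notin> Units R" if "a \<in> \<mm>"
  proof
    assume "a \<in> Units R"
    then have "inv a \<otimes> a = \<one>" "inv a \<in> carrier R" by auto
    then have "\<one> \<in> \<mm>" using m.I_l_closed[OF that, of "inv a"] by simp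
    then show False using m.one_imp_carrier maximalideal.I_notcarr[OF m] by simp
  qed
  show "a \<in> \<mm>" if "a \<notin> Units R"
    using noetherian_ring.proper_ideal_subset_maximal_ideal[OF assms(1,2) cgenideal_ideal[OF assms(3)]]
      cgenideal_self[OF assms(3)] ideal_eq_carrier_iff[OF assms(3)] that by auto
qed

lemma krull_dim_ge_4:
  assumes "primeideal A R" "primeideal B R" "primeideal C R" "primeideal D R" "primeideal E R"
    and "A \<subset> B" "B \<subset> C" "C \<subset> D" "D \<subset> E"
  shows "krull_dim R \<ge> 4"
proof -
  define P where "P = (\<lambda>i :: nat. [A, B, C, D, E] ! i)"
  have "\<forall>i\<le>4. primeideal (P i) R"
    using assms by (auto simp: P_def numeral_eq_Suc le_Suc_eq)
  moreover have "\<forall>i<4. P i \<subset> P (Suc i)"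
    using assms by (auto simp: P_def numeral_eq_Suc less_Suc_eq)
  ultimately have "ereal (real 4) \<le> krull_dim R"
    unfolding krull_dim_def by (intro SUP_upper) blast
  then show ?thesis by simp
qed

locale noetherian_factorial_domain = noetherian_ring R + factorial_domain R for R (structure)
begin

lemma exists_prime_divisor:
  assumes "x \<in> carrier R" "x \<noteq> \<zero>" "x \<notin> Units R"
  obtains p where "p \<in> carrier R" "ring_prime p" "p divides x"
proof -
  interpret noetherian_domain R ..
  obtain p where p: "p \<in> carrier R" "ring_irreducible p" "p divides x"
    using exists_irreducible_divisor assms by blast
  then have "prime (mult_of R) p"
    using factorial_monoid.irreducible_prime[of "mult_of R" p] ring_irreducibleE(1,3)[OF p(1,2)]
      factorial_domain_axioms p(1) by (simp add: factorial_domain_def)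
  then have "ring_prime p" using p ring_irreducibleE(1) ring_primeI' by blast
  then show thesis using that p by blast
qed

lemma prime_not_unit:
  assumes "p \<in> carrier R" "ring_prime p"
  shows "p \<notin> Units R"
  using assms unfolding ring_prime_def prime_def by simp

lemma prime_induct [consumes 2, case_names unit mult]:
  assumes "x \<in> carrier R" "x \<noteq> \<zero>"
    and unit: "\<And>u. u \<in> Units R \<Longrightarrow> Q u"
    and mult: "\<And>p x. \<lbrakk> p \<in> carrier R; ring_prime p; x \<in> carrier R; x \<noteq> \<zero>; Q x \<rbrakk> \<Longrightarrow> Q (p \<otimes> x)"
  shows "Q x"
proof (rule ccontr)
  assume "\<not> Q x"
  define F where "F = {PIdl z | z. z \<in> carrier R \<and> z \<noteq> \<zero> \<and> \<not> Q z}"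
  have "F \<noteq> {}" using assms(1,2) \<open>\<not> Q x\<close> by (auto simp: F_def)
  then obtain K where K: "K \<in> F" and max: "\<And>L. \<lbrakk> L \<in> F; K \<subseteq> L \<rbrakk> \<Longrightarrow> L = K"
    by (rule maximal_element_in_ideal_family) (auto simp: F_def cgenideal_ideal)
  obtain z where z: "K = PIdl z" "z \<in> carrier R" "z \<noteq> \<zero>" "\<not> Q z"
    using K by (auto simp: F_def)
  obtain p where p: "p \<in> carrier R" "ring_prime p" "p divides z"
    using exists_prime_divisor z unit by blast
  obtain w where w: "w \<in> carrier R" "z = p \<otimes> w" using p(3) by (auto simp: factor_def)
  have w0: "w \<noteq> \<zero>" using w(2) z(3) p(1) by (metis r_null)
  then have "\<not> Q w" using mult p w z by blast
  then have "PIdl w \<in> F" using w w0 by (auto simp: F_def)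
  moreover have "w divides z" using w p m_comm[of p w] by (auto simp: factor_def)
  then have "K \<subseteq> PIdl w" using to_contain_is_to_divide z w by auto
  ultimately have "PIdl w = PIdl z" using max z by auto
  then have "z divides w" using mem_cgenideal_iff[OF z(2)] cgenideal_self[OF w(1)] by auto
  then obtain c where c: "c \<in> carrier R" "w = (p \<otimes> w) \<otimes> c" using w by (auto simp: factor_def)
  then have "w \<otimes> \<one> = w \<otimes> (p \<otimes> c)" using w(1) p(1) m_assoc m_comm by simp
  then have "\<one> = p \<otimes> c" using m_lcancel[OF w0 w(1)] c(1) p(1) by simp
  then have "p divides \<one>" using c by (auto simp: factor_def)
  then show False using divides_one prime_not_unit p by blast
qed

lemma prime_divides_mult:
  assumes "p \<in> carrier R" "ring_prime p" "a \<in> carrier R" "b \<in> carrier R" "p divides a \<otimes> b"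
  shows "p divides a \<or> p divides b"
  using assms unfolding ring_prime_def prime_def by blast

lemma primeideal_cgenideal:
  assumes "p \<in> carrier R" "ring_prime p"
  shows "primeideal (PIdl p) R"
  using assms primeideal_iff_prime ring_primeE(1) by blast

lemma prime_ideal_contains_prime:
  assumes "primeideal P R" "P \<noteq> {\<zero>}"
  obtains p where "p \<in> P" "ring_prime p"
proof -
  interpret P: primeideal P R by fact
  obtain x where x: "x \<in> P" "x \<noteq> \<zero>" using assms(2) P.zero_closed by blast
  have "x \<in> carrier R" using x P.Icarr by simp
  then have "x \<in> P \<longrightarrow> (\<exists>p\<in>P. ring_prime p)" using x(2)
  proof (induction rule: prime_induct)
    case (unit u)
    have "\<one> \<in> P" if "u \<in> P"
      using P.I_l_closed[OF that, of "inv u"] unit by simp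
    then show ?case using P.one_imp_carrier P.I_notcarr by auto
  next
    case (mult p x)
    then show ?case using P.I_prime by blast
  qed
  then show thesis using x that by blast
qed

lemma content_factorization:
  assumes "ideal I R" "I \<noteq> {\<zero>}"
  obtains f J where "f \<in> carrier R" "f \<noteq> \<zero>" "ideal J R"
    and "\<And>a. a \<in> J \<Longrightarrow> f \<otimes> a \<in> I" and "\<And>b. b \<in> I \<Longrightarrow> \<exists>a\<in>J. b = f \<otimes> a"
    and "\<And>p. \<lbrakk> p \<in> carrier R; ring_prime p \<rbrakk> \<Longrightarrow> \<not> J \<subseteq> PIdl p"
proof -
  interpret I: ideal I R by fact
  obtain b where b: "b \<in> I" "b \<noteq> \<zero>" using assms(2) I.zero_closed by blast
  have bc: "b \<in> carrier R" using b I.Icarr by simp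
  define F where "F = {PIdl g | f g. f \<in> carrier R \<and> g \<in> carrier R \<and> b = f \<otimes> g \<and> I \<subseteq> PIdl f}"
  have "PIdl b \<in> F" unfolding F_def
    using bc ideal_eq_carrier_iff[of \<one>] I.a_subset Units_one_closed
    by (intro CollectI exI[of _ \<one>] exI[of _ b]) auto
  then have "F \<noteq> {}" by auto
  then obtain K where K: "K \<in> F" and max: "\<And>L. \<lbrakk> L \<in> F; K \<subseteq> L \<rbrakk> \<Longrightarrow> L = K"
    by (rule maximal_element_in_ideal_family) (auto simp: F_def cgenideal_ideal)
  obtain f g where fg: "K = PIdl g" "f \<in> carrier R" "g \<in> carrier R" "b = f \<otimes> g" "I \<subseteq> PIdl f"
    using K by (auto simp: F_def)
  have f0: "f \<noteq> \<zero>" and g0: "g \<noteq> \<zero>" using fg(2-4) b(2) by (metis l_null r_null)+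
  define J where "J = {r \<in> carrier R. f \<otimes> r \<in> I}"
  have JI: "f \<otimes> a \<in> I" if "a \<in> J" for a using that by (simp add: J_def)
  have IJ: "\<exists>a\<in>J. c = f \<otimes> a" if "c \<in> I" for c
  proof -
    have "f divides c" using that fg mem_cgenideal_iff by blast
    then show ?thesis using that by (auto simp: factor_def J_def)
  qed
  have J: "ideal J R"
  proof (rule idealI[OF ring_axioms])
    show "subgroup J (add_monoid R)"
      using fg(2) by unfold_locales
        (auto simp: J_def r_distr a_inv_def[symmetric] r_minus intro: I.a_closed I.a_inv_closed)
    show "x \<otimes> a \<in> J" and "a \<otimes> x \<in> J" if "a \<in> J" "x \<in> carrier R" for a x
    proof -
      have "f \<otimes> (x \<otimes> a) = x \<otimes> (f \<otimes> a)" using that fg(2) by (simp add: J_def m_lcomm)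
      then show "x \<otimes> a \<in> J" using that I.I_l_closed by (simp add: J_def)
      then show "a \<otimes> x \<in> J" using that by (simp add: J_def m_comm)
    qed
  qed
  have "\<not> J \<subseteq> PIdl p" if p: "p \<in> carrier R" "ring_prime p" for p
  proof
    assume Jp: "J \<subseteq> PIdl p"
    have "g \<in> J" using fg b by (simp add: J_def)
    then obtain h where h: "h \<in> carrier R" "g = p \<otimes> h"
      using Jp mem_cgenideal_iff[OF p(1)] by (auto simp: factor_def)
    have h0: "h \<noteq> \<zero>" using h(2) g0 p(1) by (metis r_null)
    have "I \<subseteq> PIdl (f \<otimes> p)"
    proof
      fix c assume "c \<in> I"
      then obtain a where a: "a \<in> J" "c = f \<otimes> a" using IJ by blast
      then obtain r where "r \<in> carrier R" "a = p \<otimes> r"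
        using Jp mem_cgenideal_iff[OF p(1)] by (auto simp: factor_def)
      then have "c = (f \<otimes> p) \<otimes> r" "r \<in> carrier R" using a fg p by (auto simp: m_assoc)
      then show "c \<in> PIdl (f \<otimes> p)"
        using mem_cgenideal_iff fg p by (auto simp: factor_def)
    qed
    then have "PIdl h \<in> F" unfolding F_def
      using h fg p by (intro CollectI exI[of _ "f \<otimes> p"] exI[of _ h]) (auto simp: m_assoc)
    moreover have "h divides g" using h p m_comm[of p h] by (auto simp: factor_def)
    then have "PIdl g \<subseteq> PIdl h" using to_contain_is_to_divide h fg by auto
    ultimately have "PIdl h = PIdl g" using max fg(1) by auto
    then have "g divides h" using mem_cgenideal_iff[OF fg(3)] cgenideal_self[OF h(1)] by auto
    then obtain c where c: "c \<in> carrier R" "h = (p \<otimes> h) \<otimes> c" using h by (auto simp: factor_def)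
    then have "h \<otimes> \<one> = h \<otimes> (p \<otimes> c)" using h(1) p(1) m_assoc m_comm by simp
    then have "\<one> = p \<otimes> c" using m_lcancel[OF h0 h(1)] c(1) p(1) by simp
    then have "p divides \<one>" using c by (auto simp: factor_def)
    then show False using divides_one prime_not_unit p by blast
  qed
  then show thesis using that fg(2) f0 J JI IJ by blast
qed

end

definition relatively_prime :: "('a, 'r) ring_scheme \<Rightarrow> 'a \<Rightarrow> 'a \<Rightarrow> bool" where
  "relatively_prime R x y \<longleftrightarrow>
     (\<forall>r\<in>carrier R. x divides\<^bsub>R\<^esub> (y \<otimes>\<^bsub>R\<^esub> r) \<longrightarrow> x divides\<^bsub>R\<^esub> r)"

lemma (in domain) relatively_prime_sym:
  assumes "x \<in> carrier R" "y \<in> carrier R" "x \<noteq> \<zero>" "relatively_prime R x y"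
  shows "relatively_prime R y x"
  unfolding relatively_prime_def
proof (intro ballI impI)
  fix r assume r: "r \<in> carrier R" "y divides x \<otimes> r"
  then obtain t where t: "t \<in> carrier R" "x \<otimes> r = y \<otimes> t" by (auto simp: factor_def)
  then have "x divides y \<otimes> t" using r(1) by (auto simp: factor_def intro!: bexI[of _ r])
  then have "x divides t" using assms(4) t(1) by (simp add: relatively_prime_def)
  then obtain u where u: "u \<in> carrier R" "t = x \<otimes> u" by (auto simp: factor_def)
  have "x \<otimes> r = x \<otimes> (y \<otimes> u)" using t(2) u assms(1,2) by (simp add: m_lcomm)
  then have "r = y \<otimes> u" using m_lcancel[OF assms(3,1)] r(1) u(1) assms(2) by simp
  then show "y divides r" using u(1) by (auto simp: factor_def)
qed

lemma (in domain) pow_divides_relatively_prime: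
  assumes "x \<in> carrier R" "y \<in> carrier R" "x \<noteq> \<zero>" "relatively_prime R x y"
  shows "r \<in> carrier R \<Longrightarrow> x [^] (k::nat) divides y \<otimes> r \<Longrightarrow> x [^] k divides r"
proof (induction k arbitrary: r)
  case 0
  then show ?case using one_divides by simp
next
  case (Suc k)
  then obtain t where t: "t \<in> carrier R" "y \<otimes> r = (x [^] k \<otimes> x) \<otimes> t" by (auto simp: factor_def)
  then have "y \<otimes> r = x \<otimes> (x [^] k \<otimes> t)" using assms(1) by (simp add: m_comm m_lcomm)
  then have "x divides y \<otimes> r" using t(1) assms(1) by (auto simp: factor_def)
  then have "x divides r" using assms(4) Suc.prems(1) by (simp add: relatively_prime_def)
  then obtain u where u: "u \<in> carrier R" "r = x \<otimes> u" by (auto simp: factor_def)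
  have "x \<otimes> (y \<otimes> u) = x \<otimes> (x [^] k \<otimes> t)"
    using \<open>y \<otimes> r = x \<otimes> (x [^] k \<otimes> t)\<close> u assms(1,2) by (simp add: m_lcomm)
  then have "y \<otimes> u = x [^] k \<otimes> t"
    using m_lcancel[OF assms(3,1)] u(1) t(1) assms(1,2) by simp
  then have "x [^] k divides y \<otimes> u" using t(1) by (auto simp: factor_def)
  then have "x [^] k divides u" using Suc.IH u(1) by blast
  then obtain v where v: "v \<in> carrier R" "u = x [^] k \<otimes> v" by (auto simp: factor_def)
  then have "r = (x [^] k \<otimes> x) \<otimes> v" using u assms(1) by (simp add: m_assoc m_lcomm)
  then show ?case using v(1) by (auto simp: factor_def)
qed

lemma (in domain) pow_divides_pow_mult_relatively_prime:
  assumes "x \<in> carrier R" "y \<in> carrier R" "x \<noteq> \<zero>" "relatively_prime R x y"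
  shows "r \<in> carrier R \<Longrightarrow> x [^] (k::nat) divides y [^] (j::nat) \<otimes> r \<Longrightarrow> x [^] k divides r"
proof (induction j arbitrary: r)
  case 0
  then show ?case by simp
next
  case (Suc j)
  have "y [^] Suc j \<otimes> r = y [^] j \<otimes> (y \<otimes> r)" using assms(2) Suc.prems(1) by (simp add: m_assoc)
  then show ?case
    using Suc.IH[of "y \<otimes> r"] Suc.prems pow_divides_relatively_prime[OF assms Suc.prems(1)] assms(2)
    by simp
qed

lemma (in cring) divides_mult_self:
  assumes "a \<in> carrier R" "b \<in> carrier R"
  shows "a divides a \<otimes> b"
  using assms by (auto simp: factor_def)

lemma (in cring) divides_addD:
  assumes "a \<in> carrier R" "b \<in> carrier R" "c \<in> carrier R" "a divides b" "a divides (b \<oplus> c)"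
  shows "a divides c"
proof -
  obtain s t where s: "s \<in> carrier R" "b = a \<otimes> s" and t: "t \<in> carrier R" "b \<oplus> c = a \<otimes> t"
    using assms(4,5) by (auto simp: factor_def)
  have "c = (b \<oplus> c) \<ominus> b" using assms(2,3) by algebra
  also have "\<dots> = a \<otimes> (t \<ominus> s)" unfolding t(2) unfolding s(2) using assms(1) s(1) t(1) by algebra
  finally show ?thesis using s(1) t(1) assms(1) divides_mult_self by simp
qed

context noetherian_factorial_domain
begin

lemma relatively_prime_common_prime_divisor:
  assumes "x \<in> carrier R" "y \<in> carrier R" "x \<noteq> \<zero>" "relatively_prime R x y"
    and "p \<in> carrier R" "ring_prime p"
  shows "\<not> (p divides x \<and> p divides y)"
proof
  assume "p divides x \<and> p divides y"
  then obtain s t where s: "s \<in> carrier R" "x = p \<otimes> s" and t: "t \<in> carrier R" "y = p \<otimes> t"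
    by (auto simp: factor_def)
  have "y \<otimes> s = x \<otimes> t" using s t assms(5) by (simp add: m_ac)
  then have "x divides y \<otimes> s" using assms(1) t(1) divides_mult_self by simp
  then have "x divides s" using assms(4) s(1) by (simp add: relatively_prime_def)
  then obtain c where c: "c \<in> carrier R" "s = (p \<otimes> s) \<otimes> c" using s by (auto simp: factor_def)
  have s0: "s \<noteq> \<zero>" using s(2) assms(3,5) by (metis r_null)
  have "s \<otimes> \<one> = s \<otimes> (p \<otimes> c)" using c s(1) assms(5) m_assoc m_comm by simp
  then have "\<one> = p \<otimes> c" using m_lcancel[OF s0 s(1)] c(1) assms(5) by simp
  then have "p divides \<one>" using c by (auto simp: factor_def)
  then show False using divides_one prime_not_unit assms(5,6) by blast
qed

lemma exists_relatively_prime_in_ideal: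
  assumes "ideal J R" and J: "\<And>p. \<lbrakk> p \<in> carrier R; ring_prime p \<rbrakk> \<Longrightarrow> \<not> J \<subseteq> PIdl p"
    and "x \<in> carrier R" "x \<noteq> \<zero>"
  shows "\<exists>y\<in>J. relatively_prime R x y"
  using assms(3,4)
proof (induction rule: prime_induct)
  interpret J: ideal J R by fact
  case (unit u)
  have "u divides r" if "r \<in> carrier R" for r
  proof -
    have "r = u \<otimes> (inv u \<otimes> r)"
      using that Units_r_inv[OF unit] Units_closed[OF unit] Units_inv_closed[OF unit]
      by (simp add: m_assoc[symmetric])
    then show ?thesis
      using that Units_closed[OF unit] Units_inv_closed[OF unit] by (auto simp: factor_def)
  qed
  then show ?case
    unfolding relatively_prime_def by (intro bexI[of _ \<zero>] ballI impI J.zero_closed)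
next
  interpret J: ideal J R by fact
  case (mult p x)
  then obtain y where y: "y \<in> J" "relatively_prime R x y" by blast
  have yc: "y \<in> carrier R" using y J.Icarr by simp
  note p = mult.hyps(1,2) and x = mult.hyps(3,4)
  have step: "relatively_prime R (p \<otimes> x) z"
    if z: "z \<in> carrier R" "relatively_prime R x z" "\<not> p divides z" for z
    unfolding relatively_prime_def
  proof (intro ballI impI)
    fix r assume r: "r \<in> carrier R" "p \<otimes> x divides z \<otimes> r"
    then obtain t where t: "t \<in> carrier R" "z \<otimes> r = (p \<otimes> x) \<otimes> t" by (auto simp: factor_def)
    then have "z \<otimes> r = p \<otimes> (x \<otimes> t)" using p(1) x(1) by (simp add: m_assoc)
    then have "p divides z \<otimes> r" using p(1) x(1) t(1) by (auto simp: factor_def)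
    then have "p divides r" using prime_divides_mult[OF p z(1) r(1)] z(3) by simp
    then obtain s where s: "s \<in> carrier R" "r = p \<otimes> s" by (auto simp: factor_def)
    have "p \<otimes> (z \<otimes> s) = p \<otimes> (x \<otimes> t)"
      using \<open>z \<otimes> r = p \<otimes> (x \<otimes> t)\<close> s z(1) p(1) by (simp add: m_lcomm)
    then have "z \<otimes> s = x \<otimes> t"
      using m_lcancel[of p] ring_primeE(1)[OF p] p(1) z(1) s(1) x(1) t(1) by simp
    then have "x divides s" using z(2) s(1) x(1) t(1) divides_mult_self
      by (simp add: relatively_prime_def)
    then show "p \<otimes> x divides r" using s divides_mult[OF x(1) p(1)] by simp
  qed
  show ?case
  proof (cases "p divides y")
    case False
    then show ?thesis using step y yc by blast
  next
    case True
    then have npx: "\<not> p divides x"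
      using relatively_prime_common_prime_divisor[OF x(1) yc x(2) y(2) p] by blast
    obtain z where z: "z \<in> J" "\<not> p divides z" using J[OF p] mem_cgenideal_iff[OF p(1)] by blast
    have zc: "z \<in> carrier R" using z J.Icarr by simp
    have "\<not> p divides x \<otimes> z" using prime_divides_mult[OF p x(1) zc] npx z(2) by blast
    then have "\<not> p divides (y \<oplus> x \<otimes> z)"
      using divides_addD[OF p(1) yc _ True] x(1) zc by blast
    moreover have "relatively_prime R x (y \<oplus> x \<otimes> z)"
      unfolding relatively_prime_def
    proof (intro ballI impI)
      fix r assume r: "r \<in> carrier R" "x divides (y \<oplus> x \<otimes> z) \<otimes> r"
      have "(y \<oplus> x \<otimes> z) \<otimes> r = x \<otimes> (z \<otimes> r) \<oplus> y \<otimes> r" using x(1) yc zc r(1) by algebra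
      then have "x divides y \<otimes> r"
        using divides_addD[OF x(1) _ _ divides_mult_self[OF x(1)], of "z \<otimes> r" "y \<otimes> r"] r x(1) yc zc
        by simp
      then show "x divides r" using y(2) r(1) by (simp add: relatively_prime_def)
    qed
    ultimately have "relatively_prime R (p \<otimes> x) (y \<oplus> x \<otimes> z)" using step x(1) yc zc by simp
    moreover have "y \<oplus> x \<otimes> z \<in> J" using y z x(1) by (simp add: J.I_l_closed)
    ultimately show ?thesis by blast
  qed
qed

lemma power_in_two_generated_ideal_outside_prime:
  assumes dim: "\<not> krull_dim R \<ge> 4" and P: "primeideal P R" and Q: "primeideal Q R" "P \<subset> Q"
    and xy: "x \<in> P" "y \<in> P" "x \<noteq> \<zero>" "relatively_prime R x y" and b: "b \<in> P"
  shows "\<exists>s\<in>carrier R - P. \<exists>n::nat. \<exists>r\<in>carrier R. \<exists>t\<in>carrier R. s \<otimes> b [^] n = r \<otimes> x \<oplus> t \<otimes> y"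
proof (rule ccontr)
  assume *: "\<not> ?thesis"
  interpret P: primeideal P R by fact
  have carr: "x \<in> carrier R" "y \<in> carrier R" "b \<in> carrier R" using xy b P.Icarr by auto
  define T where "T = {s \<otimes> b [^] n | s n. s \<in> carrier R - P \<and> n \<in> (UNIV :: nat set)}"
  define K where "K = PIdl x <+>\<^bsub>R\<^esub> PIdl y"
  have K: "ideal K R" unfolding K_def using carr by (intro add_ideals cgenideal_ideal)
  have "\<one> \<notin> P" using P.one_imp_carrier P.I_notcarr by auto
  have xK: "x \<in> K" and yK: "y \<in> K"
    using subset_set_add_cgenideal[OF cgenideal_ideal[OF carr(1)] carr(2)] cgenideal_self[OF carr(1)]
    by (auto simp: K_def)
  have KT: "K \<inter> T = {}"
  proof (rule ccontr)
    assume "K \<inter> T \<noteq> {}"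
    then obtain a where "a \<in> K" "a \<in> T" by blast
    obtain s n where s: "a = s \<otimes> b [^] (n::nat)" "s \<in> carrier R - P"
      using \<open>a \<in> T\<close> by (auto simp: T_def)
    obtain j t where j: "j \<in> PIdl x" "t \<in> carrier R" "a = j \<oplus> t \<otimes> y"
      using \<open>a \<in> K\<close> by (auto simp: K_def mem_set_add_cgenideal_iff[OF carr(2)])
    obtain r where "r \<in> carrier R" "j = r \<otimes> x" using j(1) by (auto simp: cgenideal_def)
    then show False using * s j(2,3) by metis
  qed
  obtain L where L: "primeideal L R" "K \<subseteq> L" "L \<inter> T = {}"
  proof (rule prime_ideal_avoiding_mult_closed[OF noetherian_ring_axioms K _ _ _ KT])
    show "T \<subseteq> carrier R" using carr by (auto simp: T_def)
    have "\<one> = \<one> \<otimes> b [^] (0::nat)" by simp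
    then show "\<one> \<in> T" using \<open>\<one> \<notin> P\<close> unfolding T_def by blast
    fix u v assume "u \<in> T" "v \<in> T"
    then obtain s m t n where st: "s \<in> carrier R - P" "u = s \<otimes> b [^] (m::nat)"
      "t \<in> carrier R - P" "v = t \<otimes> b [^] (n::nat)" by (auto simp: T_def)
    have "u \<otimes> v = (s \<otimes> t) \<otimes> b [^] (m + n)"
      using st carr by (simp add: m_ac nat_pow_mult[symmetric])
    moreover have "s \<otimes> t \<in> carrier R - P" using st P.I_prime by blast
    ultimately show "u \<otimes> v \<in> T" unfolding T_def by blast
  qed
  interpret L: primeideal L R by fact
  have "L \<subset> P"
  proof
    show "L \<subseteq> P"
    proof
      fix s assume s: "s \<in> L"
      show "s \<in> P"
      proof (rule ccontr)
        assume "s \<notin> P"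
        then have "s \<otimes> b [^] (0::nat) \<in> T" using L.Icarr[OF s] unfolding T_def by blast
        then show False using s L(3) L.Icarr[OF s] by auto
      qed
    qed
    have "\<one> \<otimes> b [^] (1::nat) \<in> T" using \<open>\<one> \<notin> P\<close> unfolding T_def by blast
    then have "b \<in> T" using carr by simp
    then show "L \<noteq> P" using b L(3) by auto
  qed
  have "L \<noteq> {\<zero>}" using xK L(2) xy(3) by auto
  then obtain p where p: "p \<in> L" "ring_prime p" using prime_ideal_contains_prime L(1) by blast
  have pc: "p \<in> carrier R" using p L.Icarr by simp
  have "{\<zero>} \<subset> PIdl p"
    using ring_primeE(1)[OF pc p(2)] cgenideal_self[OF pc]
      additive_subgroup.zero_closed[OF ideal.axioms(1)[OF cgenideal_ideal[OF pc]]] by auto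
  moreover have "PIdl p \<subset> L"
  proof
    show "PIdl p \<subseteq> L" using cgenideal_minimal[OF L.ideal_axioms p(1)] .
    show "PIdl p \<noteq> L"
      using relatively_prime_common_prime_divisor[OF carr(1,2) xy(3,4) pc p(2)] xK yK L(2)
        mem_cgenideal_iff[OF pc] by auto
  qed
  ultimately show False
    using dim krull_dim_ge_4[OF zeroprimeideal primeideal_cgenideal[OF pc p(2)] L(1) P Q(1)]
      \<open>L \<subset> P\<close> Q(2) by simp
qed

end

section \<open>Submodules, quotients and dimension\<close>

lemma (in abelian_group) a_inv_zero [simp]: "\<ominus> \<zero> = \<zero>"
  by (simp add: a_inv_def)

context module
begin

lemma zero_submodule: "submodule {\<zero>\<^bsub>M\<^esub>} R M"
  by (rule submoduleI) auto

lemma submodule_zero: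
  assumes "submodule N R M"
  shows "\<zero>\<^bsub>M\<^esub> \<in> N"
  using subgroup.one_closed[OF submodule.axioms(1)[OF assms]] by simp

lemma submodule_span_superset: "S \<subseteq> submodule_span R M S"
  unfolding submodule_span_def by auto

lemma submodule_span_minimal:
  assumes "submodule N R M" and "S \<subseteq> N"
  shows "submodule_span R M S \<subseteq> N"
  using assms unfolding submodule_span_def by auto

lemma submodule_span_is_submodule:
  assumes "S \<subseteq> carrier M"
  shows "submodule (submodule_span R M S) R M"
proof (rule submoduleI)
  show "submodule_span R M S \<subseteq> carrier M"
    using submodule_span_minimal[OF carrier_is_submodule assms] .
qed (auto simp: submodule_span_def submodule_zero submoduleE)

lemma submodule_smult_vimage:
  assumes "submodule N R M" and "c \<in> carrier R"
  shows "submodule {x \<in> carrier M. c \<odot>\<^bsub>M\<^esub> x \<in> N} R M"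
proof (rule submoduleI)
  fix a x assume a: "a \<in> carrier R" "x \<in> {x \<in> carrier M. c \<odot>\<^bsub>M\<^esub> x \<in> N}"
  then have "c \<odot>\<^bsub>M\<^esub> (a \<odot>\<^bsub>M\<^esub> x) = a \<odot>\<^bsub>M\<^esub> (c \<odot>\<^bsub>M\<^esub> x)"
    using assms(2) by (simp add: smult_assoc1[symmetric] R.m_comm)
  then show "a \<odot>\<^bsub>M\<^esub> x \<in> {x \<in> carrier M. c \<odot>\<^bsub>M\<^esub> x \<in> N}"
    using a submoduleE(4)[OF assms(1)] by simp
qed (use assms in \<open>auto simp: smult_r_distr smult_r_minus submodule_zero submoduleE\<close>)

lemma submodule_add_cyclic:
  assumes N: "submodule N R M" and s: "s \<in> carrier M"
  shows "submodule {n \<oplus>\<^bsub>M\<^esub> r \<odot>\<^bsub>M\<^esub> s | n r. n \<in> N \<and> r \<in> carrier R} R M" (is "submodule ?W R M")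
proof -
  have carr: "n \<in> carrier M" if "n \<in> N" for n using that submoduleE(1)[OF N] by blast
  show ?thesis
  proof (rule submoduleI)
    show "?W \<subseteq> carrier M" using carr s by auto
    have "\<zero>\<^bsub>M\<^esub> = \<zero>\<^bsub>M\<^esub> \<oplus>\<^bsub>M\<^esub> \<zero> \<odot>\<^bsub>M\<^esub> s" using s by simp
    then show "\<zero>\<^bsub>M\<^esub> \<in> ?W" using submodule_zero[OF N] by blast
  next
    fix w assume "w \<in> ?W"
    then obtain n r where w: "n \<in> N" "r \<in> carrier R" "w = n \<oplus>\<^bsub>M\<^esub> r \<odot>\<^bsub>M\<^esub> s" by blast
    have "\<ominus>\<^bsub>M\<^esub> w = \<ominus>\<^bsub>M\<^esub> n \<oplus>\<^bsub>M\<^esub> (\<ominus> r) \<odot>\<^bsub>M\<^esub> s"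
      using w carr s by (simp add: M.minus_add smult_l_minus)
    then show "\<ominus>\<^bsub>M\<^esub> w \<in> ?W" using w submoduleE(3)[OF N] by blast
  next
    fix v w assume "v \<in> ?W" "w \<in> ?W"
    then obtain n r m t where v: "n \<in> N" "r \<in> carrier R" "v = n \<oplus>\<^bsub>M\<^esub> r \<odot>\<^bsub>M\<^esub> s"
      and w: "m \<in> N" "t \<in> carrier R" "w = m \<oplus>\<^bsub>M\<^esub> t \<odot>\<^bsub>M\<^esub> s" by blast
    have "v \<oplus>\<^bsub>M\<^esub> w = (n \<oplus>\<^bsub>M\<^esub> m) \<oplus>\<^bsub>M\<^esub> (r \<oplus> t) \<odot>\<^bsub>M\<^esub> s"
      using v w carr s by (simp add: smult_l_distr M.a_ac)
    then show "v \<oplus>\<^bsub>M\<^esub> w \<in> ?W" using v w submoduleE(5)[OF N] by blast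
  next
    fix a w assume a: "a \<in> carrier R" and "w \<in> ?W"
    then obtain n r where w: "n \<in> N" "r \<in> carrier R" "w = n \<oplus>\<^bsub>M\<^esub> r \<odot>\<^bsub>M\<^esub> s" by blast
    have "a \<odot>\<^bsub>M\<^esub> w = a \<odot>\<^bsub>M\<^esub> n \<oplus>\<^bsub>M\<^esub> (a \<otimes> r) \<odot>\<^bsub>M\<^esub> s"
      using w carr s a by (simp add: smult_r_distr smult_assoc1)
    then show "a \<odot>\<^bsub>M\<^esub> w \<in> ?W" using a w submoduleE(4)[OF N] by blast
  qed
qed

lemma submodule_abelian_subgroup:
  assumes "submodule N R M"
  shows "abelian_subgroup N M"
  using assms by (intro abelian_subgroupI3 additive_subgroup.intro M.abelian_group_axioms submodule.axioms(1))

lemma coset_eq_iff: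
  assumes "submodule N R M" "x \<in> carrier M" "y \<in> carrier M"
  shows "N +>\<^bsub>M\<^esub> x = N +>\<^bsub>M\<^esub> y \<longleftrightarrow> x \<ominus>\<^bsub>M\<^esub> y \<in> N"
proof -
  interpret N: abelian_subgroup N M using submodule_abelian_subgroup[OF assms(1)] .
  show ?thesis
    using N.a_rcos_module[OF assms(3,2)] N.a_repr_independence'[of x y] N.a_rcos_self[OF assms(2)] assms(3)
    by (metis a_minus_def)
qed

lemma coset_zero:
  assumes "submodule N R M"
  shows "N +>\<^bsub>M\<^esub> \<zero>\<^bsub>M\<^esub> = N"
  using abelian_subgroup.a_rcos_const[OF submodule_abelian_subgroup submodule_zero] assms by blast

lemma coset_eq_self_iff:
  assumes "submodule N R M" "x \<in> carrier M"
  shows "N +>\<^bsub>M\<^esub> x = N \<longleftrightarrow> x \<in> N"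
  using coset_eq_iff[OF assms M.zero_closed] coset_zero[OF assms(1)] assms(2)
  by (simp add: a_minus_def)

lemma quot_module_carrier:
  "carrier (quot_module M N) = (\<lambda>x. N +>\<^bsub>M\<^esub> x) ` carrier M"
  by (auto simp: quot_module_def A_RCOSETS_def')

lemma quot_module_zero: "\<zero>\<^bsub>quot_module M N\<^esub> = N"
  by (simp add: quot_module_def)

lemma quot_module_add:
  assumes "submodule N R M" "x \<in> carrier M" "y \<in> carrier M"
  shows "(N +>\<^bsub>M\<^esub> x) \<oplus>\<^bsub>quot_module M N\<^esub> (N +>\<^bsub>M\<^esub> y) = N +>\<^bsub>M\<^esub> (x \<oplus>\<^bsub>M\<^esub> y)"
  using abelian_subgroup.a_rcos_sum[OF submodule_abelian_subgroup[OF assms(1)] assms(2,3)]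
  by (simp add: quot_module_def)

lemma quot_module_smult:
  assumes "submodule N R M" "a \<in> carrier R" "x \<in> carrier M"
  shows "a \<odot>\<^bsub>quot_module M N\<^esub> (N +>\<^bsub>M\<^esub> x) = N +>\<^bsub>M\<^esub> (a \<odot>\<^bsub>M\<^esub> x)"
proof -
  interpret N: abelian_subgroup N M using submodule_abelian_subgroup[OF assms(1)] .
  have "N +>\<^bsub>M\<^esub> (a \<odot>\<^bsub>M\<^esub> y) = N +>\<^bsub>M\<^esub> (a \<odot>\<^bsub>M\<^esub> x)" if y: "y \<in> N +>\<^bsub>M\<^esub> x" for y
  proof -
    have yc: "y \<in> carrier M" using y N.a_elemrcos_carrier assms(3) by blast
    have "y \<oplus>\<^bsub>M\<^esub> \<ominus>\<^bsub>M\<^esub> x \<in> N" using y N.a_rcos_module_imp assms(3) by blast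
    then have "a \<odot>\<^bsub>M\<^esub> (y \<oplus>\<^bsub>M\<^esub> \<ominus>\<^bsub>M\<^esub> x) \<in> N" using submoduleE(4)[OF assms(1,2)] by blast
    then have "a \<odot>\<^bsub>M\<^esub> y \<ominus>\<^bsub>M\<^esub> a \<odot>\<^bsub>M\<^esub> x \<in> N"
      using yc assms(2,3) by (simp add: smult_r_distr smult_r_minus a_minus_def)
    then show ?thesis using coset_eq_iff[OF assms(1)] yc assms(2,3) by simp
  qed
  then have "(\<Union>y\<in>N +>\<^bsub>M\<^esub> x. N +>\<^bsub>M\<^esub> (a \<odot>\<^bsub>M\<^esub> y)) = N +>\<^bsub>M\<^esub> (a \<odot>\<^bsub>M\<^esub> x)"
    using N.a_rcos_self[OF assms(3)] by (intro SUP_eq_const) blast+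
  then show ?thesis by (simp add: quot_module_def)
qed

lemma annihilator_quot_module:
  assumes "submodule N R M"
  shows "annihilator R (quot_module M N) = {a \<in> carrier R. \<forall>x\<in>carrier M. a \<odot>\<^bsub>M\<^esub> x \<in> N}"
  unfolding annihilator_def quot_module_zero quot_module_carrier
  by (simp add: quot_module_smult[OF assms] coset_eq_self_iff[OF assms] cong: conj_cong)

lemma ideal_annihilator_quot_module:
  assumes N: "submodule N R M"
  shows "ideal (annihilator R (quot_module M N)) R"
  unfolding annihilator_quot_module[OF N]
proof (rule idealI[OF R.ring_axioms])
  show "subgroup {a \<in> carrier R. \<forall>x\<in>carrier M. a \<odot>\<^bsub>M\<^esub> x \<in> N} (add_monoid R)"
    using N by unfold_locales
      (auto simp: smult_l_distr a_inv_def[symmetric] smult_l_minus submodule_zero submoduleE)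
qed (use N in \<open>auto simp: smult_assoc1 submoduleE\<close>)

lemma ideal_smult_submodule:
  assumes "ideal I R"
  shows "submodule (ideal_smult R I M) R M"
  unfolding ideal_smult_def using ideal.Icarr[OF assms] by (intro submodule_span_is_submodule) auto

lemma ideal_subset_annihilator:
  assumes "ideal I R"
  shows "I \<subseteq> annihilator R (quot_module M (ideal_smult R I M))"
  unfolding annihilator_quot_module[OF ideal_smult_submodule[OF assms]]
proof (intro subsetI CollectI conjI ballI)
  fix a x assume a: "a \<in> I"
  then show "a \<in> carrier R" using ideal.Icarr[OF assms] by simp
  assume "x \<in> carrier M"
  then have "a \<odot>\<^bsub>M\<^esub> x \<in> {a \<odot>\<^bsub>M\<^esub> x | a x. a \<in> I \<and> x \<in> carrier M}" using a by blast
  then show "a \<odot>\<^bsub>M\<^esub> x \<in> ideal_smult R I M"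
    unfolding ideal_smult_def using submodule_span_superset by (rule subsetD[rotated])
qed

end

lemma (in ring_hom_ring) prime_chain_vimage:
  assumes "cring R" and surj: "h ` carrier R = carrier S"
    and P: "\<forall>i\<le>k. primeideal (P i) S" "\<forall>i<k. P i \<subset> P (Suc i)"
  defines "Q \<equiv> \<lambda>i :: nat. {r \<in> carrier R. h r \<in> P i}"
  shows "\<forall>i\<le>k. primeideal (Q i) R" "\<forall>i<k. Q i \<subset> Q (Suc i)"
proof -
  show "\<forall>i\<le>k. primeideal (Q i) R" unfolding Q_def using primeideal_vimage[OF assms(1)] P(1) by blast
  show "\<forall>i<k. Q i \<subset> Q (Suc i)"
  proof (intro allI impI)
    fix i assume i: "i < k"
    then obtain s where s: "s \<in> P (Suc i)" "s \<notin> P i" using P(2) by blast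
    have "ideal (P (Suc i)) S" using P(1) i by (simp add: primeideal_def)
    from ideal.Icarr[OF this s(1)] have "s \<in> h ` carrier R" using surj by simp
    then obtain r where "r \<in> carrier R" "s = h r" by blast
    then have "r \<in> Q (Suc i)" "r \<notin> Q i" using s by (simp_all add: Q_def)
    moreover have "Q i \<subseteq> Q (Suc i)" using P(2) i by (auto simp: Q_def)
    ultimately show "Q i \<subset> Q (Suc i)" by blast
  qed
qed

lemma krull_dim_surjective_hom:
  assumes "ring_hom_ring R S h" "cring R" "h ` carrier R = carrier S"
  shows "krull_dim S \<le> krull_dim R"
  unfolding krull_dim_def
proof (rule SUP_subset_mono, intro subsetI CollectI)
  fix k :: nat assume "k \<in> {k. \<exists>P. (\<forall>i\<le>k. primeideal (P i) S) \<and> (\<forall>i<k. P i \<subset> P (Suc i))}"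
  then obtain P where P: "\<forall>i\<le>k. primeideal (P i) S" "\<forall>i<k. P i \<subset> P (Suc i)" by auto
  show "\<exists>P. (\<forall>i\<le>k. primeideal (P i) R) \<and> (\<forall>i<k. P i \<subset> P (Suc i))"
    using ring_hom_ring.prime_chain_vimage[OF assms P]
    by (intro exI[of _ "\<lambda>i. {r \<in> carrier R. h r \<in> P i}"] conjI)
qed simp

lemma (in cring) krull_dim_quot_zero: "krull_dim (R Quot {\<zero>}) = krull_dim R"
proof (rule antisym)
  show "krull_dim (R Quot {\<zero>}) \<le> krull_dim R"
    using krull_dim_surjective_hom[OF ideal.rcos_ring_hom_ring[OF zeroideal] is_cring]
    by (auto simp: FactRing_def A_RCOSETS_def')
  obtain h where h: "h \<in> ring_iso (R Quot {\<zero>}) R"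
    using FactRing_zeroideal(1) by (auto simp: is_ring_iso_def)
  have quot: "cring (R Quot {\<zero>})" using ideal.quotient_is_cring[OF zeroideal is_cring] .
  have "ring_hom_ring (R Quot {\<zero>}) R h"
    using h quot ring_axioms by (intro ring_hom_ringI2) (auto simp: ring_iso_def cring_def)
  moreover have "h ` carrier (R Quot {\<zero>}) = carrier R"
    using h by (auto simp: ring_iso_def bij_betw_def)
  ultimately show "krull_dim R \<le> krull_dim (R Quot {\<zero>})"
    using krull_dim_surjective_hom[OF _ quot] by simp
qed

lemma (in cring) prime_chain_over_ideal:
  assumes "ideal K R"
    and P: "\<forall>i\<le>k. primeideal (P i) (R Quot K)" "\<forall>i<k. P i \<subset> P (Suc i)"
  obtains Q where "\<forall>i\<le>k. primeideal (Q i) R \<and> K \<subseteq> Q i" "\<forall>i<k::nat. Q i \<subset> Q (Suc i)"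
proof -
  define Q where "Q = (\<lambda>i. {r \<in> carrier R. K +> r \<in> P i})"
  have surj: "(+>) K ` carrier R = carrier (R Quot K)" by (auto simp: FactRing_def A_RCOSETS_def')
  have Q: "\<forall>i\<le>k. primeideal (Q i) R" "\<forall>i<k. Q i \<subset> Q (Suc i)"
    unfolding Q_def
    using ring_hom_ring.prime_chain_vimage[OF ideal.rcos_ring_hom_ring[OF assms(1)] is_cring surj P]
    by simp_all
  have "K \<subseteq> Q i" if "i \<le> k" for i
  proof
    fix a assume a: "a \<in> K"
    have "ideal (P i) (R Quot K)" using P(1) that by (simp add: primeideal_def)
    note additive_subgroup.zero_closed[OF ideal.axioms(1)[OF this]]
    then show "a \<in> Q i"
      using a_rcos_zero[OF assms(1) a] ideal.Icarr[OF assms(1) a] by (simp add: Q_def FactRing_def)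
  qed
  then show thesis using that[of Q] Q by simp
qed

lemma (in noetherian_factorial_domain) two_dimensional_quotient:
  assumes dim: "\<not> krull_dim R \<ge> 4" and K: "ideal K R" "K \<noteq> {\<zero>}" and "krull_dim (R Quot K) > 1"
  shows "krull_dim (R Quot K) = 2"
    and "\<exists>A B C. primeideal A R \<and> primeideal B R \<and> primeideal C R \<and> K \<subseteq> A \<and> A \<subset> B \<and> B \<subset> C"
proof -
  let ?C = "{k. \<exists>P :: nat \<Rightarrow> 'a set set. (\<forall>i\<le>k. primeideal (P i) (R Quot K)) \<and> (\<forall>i<k. P i \<subset> P (Suc i))}"
  have "k \<le> 2" if k: "k \<in> ?C" for k
  proof (rule ccontr)
    assume "\<not> k \<le> 2"
    obtain P where P: "\<forall>i\<le>k. primeideal (P i) (R Quot K)" "\<forall>i<k. P i \<subset> P (Suc i)"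
      using k by auto
    obtain Q where Q: "\<forall>i\<le>k. primeideal (Q i) R \<and> K \<subseteq> Q i" "\<forall>i<k. Q i \<subset> Q (Suc i)"
      using prime_chain_over_ideal[OF K(1) P] .
    have "ideal (Q 0) R" using Q(1) by (simp add: primeideal_def)
    note additive_subgroup.zero_closed[OF ideal.axioms(1)[OF this]]
    moreover have "K \<subseteq> Q 0" "\<zero> \<in> K"
      using Q(1) additive_subgroup.zero_closed[OF ideal.axioms(1)[OF K(1)]] by simp_all
    ultimately have "{\<zero>} \<subset> Q 0" using K(2) by blast
    moreover have "Q 0 \<subset> Q 1" "Q 1 \<subset> Q 2" "Q 2 \<subset> Q 3"
      using Q(2) \<open>\<not> k \<le> 2\<close> by (auto simp: numeral_eq_Suc)
    ultimately show False
      using dim krull_dim_ge_4[OF zeroprimeideal, of "Q 0" "Q 1" "Q 2" "Q 3"] Q(1) \<open>\<not> k \<le> 2\<close>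
      by simp
  qed
  then have "krull_dim (R Quot K) \<le> 2"
    unfolding krull_dim_def by (intro SUP_least) simp
  moreover obtain k where k: "k \<in> ?C" "1 < ereal (real k)"
    using assms(4) unfolding krull_dim_def less_SUP_iff by auto
  then have "ereal (real k) \<le> krull_dim (R Quot K)"
    unfolding krull_dim_def by (intro SUP_upper)
  have "2 \<le> k" using k(2) by simp
  then have "2 \<le> ereal (real k)" by simp
  from order_trans[OF this \<open>ereal (real k) \<le> krull_dim (R Quot K)\<close>]
  have "2 \<le> krull_dim (R Quot K)" .
  ultimately show "krull_dim (R Quot K) = 2" by (meson antisym order_trans)
  obtain P where P: "\<forall>i\<le>k. primeideal (P i) (R Quot K)" "\<forall>i<k. P i \<subset> P (Suc i)"
      using k by auto
  obtain Q where "\<forall>i\<le>k. primeideal (Q i) R \<and> K \<subseteq> Q i" "\<forall>i<k. Q i \<subset> Q (Suc i)"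
    using prime_chain_over_ideal[OF K(1) P] .
  then have "primeideal (Q 0) R \<and> primeideal (Q 1) R \<and> primeideal (Q 2) R \<and> K \<subseteq> Q 0 \<and> Q 0 \<subset> Q 1 \<and> Q 1 \<subset> Q 2"
    using \<open>2 \<le> k\<close> by (auto simp: numeral_eq_Suc)
  then show "\<exists>A B C. primeideal A R \<and> primeideal B R \<and> primeideal C R \<and> K \<subseteq> A \<and> A \<subset> B \<and> B \<subset> C"
    by blast
qed

lemma (in domain) killed_or_rank_one_quotient:
  assumes "module R M" and "finite S" and "S \<subseteq> carrier M"
  shows "(\<exists>c\<in>carrier R - {\<zero>}. \<forall>x\<in>S. c \<odot>\<^bsub>M\<^esub> x = \<zero>\<^bsub>M\<^esub>) \<or>
    (\<exists>c\<in>carrier R - {\<zero>}. \<exists>N s. submodule N R M \<and> s \<in> carrier M \<and>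
      (\<forall>r\<in>carrier R. r \<odot>\<^bsub>M\<^esub> s \<in> N \<longrightarrow> r = \<zero>) \<and>
      (\<forall>x\<in>S. c \<odot>\<^bsub>M\<^esub> x \<in> {n \<oplus>\<^bsub>M\<^esub> r \<odot>\<^bsub>M\<^esub> s | n r. n \<in> N \<and> r \<in> carrier R}))"
  using assms(2,3)
proof (induction S)
  case empty
  then show ?case by (intro disjI1 bexI[of _ \<one>]) auto
next
  interpret M: module R M by fact
  case (insert b S)
  have b: "b \<in> carrier M" and S: "S \<subseteq> carrier M" using insert.prems by auto
  have new: ?case
    if c: "c \<in> carrier R" "c \<noteq> \<zero>" and W: "submodule W R M" "\<forall>x\<in>S. c \<odot>\<^bsub>M\<^esub> x \<in> W"
      and indep: "\<forall>r\<in>carrier R. r \<odot>\<^bsub>M\<^esub> b \<in> W \<longrightarrow> r = \<zero>" for c W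
  proof (intro disjI2 bexI[of _ c] exI[of _ W] exI[of _ b] conjI ballI)
    fix x assume "x \<in> insert b S"
    then consider "x = b" | "x \<in> S" by blast
    then show "c \<odot>\<^bsub>M\<^esub> x \<in> {n \<oplus>\<^bsub>M\<^esub> r \<odot>\<^bsub>M\<^esub> b | n r. n \<in> W \<and> r \<in> carrier R}"
    proof cases
      case 1
      have "c \<odot>\<^bsub>M\<^esub> b = \<zero>\<^bsub>M\<^esub> \<oplus>\<^bsub>M\<^esub> c \<odot>\<^bsub>M\<^esub> b" using c(1) b by simp
      then show ?thesis using 1 c(1) M.submodule_zero[OF W(1)] by blast
    next
      case 2
      have "c \<odot>\<^bsub>M\<^esub> x = c \<odot>\<^bsub>M\<^esub> x \<oplus>\<^bsub>M\<^esub> \<zero> \<odot>\<^bsub>M\<^esub> b" using c(1) b S 2 by auto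
      then show ?thesis using 2 W(2) by blast
    qed
  qed (use c W b indep in auto)
  from insert.IH[OF S] show ?case
  proof (elim disjE bexE exE conjE)
    fix c assume c: "c \<in> carrier R - {\<zero>}" "\<forall>x\<in>S. c \<odot>\<^bsub>M\<^esub> x = \<zero>\<^bsub>M\<^esub>"
    show ?case
    proof (cases "\<forall>r\<in>carrier R. r \<odot>\<^bsub>M\<^esub> b \<in> {\<zero>\<^bsub>M\<^esub>} \<longrightarrow> r = \<zero>")
      case True
      then show ?thesis using new[of c "{\<zero>\<^bsub>M\<^esub>}"] c M.zero_submodule by simp
    next
      case False
      then obtain r where r: "r \<in> carrier R" "r \<odot>\<^bsub>M\<^esub> b = \<zero>\<^bsub>M\<^esub>" "r \<noteq> \<zero>" by auto
      have "(c \<otimes> r) \<odot>\<^bsub>M\<^esub> x = \<zero>\<^bsub>M\<^esub>" if "x \<in> insert b S" for x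
      proof (cases "x = b")
        case True
        then show ?thesis using c r b by (simp add: M.smult_assoc1)
      next
        case False
        then have "x \<in> carrier M" "c \<odot>\<^bsub>M\<^esub> x = \<zero>\<^bsub>M\<^esub>" using that c(2) S by auto
        then show ?thesis using c(1) r(1) by (simp add: M.smult_assoc1 m_comm[of c r])
      qed
      moreover have "c \<otimes> r \<in> carrier R - {\<zero>}" using c(1) r(1,3) integral_iff by simp
      ultimately show ?thesis by blast
    qed
  next
    fix c N s
    let ?W = "{n \<oplus>\<^bsub>M\<^esub> r \<odot>\<^bsub>M\<^esub> s | n r. n \<in> N \<and> r \<in> carrier R}"
    assume c: "c \<in> carrier R - {\<zero>}" and N: "submodule N R M" and s: "s \<in> carrier M"
      and indep: "\<forall>r\<in>carrier R. r \<odot>\<^bsub>M\<^esub> s \<in> N \<longrightarrow> r = \<zero>" and SW: "\<forall>x\<in>S. c \<odot>\<^bsub>M\<^esub> x \<in> ?W"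
    have W: "submodule ?W R M" using M.submodule_add_cyclic[OF N s] .
    show ?case
    proof (cases "\<forall>r\<in>carrier R. r \<odot>\<^bsub>M\<^esub> b \<in> ?W \<longrightarrow> r = \<zero>")
      case True
      then show ?thesis using new[OF _ _ W SW] c by simp
    next
      case False
      then obtain r where r: "r \<in> carrier R" "r \<odot>\<^bsub>M\<^esub> b \<in> ?W" "r \<noteq> \<zero>" by blast
      have "(c \<otimes> r) \<odot>\<^bsub>M\<^esub> x \<in> ?W" if "x \<in> insert b S" for x
      proof (cases "x = b")
        case True
        have "(c \<otimes> r) \<odot>\<^bsub>M\<^esub> b = c \<odot>\<^bsub>M\<^esub> (r \<odot>\<^bsub>M\<^esub> b)" using c r b by (simp add: M.smult_assoc1)
        then show ?thesis using True M.submoduleE(4)[OF W, of c] c r(2) by simp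
      next
        case False
        then have x: "x \<in> carrier M" "c \<odot>\<^bsub>M\<^esub> x \<in> ?W" using that SW S by auto
        have "(c \<otimes> r) \<odot>\<^bsub>M\<^esub> x = r \<odot>\<^bsub>M\<^esub> (c \<odot>\<^bsub>M\<^esub> x)"
          using c r(1) x(1) by (simp add: M.smult_assoc1 m_comm[of c r])
        then show ?thesis using M.submoduleE(4)[OF W r(1) x(2)] by simp
      qed
      moreover have "c \<otimes> r \<in> carrier R - {\<zero>}" using c r(1,3) integral_iff by simp
      ultimately show ?thesis using N s indep by (intro disjI2 bexI[of _ "c \<otimes> r"] exI[of _ N] exI[of _ s]) auto
    qed
  qed
qed

lemma (in domain) exists_nonzero_functional:
  assumes "module R M" "finitely_generated_module R M" "faithful_module R M"
  obtains \<phi> u where "\<phi> \<in> carrier M \<rightarrow> carrier R"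
    and "\<And>x y. \<lbrakk> x \<in> carrier M; y \<in> carrier M \<rbrakk> \<Longrightarrow> \<phi> (x \<oplus>\<^bsub>M\<^esub> y) = \<phi> x \<oplus> \<phi> y"
    and "\<And>a x. \<lbrakk> a \<in> carrier R; x \<in> carrier M \<rbrakk> \<Longrightarrow> \<phi> (a \<odot>\<^bsub>M\<^esub> x) = a \<otimes> \<phi> x"
    and "u \<in> carrier M" and "\<phi> u \<noteq> \<zero>"
proof -
  interpret M: module R M by fact
  obtain S where S: "finite S" "S \<subseteq> carrier M" "submodule_span R M S = carrier M"
    using assms(2) by (auto simp: finitely_generated_module_def)
  have span: "c \<odot>\<^bsub>M\<^esub> x \<in> W"
    if "submodule W R M" "c \<in> carrier R" "\<forall>x\<in>S. c \<odot>\<^bsub>M\<^esub> x \<in> W" "x \<in> carrier M" for c W x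
    using M.submodule_span_minimal[OF M.submodule_smult_vimage[OF that(1,2)], of S] that(3,4) S(2,3)
    by auto
  have "\<not> (\<exists>c\<in>carrier R - {\<zero>}. \<forall>x\<in>S. c \<odot>\<^bsub>M\<^esub> x = \<zero>\<^bsub>M\<^esub>)"
  proof
    assume "\<exists>c\<in>carrier R - {\<zero>}. \<forall>x\<in>S. c \<odot>\<^bsub>M\<^esub> x = \<zero>\<^bsub>M\<^esub>"
    then obtain c where c: "c \<in> carrier R" "c \<noteq> \<zero>" "\<forall>x\<in>S. c \<odot>\<^bsub>M\<^esub> x \<in> {\<zero>\<^bsub>M\<^esub>}" by auto
    then have "c \<in> annihilator R M"
      using span[OF M.zero_submodule c(1,3)] by (simp add: annihilator_def)
    then show False using assms(3) c(2) by (simp add: faithful_module_def)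
  qed
  then obtain c N s where cc: "c \<in> carrier R - {\<zero>}" and N: "submodule N R M" and s: "s \<in> carrier M"
    and indep': "\<forall>r\<in>carrier R. r \<odot>\<^bsub>M\<^esub> s \<in> N \<longrightarrow> r = \<zero>"
    and SW: "\<forall>x\<in>S. c \<odot>\<^bsub>M\<^esub> x \<in> {n \<oplus>\<^bsub>M\<^esub> r \<odot>\<^bsub>M\<^esub> s | n r. n \<in> N \<and> r \<in> carrier R}"
    using killed_or_rank_one_quotient[OF assms(1) S(1,2)] by blast
  have c: "c \<in> carrier R" "c \<noteq> \<zero>" using cc by simp_all
  have indep: "r = \<zero>" if "r \<in> carrier R" "r \<odot>\<^bsub>M\<^esub> s \<in> N" for r
    using indep' that by blast
  have Ncarr: "n \<in> carrier M" if "n \<in> N" for n using that M.submoduleE(1)[OF N] by blast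
  have coord: "\<exists>r. r \<in> carrier R \<and> c \<odot>\<^bsub>M\<^esub> x \<ominus>\<^bsub>M\<^esub> r \<odot>\<^bsub>M\<^esub> s \<in> N" if x: "x \<in> carrier M" for x
  proof -
    obtain n r where n: "n \<in> N" "r \<in> carrier R" "c \<odot>\<^bsub>M\<^esub> x = n \<oplus>\<^bsub>M\<^esub> r \<odot>\<^bsub>M\<^esub> s"
      using span[OF M.submodule_add_cyclic[OF N s] c(1) SW x] by blast
    then have "c \<odot>\<^bsub>M\<^esub> x \<ominus>\<^bsub>M\<^esub> r \<odot>\<^bsub>M\<^esub> s = n"
      using Ncarr s by (simp add: a_minus_def M.M.a_assoc M.M.r_neg)
    then show ?thesis using n by auto
  qed
  define \<phi> where "\<phi> x = (SOME r. r \<in> carrier R \<and> c \<odot>\<^bsub>M\<^esub> x \<ominus>\<^bsub>M\<^esub> r \<odot>\<^bsub>M\<^esub> s \<in> N)" for x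
  have \<phi>: "\<phi> x \<in> carrier R" "c \<odot>\<^bsub>M\<^esub> x \<ominus>\<^bsub>M\<^esub> \<phi> x \<odot>\<^bsub>M\<^esub> s \<in> N" if "x \<in> carrier M" for x
    using someI_ex[OF coord[OF that]] unfolding \<phi>_def by simp_all
  have unique: "\<phi> x = r"
    if x: "x \<in> carrier M" and r: "r \<in> carrier R" "c \<odot>\<^bsub>M\<^esub> x \<ominus>\<^bsub>M\<^esub> r \<odot>\<^bsub>M\<^esub> s \<in> N" for x r
  proof -
    have "(c \<odot>\<^bsub>M\<^esub> x \<ominus>\<^bsub>M\<^esub> r \<odot>\<^bsub>M\<^esub> s) \<ominus>\<^bsub>M\<^esub> (c \<odot>\<^bsub>M\<^esub> x \<ominus>\<^bsub>M\<^esub> \<phi> x \<odot>\<^bsub>M\<^esub> s) = (\<phi> x \<ominus> r) \<odot>\<^bsub>M\<^esub> s"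
      using x r(1) \<phi>(1)[OF x] c(1) s
      by (simp add: a_minus_def M.smult_l_distr M.smult_l_minus M.M.minus_add M.M.a_ac M.M.r_neg2
          M.M.r_neg1 M.M.r_neg M.M.l_neg)
    moreover have "v \<ominus>\<^bsub>M\<^esub> w \<in> N" if "v \<in> N" "w \<in> N" for v w
      using that M.submoduleE(3,5)[OF N] by (simp add: a_minus_def)
    ultimately have "(\<phi> x \<ominus> r) \<odot>\<^bsub>M\<^esub> s \<in> N" using r(2) \<phi>(2)[OF x] by metis
    then have "\<phi> x \<ominus> r = \<zero>" using indep \<phi>(1)[OF x] r(1) by simp
    then show ?thesis using \<phi>(1)[OF x] r(1) by simp
  qed
  show thesis
  proof (rule that)
    show "\<phi> \<in> carrier M \<rightarrow> carrier R" using \<phi>(1) by simp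
    show "\<phi> (x \<oplus>\<^bsub>M\<^esub> y) = \<phi> x \<oplus> \<phi> y" if xy: "x \<in> carrier M" "y \<in> carrier M" for x y
    proof (rule unique)
      have "c \<odot>\<^bsub>M\<^esub> (x \<oplus>\<^bsub>M\<^esub> y) \<ominus>\<^bsub>M\<^esub> (\<phi> x \<oplus> \<phi> y) \<odot>\<^bsub>M\<^esub> s
          = (c \<odot>\<^bsub>M\<^esub> x \<ominus>\<^bsub>M\<^esub> \<phi> x \<odot>\<^bsub>M\<^esub> s) \<oplus>\<^bsub>M\<^esub> (c \<odot>\<^bsub>M\<^esub> y \<ominus>\<^bsub>M\<^esub> \<phi> y \<odot>\<^bsub>M\<^esub> s)"
        using xy c(1) s \<phi>(1)
        by (simp add: a_minus_def M.smult_l_distr M.smult_r_distr M.M.minus_add M.M.a_ac)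
      then show "c \<odot>\<^bsub>M\<^esub> (x \<oplus>\<^bsub>M\<^esub> y) \<ominus>\<^bsub>M\<^esub> (\<phi> x \<oplus> \<phi> y) \<odot>\<^bsub>M\<^esub> s \<in> N"
        using \<phi>(2) xy M.submoduleE(5)[OF N] by simp
    qed (use xy \<phi>(1) in auto)
    show "\<phi> (a \<odot>\<^bsub>M\<^esub> x) = a \<otimes> \<phi> x" if a: "a \<in> carrier R" "x \<in> carrier M" for a x
    proof (rule unique)
      have "c \<odot>\<^bsub>M\<^esub> (a \<odot>\<^bsub>M\<^esub> x) = a \<odot>\<^bsub>M\<^esub> (c \<odot>\<^bsub>M\<^esub> x)"
        using a c(1) by (simp add: M.smult_assoc1[symmetric] m_comm)
      then have "c \<odot>\<^bsub>M\<^esub> (a \<odot>\<^bsub>M\<^esub> x) \<ominus>\<^bsub>M\<^esub> (a \<otimes> \<phi> x) \<odot>\<^bsub>M\<^esub> s = a \<odot>\<^bsub>M\<^esub> (c \<odot>\<^bsub>M\<^esub> x \<ominus>\<^bsub>M\<^esub> \<phi> x \<odot>\<^bsub>M\<^esub> s)"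
        using a c(1) s \<phi>(1) by (simp add: a_minus_def M.smult_r_distr M.smult_r_minus M.smult_assoc1)
      then show "c \<odot>\<^bsub>M\<^esub> (a \<odot>\<^bsub>M\<^esub> x) \<ominus>\<^bsub>M\<^esub> (a \<otimes> \<phi> x) \<odot>\<^bsub>M\<^esub> s \<in> N"
        using \<phi>(2)[OF a(2)] M.submoduleE(4)[OF N a(1)] by simp
    qed (use a \<phi>(1) in auto)
    have "\<phi> s = c"
      using M.submodule_zero[OF N] s c(1)
      by (intro unique) (simp_all add: a_minus_def M.M.r_neg)
    then show "s \<in> carrier M" "\<phi> s \<noteq> \<zero>" using s c(2) by simp_all
  qed
qed

section \<open>Injective modules over a domain\<close>

definition ideal_as_module :: "('a, 'r) ring_scheme \<Rightarrow> 'a set \<Rightarrow> ('a, 'a) module" where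
  "ideal_as_module R K =
     \<lparr>carrier = K, monoid.mult = monoid.mult R, one = monoid.one R,
      ring.zero = ring.zero R, add = ring.add R, smult = monoid.mult R\<rparr>"

lemma (in cring) carrier_as_module: "module R (ideal_as_module R (carrier R))"
proof (rule moduleI[OF is_cring])
  show "abelian_group (ideal_as_module R (carrier R))"
    by (rule abelian_groupI)
      (auto simp: ideal_as_module_def a_ac intro: bexI[of _ "\<ominus> _"] l_neg)
qed (auto simp: ideal_as_module_def l_distr r_distr m_assoc)

lemma (in cring) ideal_as_module:
  assumes "ideal K R"
  shows "module R (ideal_as_module R K)"
proof -
  interpret B: module R "ideal_as_module R (carrier R)" by (rule carrier_as_module)
  interpret K: ideal K R by fact
  have neg: "\<ominus>\<^bsub>ideal_as_module R (carrier R)\<^esub> a = \<ominus> a" for a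
    by (simp add: ideal_as_module_def a_inv_def m_inv_def)
  have "submodule K R (ideal_as_module R (carrier R))"
    by (rule B.submoduleI, unfold neg) (auto simp: ideal_as_module_def K.Icarr K.I_l_closed)
  then have "module R ((ideal_as_module R (carrier R))\<lparr>carrier := K\<rparr>)"
    using submodule.submodule_is_module carrier_as_module by blast
  then show ?thesis by (simp add: ideal_as_module_def)
qed

text \<open>The map to be extended is given by its graph \<open>\<rho>\<close>.\<close>

lemma (in cring) injective_module_extend:
  assumes inj: "injective_module R E" and "\<rho> \<subseteq> carrier R \<times> carrier E" and "\<rho> \<noteq> {}"
    and add: "\<And>r v r' v'. \<lbrakk> (r, v) \<in> \<rho>; (r', v') \<in> \<rho> \<rbrakk> \<Longrightarrow> (r \<oplus> r', v \<oplus>\<^bsub>E\<^esub> v') \<in> \<rho>"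
    and smult: "\<And>a r v. \<lbrakk> a \<in> carrier R; (r, v) \<in> \<rho> \<rbrakk> \<Longrightarrow> (a \<otimes> r, a \<odot>\<^bsub>E\<^esub> v) \<in> \<rho>"
    and single: "\<And>v. (\<zero>, v) \<in> \<rho> \<Longrightarrow> v = \<zero>\<^bsub>E\<^esub>"
  shows "\<exists>e\<in>carrier E. \<forall>(r, v)\<in>\<rho>. v = r \<odot>\<^bsub>E\<^esub> e"
proof -
  interpret E: module R E using inj by (simp add: injective_module_def)
  have carr: "r \<in> carrier R" "v \<in> carrier E" if "(r, v) \<in> \<rho>" for r v using that assms(2) by auto
  have neg: "(\<ominus> r, \<ominus>\<^bsub>E\<^esub> v) \<in> \<rho>" if "(r, v) \<in> \<rho>" for r v
    using smult[OF _ that, of "\<ominus> \<one>"] carr[OF that] by (simp add: l_minus E.smult_l_minus)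
  have unique: "v = v'" if "(r, v) \<in> \<rho>" "(r, v') \<in> \<rho>" for r v v'
  proof -
    have "(\<zero>, v \<oplus>\<^bsub>E\<^esub> \<ominus>\<^bsub>E\<^esub> v') \<in> \<rho>" using add[OF that(1) neg[OF that(2)]] carr[OF that(1)] by (simp add: r_neg)
    then have "v \<oplus>\<^bsub>E\<^esub> \<ominus>\<^bsub>E\<^esub> v' = \<zero>\<^bsub>E\<^esub>" by (rule single)
    then show ?thesis using carr[OF that(1)] carr[OF that(2)] E.M.minus_equality E.M.minus_minus
      by (metis E.M.a_inv_closed)
  qed
  define K where "K = fst ` \<rho>"
  define h where "h r = (THE v. (r, v) \<in> \<rho>)" for r
  have h: "h r = v" if "(r, v) \<in> \<rho>" for r v
    unfolding h_def using that unique by (intro the_equality) auto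
  have hr: "(r, h r) \<in> \<rho>" if "r \<in> K" for r using that h by (auto simp: K_def)
  have KI: "r \<in> K" if "(r, v) \<in> \<rho>" for r v using that by (force simp: K_def)
  have Kc: "r \<in> carrier R" if "r \<in> K" for r using carr(1)[OF hr[OF that]] .
  have K: "ideal K R"
  proof (rule idealI[OF ring_axioms])
    obtain r v where "(r, v) \<in> \<rho>" using assms(3) by auto
    from add[OF this neg[OF this]] carr[OF this] have "(\<zero>, \<zero>\<^bsub>E\<^esub>) \<in> \<rho>" by (simp add: r_neg E.M.r_neg)
    then have "\<zero> \<in> K" by (rule KI)
    then show "subgroup K (add_monoid R)"
      using Kc KI[OF add[OF hr hr]] KI[OF neg[OF hr]] by unfold_locales (auto simp: a_inv_def[symmetric])
    show *: "x \<otimes> a \<in> K" if "a \<in> K" "x \<in> carrier R" for a x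
      using KI[OF smult[OF that(2) hr[OF that(1)]]] .
    show "a \<otimes> x \<in> K" if "a \<in> K" "x \<in> carrier R" for a x
      using *[OF that] m_comm[OF Kc[OF that(1)] that(2)] by simp
  qed
  let ?A = "ideal_as_module R K" and ?B = "ideal_as_module R (carrier R)"
  have "(\<lambda>r. r) \<in> module_hom R ?A ?B" using Kc by (auto simp: module_hom_def ideal_as_module_def)
  moreover have "h \<in> module_hom R ?A E"
    using carr(2)[OF hr] h[OF add[OF hr hr]] h[OF smult[OF _ hr]]
    by (simp add: module_hom_def ideal_as_module_def)
  ultimately obtain g where g: "g \<in> module_hom R ?B E" "\<forall>r\<in>carrier ?A. g r = h r"
    using inj[unfolded injective_module_def, THEN conjunct2, rule_format, of ?A ?B "\<lambda>r. r" h]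
      ideal_as_module[OF K] carrier_as_module by auto
  have glin: "\<forall>a\<in>carrier R. \<forall>x\<in>carrier R. g (a \<otimes> x) = a \<odot>\<^bsub>E\<^esub> g x"
    using g(1) by (simp add: module_hom_def ideal_as_module_def)
  have "v = r \<odot>\<^bsub>E\<^esub> g \<one>" if rv: "(r, v) \<in> \<rho>" for r v
  proof -
    have "r \<in> K" using rv by (rule KI)
    then have "v = g r" using g(2) h[OF rv] by (simp add: ideal_as_module_def)
    also have "\<dots> = g (r \<otimes> \<one>)" using carr[OF rv] by simp
    also have "\<dots> = r \<odot>\<^bsub>E\<^esub> g \<one>" using bspec[OF bspec[OF glin carr(1)[OF rv]] one_closed] .
    finally show ?thesis .
  qed
  moreover have "g \<one> \<in> carrier E" using g(1) by (auto simp: module_hom_def ideal_as_module_def)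
  ultimately show ?thesis by blast
qed

lemma (in domain) injective_module_divisible:
  assumes inj: "injective_module R E" and a: "a \<in> carrier R" "a \<noteq> \<zero>" and e: "e \<in> carrier E"
  obtains e' where "e' \<in> carrier E" "a \<odot>\<^bsub>E\<^esub> e' = e"
proof -
  interpret E: module R E using inj by (simp add: injective_module_def)
  define \<rho> where "\<rho> = {(r \<otimes> a, r \<odot>\<^bsub>E\<^esub> e) | r. r \<in> carrier R}"
  have "\<exists>e'\<in>carrier E. \<forall>(r, v)\<in>\<rho>. v = r \<odot>\<^bsub>E\<^esub> e'"
  proof (rule injective_module_extend[OF inj])
    show "\<rho> \<subseteq> carrier R \<times> carrier E" "\<rho> \<noteq> {}" using a e by (auto simp: \<rho>_def)
  next
    fix r v r' v' assume "(r, v) \<in> \<rho>" "(r', v') \<in> \<rho>"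
    then obtain s s' where s: "s \<in> carrier R" "s' \<in> carrier R" "r = s \<otimes> a" "v = s \<odot>\<^bsub>E\<^esub> e"
      "r' = s' \<otimes> a" "v' = s' \<odot>\<^bsub>E\<^esub> e" by (auto simp: \<rho>_def)
    show "(r \<oplus> r', v \<oplus>\<^bsub>E\<^esub> v') \<in> \<rho>" unfolding \<rho>_def
      using s a e by (intro CollectI exI[of _ "s \<oplus> s'"]) (simp add: l_distr E.smult_l_distr)
  next
    fix c r v assume c: "c \<in> carrier R" and "(r, v) \<in> \<rho>"
    then obtain s where s: "s \<in> carrier R" "r = s \<otimes> a" "v = s \<odot>\<^bsub>E\<^esub> e" by (auto simp: \<rho>_def)
    show "(c \<otimes> r, c \<odot>\<^bsub>E\<^esub> v) \<in> \<rho>" unfolding \<rho>_def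
      using s a e c by (intro CollectI exI[of _ "c \<otimes> s"]) (simp add: m_assoc E.smult_assoc1)
  next
    fix v assume "(\<zero>, v) \<in> \<rho>"
    then obtain s where s: "s \<in> carrier R" "\<zero> = s \<otimes> a" "v = s \<odot>\<^bsub>E\<^esub> e" by (auto simp: \<rho>_def)
    then have "s = \<zero>" using integral[of s a] a by auto
    then show "v = \<zero>\<^bsub>E\<^esub>" using s(3) e by simp
  qed
  then obtain e' where e': "e' \<in> carrier E" "\<forall>(r, v)\<in>\<rho>. v = r \<odot>\<^bsub>E\<^esub> e'" by blast
  have "(\<one> \<otimes> a, \<one> \<odot>\<^bsub>E\<^esub> e) \<in> \<rho>" unfolding \<rho>_def by blast
  then show thesis using e' that[of e'] a e by auto
qed

lemma (in domain) injective_module_split: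
  assumes inj: "injective_module R E" and x: "x \<in> carrier R" and y: "y \<in> carrier R"
    and rel: "relatively_prime R x y"
    and g: "g \<in> carrier E" "(x \<otimes> y) \<odot>\<^bsub>E\<^esub> g = \<zero>\<^bsub>E\<^esub>"
  obtains g1 g2 where "g1 \<in> carrier E" "g2 \<in> carrier E" "g = g1 \<oplus>\<^bsub>E\<^esub> g2"
    "x \<odot>\<^bsub>E\<^esub> g1 = \<zero>\<^bsub>E\<^esub>" "y \<odot>\<^bsub>E\<^esub> g2 = \<zero>\<^bsub>E\<^esub>"
proof -
  interpret E: module R E using inj by (simp add: injective_module_def)
  define \<rho> where "\<rho> = {(r \<otimes> x \<oplus> s \<otimes> y, (s \<otimes> y) \<odot>\<^bsub>E\<^esub> g) | r s. r \<in> carrier R \<and> s \<in> carrier R}"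
  have "\<exists>e\<in>carrier E. \<forall>(r, v)\<in>\<rho>. v = r \<odot>\<^bsub>E\<^esub> e"
  proof (rule injective_module_extend[OF inj])
    show "\<rho> \<subseteq> carrier R \<times> carrier E" "\<rho> \<noteq> {}" using x y g by (auto simp: \<rho>_def)
  next
    fix a v a' v' assume "(a, v) \<in> \<rho>" "(a', v') \<in> \<rho>"
    then obtain r s r' s' where s: "r \<in> carrier R" "s \<in> carrier R" "r' \<in> carrier R" "s' \<in> carrier R"
      "a = r \<otimes> x \<oplus> s \<otimes> y" "v = (s \<otimes> y) \<odot>\<^bsub>E\<^esub> g" "a' = r' \<otimes> x \<oplus> s' \<otimes> y" "v' = (s' \<otimes> y) \<odot>\<^bsub>E\<^esub> g"
      by (auto simp: \<rho>_def)
    have "a \<oplus> a' = (r \<oplus> r') \<otimes> x \<oplus> (s \<oplus> s') \<otimes> y"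
      unfolding s(5,7) using s(1-4) x y by algebra
    moreover have "v \<oplus>\<^bsub>E\<^esub> v' = ((s \<oplus> s') \<otimes> y) \<odot>\<^bsub>E\<^esub> g"
      using s y g(1) by (simp add: l_distr E.smult_l_distr)
    ultimately show "(a \<oplus> a', v \<oplus>\<^bsub>E\<^esub> v') \<in> \<rho>" unfolding \<rho>_def using s(1-4)
      by (intro CollectI exI[of _ "r \<oplus> r'"] exI[of _ "s \<oplus> s'"]) simp
  next
    fix c a v assume c: "c \<in> carrier R" and "(a, v) \<in> \<rho>"
    then obtain r s where s: "r \<in> carrier R" "s \<in> carrier R" "a = r \<otimes> x \<oplus> s \<otimes> y" "v = (s \<otimes> y) \<odot>\<^bsub>E\<^esub> g"
      by (auto simp: \<rho>_def)
    have "c \<otimes> a = (c \<otimes> r) \<otimes> x \<oplus> (c \<otimes> s) \<otimes> y" unfolding s(3) using s(1,2) c x y by algebra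
    moreover have "c \<odot>\<^bsub>E\<^esub> v = ((c \<otimes> s) \<otimes> y) \<odot>\<^bsub>E\<^esub> g"
      using s y g(1) c by (simp add: m_assoc E.smult_assoc1)
    ultimately show "(c \<otimes> a, c \<odot>\<^bsub>E\<^esub> v) \<in> \<rho>" unfolding \<rho>_def using s(1,2) c
      by (intro CollectI exI[of _ "c \<otimes> r"] exI[of _ "c \<otimes> s"]) simp
  next
    fix v assume "(\<zero>, v) \<in> \<rho>"
    then obtain r s where s: "r \<in> carrier R" "s \<in> carrier R" "r \<otimes> x \<oplus> s \<otimes> y = \<zero>" "v = (s \<otimes> y) \<odot>\<^bsub>E\<^esub> g"
      by (auto simp: \<rho>_def)
    have "x divides (r \<otimes> x)" using divides_mult_self[OF x s(1)] m_comm[OF x s(1)] by simp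
    moreover have "x divides (r \<otimes> x \<oplus> s \<otimes> y)" unfolding s(3) using divides_zero[OF x] .
    ultimately have "x divides (s \<otimes> y)" using divides_addD[OF x, of "r \<otimes> x" "s \<otimes> y"] x y s(1,2) by simp
    then have "x divides s" using rel s(2) m_comm[OF s(2) y] by (simp add: relatively_prime_def)
    then obtain t where t: "t \<in> carrier R" "s = x \<otimes> t" by (auto simp: factor_def)
    have "s \<otimes> y = t \<otimes> (x \<otimes> y)" unfolding t(2) using t(1) x y by algebra
    then show "v = \<zero>\<^bsub>E\<^esub>" using s(4) t(1) x y g by (simp add: E.smult_assoc1[of t])
  qed
  then obtain e where e: "e \<in> carrier E" "\<forall>(r, v)\<in>\<rho>. v = r \<odot>\<^bsub>E\<^esub> e" by blast
  have "(\<one> \<otimes> x \<oplus> \<zero> \<otimes> y, (\<zero> \<otimes> y) \<odot>\<^bsub>E\<^esub> g) \<in> \<rho>" unfolding \<rho>_def by blast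
  then have xe: "x \<odot>\<^bsub>E\<^esub> e = \<zero>\<^bsub>E\<^esub>" using e(2) x y g by auto
  have "(\<zero> \<otimes> x \<oplus> \<one> \<otimes> y, (\<one> \<otimes> y) \<odot>\<^bsub>E\<^esub> g) \<in> \<rho>" unfolding \<rho>_def by blast
  then have "y \<odot>\<^bsub>E\<^esub> g = y \<odot>\<^bsub>E\<^esub> e" using e(2) x y g by auto
  then have "y \<odot>\<^bsub>E\<^esub> (g \<ominus>\<^bsub>E\<^esub> e) = \<zero>\<^bsub>E\<^esub>"
    using e(1) g(1) y by (simp add: a_minus_def E.smult_r_distr E.smult_r_minus E.M.r_neg)
  moreover have "g = e \<oplus>\<^bsub>E\<^esub> (g \<ominus>\<^bsub>E\<^esub> e)"
    using e(1) g(1) by (simp add: a_minus_def E.M.a_lcomm[of e g] E.M.r_neg)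
  ultimately show thesis using that[of e "g \<ominus>\<^bsub>E\<^esub> e"] e(1) g(1) xe by simp
qed

section \<open>Local cohomology\<close>

lemma (in domain) pow_not_zero:
  assumes "f \<in> carrier R" "f \<noteq> \<zero>"
  shows "f [^] (n::nat) \<noteq> \<zero>"
  using assms by (induction n) (auto simp: integral_iff)

lemma ideals_set_one [simp]: "\<one>\<^bsub>ideals_set R\<^esub> = carrier R"
  by (simp add: ideals_set_def)

lemma ideals_set_mult [simp]: "I \<otimes>\<^bsub>ideals_set R\<^esub> J = ideal_prod R I J"
  by (simp add: ideals_set_def)

lemma (in cring) ideal_ideal_pow:
  assumes "ideal I R"
  shows "ideal (I [^]\<^bsub>ideals_set R\<^esub> (t::nat)) R"
  by (induction t) (simp_all add: oneideal ideal_prod_is_ideal assms)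

lemma (in cring) ideal_pow_decreasing:
  assumes "ideal I R" and "s \<le> t"
  shows "I [^]\<^bsub>ideals_set R\<^esub> (t::nat) \<subseteq> I [^]\<^bsub>ideals_set R\<^esub> s"
  using assms(2)
proof (rule lift_Suc_antimono_le[rotated])
  show "I [^]\<^bsub>ideals_set R\<^esub> Suc n \<subseteq> I [^]\<^bsub>ideals_set R\<^esub> n" for n
    using ideal_prod_inter[OF ideal_ideal_pow[OF assms(1)] assms(1)] by auto
qed

lemma (in cring) pow_mem_ideal_pow:
  assumes "b \<in> I"
  shows "b [^] t \<in> I [^]\<^bsub>ideals_set R\<^esub> (t::nat)"
  by (induction t) (auto simp: assms intro: ideal_prod.prod)

context module
begin

lemma torsion_Suc:
  assumes I: "ideal I R" and e: "e \<in> carrier M"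
    and be: "\<And>b a. \<lbrakk> b \<in> I; a \<in> I [^]\<^bsub>ideals_set R\<^esub> t \<rbrakk> \<Longrightarrow> a \<odot>\<^bsub>M\<^esub> (b \<odot>\<^bsub>M\<^esub> e) = \<zero>\<^bsub>M\<^esub>"
    and a: "a \<in> I [^]\<^bsub>ideals_set R\<^esub> Suc t"
  shows "a \<odot>\<^bsub>M\<^esub> e = \<zero>\<^bsub>M\<^esub>"
proof -
  have P: "ideal (I [^]\<^bsub>ideals_set R\<^esub> t) R" using R.ideal_ideal_pow[OF I] .
  have "c \<in> carrier R \<and> c \<odot>\<^bsub>M\<^esub> e = \<zero>\<^bsub>M\<^esub>" if "c \<in> ideal_prod R (I [^]\<^bsub>ideals_set R\<^esub> t) I" for c
    using that
  proof induction
    case (prod i j)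
    then show ?case
      using be[of j i] e ideal.Icarr[OF P] ideal.Icarr[OF I] by (simp add: smult_assoc1)
  next
    case (sum c d)
    then show ?case using e by (simp add: smult_l_distr)
  qed
  then show ?thesis using a by simp
qed

lemma torsion_of_generators:
  assumes I: "ideal I R" and S: "finite S" "S \<subseteq> carrier R" "I = genideal R S"
  shows "e \<in> carrier M \<Longrightarrow> (\<And>b. b \<in> S \<Longrightarrow> b [^] (n b :: nat) \<odot>\<^bsub>M\<^esub> e = \<zero>\<^bsub>M\<^esub>) \<Longrightarrow>
    \<exists>t::nat. \<forall>a\<in>I [^]\<^bsub>ideals_set R\<^esub> t. a \<odot>\<^bsub>M\<^esub> e = \<zero>\<^bsub>M\<^esub>"
proof (induction "\<Sum>b\<in>S. n b" arbitrary: n e rule: less_induct)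
  case less
  show ?case
  proof (cases "\<exists>b\<in>S. n b = 0")
    case True
    then obtain b where "b \<in> S" "n b = 0" by blast
    then have "e = \<zero>\<^bsub>M\<^esub>" using less.prems(2)[of b] less.prems(1) by simp
    then show ?thesis by (intro exI[of _ 0]) auto
  next
    case False
    have "\<exists>t::nat. \<forall>a\<in>I [^]\<^bsub>ideals_set R\<^esub> t. a \<odot>\<^bsub>M\<^esub> (b \<odot>\<^bsub>M\<^esub> e) = \<zero>\<^bsub>M\<^esub>" if b: "b \<in> S" for b
    proof (rule less.hyps[of "n(b := n b - 1)"])
      have bc: "b \<in> carrier R" using b S(2) by blast
      have nb: "n b = Suc (n b - 1)" using False b by (metis Suc_pred' neq0_conv)
      show "(\<Sum>c\<in>S. (n(b := n b - 1)) c) < (\<Sum>c\<in>S. n c)"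
        using S(1) b nb by (intro sum_strict_mono_ex1) auto
      show "b \<odot>\<^bsub>M\<^esub> e \<in> carrier M" using bc less.prems(1) by simp
      fix c assume c: "c \<in> S"
      then have cc: "c \<in> carrier R" using S(2) by blast
      show "c [^] (n(b := n b - 1)) c \<odot>\<^bsub>M\<^esub> (b \<odot>\<^bsub>M\<^esub> e) = \<zero>\<^bsub>M\<^esub>"
      proof (cases "c = b")
        case True
        have "b [^] (n b - 1) \<odot>\<^bsub>M\<^esub> (b \<odot>\<^bsub>M\<^esub> e) = (b [^] (n b - 1) \<otimes> b) \<odot>\<^bsub>M\<^esub> e"
          using bc less.prems(1) by (simp add: smult_assoc1)
        also have "b [^] (n b - 1) \<otimes> b = b [^] Suc (n b - 1)" by simp
        also have "\<dots> \<odot>\<^bsub>M\<^esub> e = \<zero>\<^bsub>M\<^esub>" using less.prems(2)[OF b] nb by simp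
        finally show ?thesis using True by simp
      next
        case False
        have "c [^] n c \<odot>\<^bsub>M\<^esub> (b \<odot>\<^bsub>M\<^esub> e) = b \<odot>\<^bsub>M\<^esub> (c [^] n c \<odot>\<^bsub>M\<^esub> e)"
          using bc cc less.prems(1) by (simp add: smult_assoc1[symmetric] R.m_comm)
        then show ?thesis using False less.prems(2)[OF c] bc by simp
      qed
    qed
    then obtain T where T: "\<And>b a. \<lbrakk> b \<in> S; a \<in> I [^]\<^bsub>ideals_set R\<^esub> (T b :: nat) \<rbrakk> \<Longrightarrow> a \<odot>\<^bsub>M\<^esub> (b \<odot>\<^bsub>M\<^esub> e) = \<zero>\<^bsub>M\<^esub>"
      by metis
    define t where "t = (\<Sum>b\<in>S. T b)"
    define K where "K = {b \<in> carrier R. \<forall>a\<in>I [^]\<^bsub>ideals_set R\<^esub> t. a \<odot>\<^bsub>M\<^esub> (b \<odot>\<^bsub>M\<^esub> e) = \<zero>\<^bsub>M\<^esub>}"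
    have pc: "a \<in> carrier R" if "a \<in> I [^]\<^bsub>ideals_set R\<^esub> t" for a
      using ideal.Icarr[OF R.ideal_ideal_pow[OF I] that] .
    have "S \<subseteq> K"
    proof
      fix b assume b: "b \<in> S"
      then have "T b \<le> t" unfolding t_def using S(1) by (intro member_le_sum) auto
      then have "I [^]\<^bsub>ideals_set R\<^esub> t \<subseteq> I [^]\<^bsub>ideals_set R\<^esub> T b" by (rule R.ideal_pow_decreasing[OF I])
      then show "b \<in> K" using T[OF b] b S(2) by (auto simp: K_def)
    qed
    moreover have "ideal K R"
    proof (rule idealI[OF R.ring_axioms])
      show "subgroup K (add_monoid R)"
        using less.prems(1) pc by unfold_locales
          (auto simp: K_def smult_l_distr smult_r_distr a_inv_def[symmetric] smult_l_minus smult_r_minus)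
      show *: "x \<otimes> b \<in> K" if "b \<in> K" "x \<in> carrier R" for b x
      proof -
        have "a \<odot>\<^bsub>M\<^esub> ((x \<otimes> b) \<odot>\<^bsub>M\<^esub> e) = x \<odot>\<^bsub>M\<^esub> (a \<odot>\<^bsub>M\<^esub> (b \<odot>\<^bsub>M\<^esub> e))" if "a \<in> I [^]\<^bsub>ideals_set R\<^esub> t" for a
          using that \<open>b \<in> K\<close> \<open>x \<in> carrier R\<close> pc less.prems(1)
          by (simp add: K_def smult_assoc1[symmetric] R.m_ac)
        then show ?thesis using that by (simp add: K_def)
      qed
      show "b \<otimes> x \<in> K" if "b \<in> K" "x \<in> carrier R" for b x
        using *[OF that] that R.m_comm[of b x] by (simp add: K_def)
    qed
    ultimately have "I \<subseteq> K" unfolding S(3) using R.genideal_minimal by blast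
    then have "a \<odot>\<^bsub>M\<^esub> (b \<odot>\<^bsub>M\<^esub> e) = \<zero>\<^bsub>M\<^esub>" if "b \<in> I" "a \<in> I [^]\<^bsub>ideals_set R\<^esub> t" for a b
      using that by (auto simp: K_def)
    then have "\<forall>a\<in>I [^]\<^bsub>ideals_set R\<^esub> Suc t. a \<odot>\<^bsub>M\<^esub> e = \<zero>\<^bsub>M\<^esub>"
      using torsion_Suc[OF I less.prems(1)] by blast
    then show ?thesis by blast
  qed
qed

text \<open>The elementwise description of \<open>\<Gamma>\<^sub>I(M)\<close> over a Noetherian ring.\<close>

definition power_torsion where
  "power_torsion I = {e \<in> carrier M. \<forall>b\<in>I. \<exists>n::nat. b [^] n \<odot>\<^bsub>M\<^esub> e = \<zero>\<^bsub>M\<^esub>}"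

lemma power_torsionD:
  assumes "e \<in> power_torsion I" and "b \<in> I"
  obtains n :: nat where "b [^] n \<odot>\<^bsub>M\<^esub> e = \<zero>\<^bsub>M\<^esub>"
  using assms by (auto simp: power_torsion_def)

lemma power_torsion_of_generators:
  assumes I: "ideal I R" and S: "finite S" "S \<subseteq> carrier R" "I = genideal R S"
    and e: "e \<in> carrier M" "\<And>b. b \<in> S \<Longrightarrow> \<exists>n::nat. b [^] n \<odot>\<^bsub>M\<^esub> e = \<zero>\<^bsub>M\<^esub>"
  shows "\<exists>t::nat. \<forall>a\<in>I [^]\<^bsub>ideals_set R\<^esub> t. a \<odot>\<^bsub>M\<^esub> e = \<zero>\<^bsub>M\<^esub>" "e \<in> power_torsion I"
proof -
  obtain n where "\<And>b. b \<in> S \<Longrightarrow> b [^] (n b :: nat) \<odot>\<^bsub>M\<^esub> e = \<zero>\<^bsub>M\<^esub>" using e(2) by metis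
  from torsion_of_generators[OF I S e(1) this]
  show *: "\<exists>t::nat. \<forall>a\<in>I [^]\<^bsub>ideals_set R\<^esub> t. a \<odot>\<^bsub>M\<^esub> e = \<zero>\<^bsub>M\<^esub>" .
  then show "e \<in> power_torsion I"
    using e(1) R.pow_mem_ideal_pow unfolding power_torsion_def by fast
qed

lemma carrier_torsion_module:
  assumes "noetherian_ring R" and I: "ideal I R"
  shows "carrier (torsion_module R I M) = power_torsion I"
proof -
  obtain S where S: "S \<subseteq> carrier R" "finite S" "I = genideal R S"
    using noetherian_ring.finetely_gen[OF assms] by auto
  have SI: "S \<subseteq> I" using R.genideal_self[OF S(1)] S(3) by simp
  show ?thesis
  proof (intro equalityI subsetI)
    fix e assume "e \<in> carrier (torsion_module R I M)"
    then obtain t :: nat where e: "e \<in> carrier M" "\<forall>a\<in>I [^]\<^bsub>ideals_set R\<^esub> t. a \<odot>\<^bsub>M\<^esub> e = \<zero>\<^bsub>M\<^esub>"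
      by (auto simp: torsion_module_def)
    then have "b [^] t \<odot>\<^bsub>M\<^esub> e = \<zero>\<^bsub>M\<^esub>" if "b \<in> I" for b
      using R.pow_mem_ideal_pow[OF that] by simp
    then show "e \<in> power_torsion I" using e(1) by (auto simp: power_torsion_def)
  next
    fix e assume e: "e \<in> power_torsion I"
    then have "e \<in> carrier M" "\<And>b. b \<in> S \<Longrightarrow> \<exists>n::nat. b [^] n \<odot>\<^bsub>M\<^esub> e = \<zero>\<^bsub>M\<^esub>"
      using SI by (auto simp: power_torsion_def)
    from power_torsion_of_generators(1)[OF I S(2,1,3) this]
    show "e \<in> carrier (torsion_module R I M)" using \<open>e \<in> carrier M\<close> by (simp add: torsion_module_def)
  qed
qed

lemma pow_smult_zero_mono:
  assumes "b \<in> carrier R" "e \<in> carrier M" "b [^] (n::nat) \<odot>\<^bsub>M\<^esub> e = \<zero>\<^bsub>M\<^esub>" "n \<le> m"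
  shows "b [^] m \<odot>\<^bsub>M\<^esub> e = \<zero>\<^bsub>M\<^esub>"
proof -
  have "b [^] m = b [^] (m - n) \<otimes> b [^] n" using assms(1,4) by (simp add: R.nat_pow_mult)
  then show ?thesis using assms by (simp add: smult_assoc1)
qed

lemma submodule_power_torsion:
  assumes I: "ideal I R"
  shows "submodule (power_torsion I) R M"
proof (rule submoduleI)
  note Ic = ideal.Icarr[OF I]
  show "power_torsion I \<subseteq> carrier M" "\<zero>\<^bsub>M\<^esub> \<in> power_torsion I"
    using Ic by (auto simp: power_torsion_def)
  show "\<ominus>\<^bsub>M\<^esub> e \<in> power_torsion I" if "e \<in> power_torsion I" for e
    using that Ic by (simp add: power_torsion_def smult_r_minus)
  show "e \<oplus>\<^bsub>M\<^esub> e' \<in> power_torsion I" if e: "e \<in> power_torsion I" "e' \<in> power_torsion I" for e e'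
    unfolding power_torsion_def
  proof (intro CollectI conjI ballI)
    have c: "e \<in> carrier M" "e' \<in> carrier M" using e by (auto simp: power_torsion_def)
    then show "e \<oplus>\<^bsub>M\<^esub> e' \<in> carrier M" by simp
    fix b assume b: "b \<in> I"
    obtain n m :: nat where n: "b [^] n \<odot>\<^bsub>M\<^esub> e = \<zero>\<^bsub>M\<^esub>" and m: "b [^] m \<odot>\<^bsub>M\<^esub> e' = \<zero>\<^bsub>M\<^esub>"
      using power_torsionD[OF e(1) b] power_torsionD[OF e(2) b] by metis
    have "b [^] (n + m) \<odot>\<^bsub>M\<^esub> (e \<oplus>\<^bsub>M\<^esub> e') = \<zero>\<^bsub>M\<^esub>"
      using pow_smult_zero_mono[OF Ic[OF b] c(1) n, of "n + m"]
        pow_smult_zero_mono[OF Ic[OF b] c(2) m, of "n + m"] c Ic[OF b] by (simp add: smult_r_distr)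
    then show "\<exists>n::nat. b [^] n \<odot>\<^bsub>M\<^esub> (e \<oplus>\<^bsub>M\<^esub> e') = \<zero>\<^bsub>M\<^esub>" by blast
  qed
  show "a \<odot>\<^bsub>M\<^esub> e \<in> power_torsion I" if ae: "a \<in> carrier R" "e \<in> power_torsion I" for a e
    unfolding power_torsion_def
  proof (intro CollectI conjI ballI)
    have c: "e \<in> carrier M" using that by (auto simp: power_torsion_def)
    then show "a \<odot>\<^bsub>M\<^esub> e \<in> carrier M" using that by simp
    fix b assume b: "b \<in> I"
    obtain n :: nat where n: "b [^] n \<odot>\<^bsub>M\<^esub> e = \<zero>\<^bsub>M\<^esub>" using power_torsionD[OF ae(2) b] .
    have "b [^] n \<odot>\<^bsub>M\<^esub> (a \<odot>\<^bsub>M\<^esub> e) = a \<odot>\<^bsub>M\<^esub> (b [^] n \<odot>\<^bsub>M\<^esub> e)"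
      using Ic[OF b] that(1) c by (simp add: smult_assoc1[symmetric] R.m_comm)
    then show "\<exists>n::nat. b [^] n \<odot>\<^bsub>M\<^esub> (a \<odot>\<^bsub>M\<^esub> e) = \<zero>\<^bsub>M\<^esub>" using n that(1) by auto
  qed
qed

lemma submodule_of_submodule:
  assumes "submodule Z R M" "submodule N R M" "N \<subseteq> Z"
  shows "submodule N R (M\<lparr>carrier := Z\<rparr>)"
proof -
  interpret Z: module R "M\<lparr>carrier := Z\<rparr>"
    using submodule.submodule_is_module[OF assms(1) module_axioms] .
  have "module R (M\<lparr>carrier := Z, carrier := N\<rparr>)"
    using submodule.submodule_is_module[OF assms(2) module_axioms] by simp
  then show ?thesis using assms(3) by (intro Z.module_incl_imp_submodule) simp_all
qed

lemma quot_module_is_module: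
  assumes N: "submodule N R M"
  shows "module R (quot_module M N)"
proof (rule moduleI[OF R.is_cring])
  note simps = quot_module_carrier quot_module_zero quot_module_add[OF N] quot_module_smult[OF N]
  show "abelian_group (quot_module M N)"
  proof (rule abelian_groupI)
    show "\<zero>\<^bsub>quot_module M N\<^esub> \<in> carrier (quot_module M N)"
      unfolding simps using coset_zero[OF N] M.zero_closed by blast
    fix U assume "U \<in> carrier (quot_module M N)"
    then obtain x where x: "x \<in> carrier M" "U = N +>\<^bsub>M\<^esub> x" unfolding simps by blast
    have "(N +>\<^bsub>M\<^esub> \<zero>\<^bsub>M\<^esub>) \<oplus>\<^bsub>quot_module M N\<^esub> U = U" using x by (simp add: simps)
    then show "\<zero>\<^bsub>quot_module M N\<^esub> \<oplus>\<^bsub>quot_module M N\<^esub> U = U" by (simp add: coset_zero[OF N] simps)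
    have "(N +>\<^bsub>M\<^esub> (\<ominus>\<^bsub>M\<^esub> x)) \<oplus>\<^bsub>quot_module M N\<^esub> U = \<zero>\<^bsub>quot_module M N\<^esub>"
      using x by (simp add: simps M.l_neg coset_zero[OF N])
    then show "\<exists>Y\<in>carrier (quot_module M N). Y \<oplus>\<^bsub>quot_module M N\<^esub> U = \<zero>\<^bsub>quot_module M N\<^esub>"
      using x(1) by (intro bexI[of _ "N +>\<^bsub>M\<^esub> (\<ominus>\<^bsub>M\<^esub> x)"]) (auto simp: simps)
  qed (auto simp: simps M.a_ac)
qed (auto simp: quot_module_carrier quot_module_add[OF N] quot_module_smult[OF N] smult_l_distr smult_r_distr smult_assoc1)

lemma artinian_quotient_killed_by_pow:
  assumes N: "submodule N R M" and art: "artinian_module R (quot_module M N)"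
    and f: "f \<in> carrier R" "\<And>r. r \<in> carrier R \<Longrightarrow> \<one> \<ominus> r \<otimes> f \<in> Units R" and z: "z \<in> carrier M"
  shows "\<exists>k::nat. f [^] k \<odot>\<^bsub>M\<^esub> z \<in> N"
proof -
  interpret Q: module R "quot_module M N" using quot_module_is_module[OF N] .
  define U where "U = N +>\<^bsub>M\<^esub> z"
  have U: "U \<in> carrier (quot_module M N)" using z by (simp add: U_def quot_module_carrier)
  define C where "C k = {(r \<otimes> f [^] (k::nat)) \<odot>\<^bsub>quot_module M N\<^esub> U | r. r \<in> carrier R}" for k
  have "submodule (C k) R (quot_module M N) \<and> C (Suc k) \<subseteq> C k" for k
  proof
    show "submodule (C k) R (quot_module M N)"
    proof (rule Q.submoduleI)
      show "C k \<subseteq> carrier (quot_module M N)" using U f(1) by (auto simp: C_def)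
      show "\<zero>\<^bsub>quot_module M N\<^esub> \<in> C k"
        using U f(1) unfolding C_def by (intro CollectI exI[of _ \<zero>]) simp
    next
      fix Y assume "Y \<in> C k"
      then obtain r where "r \<in> carrier R" "Y = (r \<otimes> f [^] k) \<odot>\<^bsub>quot_module M N\<^esub> U" by (auto simp: C_def)
      then show "\<ominus>\<^bsub>quot_module M N\<^esub> Y \<in> C k" unfolding C_def using U f(1)
        by (intro CollectI exI[of _ "\<ominus> r"]) (simp add: R.l_minus Q.smult_l_minus)
    next
      fix Y Y' assume "Y \<in> C k" "Y' \<in> C k"
      then obtain r r' where "r \<in> carrier R" "Y = (r \<otimes> f [^] k) \<odot>\<^bsub>quot_module M N\<^esub> U"
        "r' \<in> carrier R" "Y' = (r' \<otimes> f [^] k) \<odot>\<^bsub>quot_module M N\<^esub> U" by (auto simp: C_def)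
      then show "Y \<oplus>\<^bsub>quot_module M N\<^esub> Y' \<in> C k" unfolding C_def using U f(1)
        by (intro CollectI exI[of _ "r \<oplus> r'"]) (simp add: R.l_distr Q.smult_l_distr)
    next
      fix a Y assume "a \<in> carrier R" "Y \<in> C k"
      then obtain r where "r \<in> carrier R" "Y = (r \<otimes> f [^] k) \<odot>\<^bsub>quot_module M N\<^esub> U" by (auto simp: C_def)
      then show "a \<odot>\<^bsub>quot_module M N\<^esub> Y \<in> C k" unfolding C_def using U f(1) \<open>a \<in> carrier R\<close>
        by (intro CollectI exI[of _ "a \<otimes> r"]) (simp add: R.m_assoc Q.smult_assoc1)
    qed
    show "C (Suc k) \<subseteq> C k"
    proof
      fix Y assume "Y \<in> C (Suc k)"
      then obtain r where "r \<in> carrier R" "Y = (r \<otimes> f [^] Suc k) \<odot>\<^bsub>quot_module M N\<^esub> U" by (auto simp: C_def)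
      then show "Y \<in> C k" unfolding C_def using f(1)
        by (intro CollectI exI[of _ "r \<otimes> f"]) (simp add: R.m_ac)
    qed
  qed
  then obtain k where k: "\<forall>j\<ge>k. C j = C k" using art unfolding artinian_module_def by metis
  have "(\<one> \<otimes> f [^] k) \<odot>\<^bsub>quot_module M N\<^esub> U \<in> C k" unfolding C_def by blast
  then have "f [^] k \<odot>\<^bsub>quot_module M N\<^esub> U \<in> C (Suc k)"
    using k[rule_format, of "Suc k"] f(1) by simp
  then obtain r where r: "r \<in> carrier R"
    "f [^] k \<odot>\<^bsub>quot_module M N\<^esub> U = (r \<otimes> f [^] Suc k) \<odot>\<^bsub>quot_module M N\<^esub> U" by (auto simp: C_def)
  have "(\<one> \<ominus> r \<otimes> f) \<otimes> f [^] k = f [^] k \<oplus> \<ominus> (r \<otimes> f [^] Suc k)"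
    using r(1) f(1) by (simp add: a_minus_def R.l_distr R.l_minus R.m_assoc R.m_comm[of f "f [^] k"])
  then have "((\<one> \<ominus> r \<otimes> f) \<otimes> f [^] k) \<odot>\<^bsub>quot_module M N\<^esub> U = \<zero>\<^bsub>quot_module M N\<^esub>"
    using r f(1) U by (simp add: Q.smult_l_distr Q.smult_l_minus Q.M.r_neg del: R.nat_pow_Suc)
  then have "N +>\<^bsub>M\<^esub> (((\<one> \<ominus> r \<otimes> f) \<otimes> f [^] k) \<odot>\<^bsub>M\<^esub> z) = N"
    using r(1) f(1) z by (simp add: U_def quot_module_smult[OF N] quot_module_zero)
  then have *: "((\<one> \<ominus> r \<otimes> f) \<otimes> f [^] k) \<odot>\<^bsub>M\<^esub> z \<in> N"
    using r(1) f(1) z by (simp add: coset_eq_self_iff[OF N])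
  let ?u = "\<one> \<ominus> r \<otimes> f"
  have u: "?u \<in> Units R" using f(2)[OF r(1)] .
  have "inv ?u \<odot>\<^bsub>M\<^esub> ((?u \<otimes> f [^] k) \<odot>\<^bsub>M\<^esub> z) = (inv ?u \<otimes> (?u \<otimes> f [^] k)) \<odot>\<^bsub>M\<^esub> z"
    using z f(1) R.Units_closed[OF u] R.Units_inv_closed[OF u] by (simp add: smult_assoc1)
  also have "inv ?u \<otimes> (?u \<otimes> f [^] k) = f [^] k"
    using u f(1) R.Units_l_inv[OF u] R.Units_closed[OF u] R.Units_inv_closed[OF u]
    by (simp add: R.m_assoc[symmetric])
  finally show ?thesis using submoduleE(4)[OF N R.Units_inv_closed[OF u] *] by (metis (no_types))
qed

end

lemma module_homD:
  assumes "h \<in> module_hom R M N"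
  shows "x \<in> carrier M \<Longrightarrow> h x \<in> carrier N"
    and "\<lbrakk> x \<in> carrier M; y \<in> carrier M \<rbrakk> \<Longrightarrow> h (x \<oplus>\<^bsub>M\<^esub> y) = h x \<oplus>\<^bsub>N\<^esub> h y"
    and "\<lbrakk> a \<in> carrier R; x \<in> carrier M \<rbrakk> \<Longrightarrow> h (a \<odot>\<^bsub>M\<^esub> x) = a \<odot>\<^bsub>N\<^esub> h x"
  using assms by (auto simp: module_hom_def)

lemma module_hom_zero:
  assumes "h \<in> module_hom R M N" "module R M" "module R N"
  shows "h \<zero>\<^bsub>M\<^esub> = \<zero>\<^bsub>N\<^esub>"
proof -
  interpret M: module R M by fact
  interpret N: module R N by fact
  have "h (\<zero>\<^bsub>R\<^esub> \<odot>\<^bsub>M\<^esub> \<zero>\<^bsub>M\<^esub>) = \<zero>\<^bsub>R\<^esub> \<odot>\<^bsub>N\<^esub> h \<zero>\<^bsub>M\<^esub>"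
    by (rule module_homD(3)[OF assms(1) M.R.zero_closed M.M.zero_closed])
  then show ?thesis using module_homD(1)[OF assms(1)] by simp
qed

lemma module_hom_a_inv:
  assumes "h \<in> module_hom R M N" "module R M" "module R N" and x: "x \<in> carrier M"
  shows "h (\<ominus>\<^bsub>M\<^esub> x) = \<ominus>\<^bsub>N\<^esub> h x"
proof -
  interpret M: module R M by fact
  interpret N: module R N by fact
  have "h ((\<ominus>\<^bsub>R\<^esub> \<one>\<^bsub>R\<^esub>) \<odot>\<^bsub>M\<^esub> x) = (\<ominus>\<^bsub>R\<^esub> \<one>\<^bsub>R\<^esub>) \<odot>\<^bsub>N\<^esub> h x"
    using module_homD(3)[OF assms(1)] x by simp
  then show ?thesis using module_homD(1)[OF assms(1)] x by (simp add: M.smult_l_minus N.smult_l_minus)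
qed

lemma module_hom_kernel_submodule:
  assumes "h \<in> module_hom R M N" "module R M" "module R N" "submodule W R M"
  shows "submodule {x \<in> W. h x = \<zero>\<^bsub>N\<^esub>} R M"
proof -
  interpret M: module R M by fact
  interpret N: module R N by fact
  have c: "x \<in> carrier M" if "x \<in> W" for x using that M.submoduleE(1)[OF assms(4)] by blast
  show ?thesis
    using c module_homD[OF assms(1)] module_hom_zero[OF assms(1-3)] module_hom_a_inv[OF assms(1-3)]
      M.submodule_zero[OF assms(4)] M.submoduleE(3-5)[OF assms(4)]
    by (intro M.submoduleI) auto
qed

lemma module_hom_image_submodule:
  assumes "h \<in> module_hom R M N" "module R M" "module R N" "submodule W R M"
  shows "submodule (h ` W) R N"
proof -
  interpret M: module R M by fact
  interpret N: module R N by fact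
  have c: "x \<in> carrier M" if "x \<in> W" for x using that M.submoduleE(1)[OF assms(4)] by blast
  show ?thesis
  proof (rule N.submoduleI)
    show "h ` W \<subseteq> carrier N" using c module_homD(1)[OF assms(1)] by auto
    show "\<zero>\<^bsub>N\<^esub> \<in> h ` W"
      using module_hom_zero[OF assms(1-3)] M.submodule_zero[OF assms(4)] by (intro image_eqI[of _ _ "\<zero>\<^bsub>M\<^esub>"]) auto
  next
    fix v assume "v \<in> h ` W"
    then obtain x where x: "x \<in> W" "v = h x" by blast
    then show "\<ominus>\<^bsub>N\<^esub> v \<in> h ` W"
      using module_hom_a_inv[OF assms(1-3) c[OF x(1)]] M.submoduleE(3)[OF assms(4) x(1)]
      by (intro image_eqI[of _ _ "\<ominus>\<^bsub>M\<^esub> x"]) auto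
  next
    fix v w assume "v \<in> h ` W" "w \<in> h ` W"
    then obtain x y where x: "x \<in> W" "v = h x" "y \<in> W" "w = h y" by blast
    then show "v \<oplus>\<^bsub>N\<^esub> w \<in> h ` W"
      using module_homD(2)[OF assms(1) c[OF x(1)] c[OF x(3)]] M.submoduleE(5)[OF assms(4) x(1,3)]
      by (intro image_eqI[of _ _ "x \<oplus>\<^bsub>M\<^esub> y"]) auto
  next
    fix a v assume a: "a \<in> carrier R" and "v \<in> h ` W"
    then obtain x where x: "x \<in> W" "v = h x" by blast
    then show "a \<odot>\<^bsub>N\<^esub> v \<in> h ` W"
      using module_homD(3)[OF assms(1) a c[OF x(1)]] M.submoduleE(4)[OF assms(4) a x(1)]
      by (intro image_eqI[of _ _ "a \<odot>\<^bsub>M\<^esub> x"]) auto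
  qed
qed

locale injective_resolution_over_noetherian_domain =
  noetherian_ring R + domain R for R :: "('a, 'r) ring_scheme" (structure) +
  fixes M :: "('a, 'b, 'm) module_scheme" and \<epsilon> :: "'b \<Rightarrow> 'e"
    and E :: "nat \<Rightarrow> ('a, 'e) module" and \<delta> :: "nat \<Rightarrow> 'e \<Rightarrow> 'e"
  assumes M: "module R M" and resolution: "injective_resolution R M \<epsilon> E \<delta>"
begin

lemma injective: "injective_module R (E i)"
  using resolution by (simp add: injective_resolution_def)

lemma module_E: "module R (E i)"
  using injective[of i] by (simp add: injective_module_def)

lemma hom_\<delta>: "\<delta> i \<in> module_hom R (E i) (E (Suc i))"
  using resolution by (simp add: injective_resolution_def)

lemma hom_\<epsilon>: "\<epsilon> \<in> module_hom R M (E 0)" and inj_\<epsilon>: "inj_on \<epsilon> (carrier M)"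
  using resolution by (simp_all add: injective_resolution_def)

lemmas \<delta> = module_homD[OF hom_\<delta>]
lemmas \<delta>_zero = module_hom_zero[OF hom_\<delta> module_E module_E]
lemmas \<delta>_a_inv = module_hom_a_inv[OF hom_\<delta> module_E module_E]
lemmas \<epsilon> = module_homD[OF hom_\<epsilon>]

lemma exact_0:
  assumes "z \<in> carrier (E 0)" "\<delta> 0 z = \<zero>\<^bsub>E (Suc 0)\<^esub>"
  obtains m where "m \<in> carrier M" "\<epsilon> m = z"
proof -
  have "\<epsilon> ` carrier M = cocycles E \<delta> 0" using resolution by (simp add: injective_resolution_def)
  then have "z \<in> \<epsilon> ` carrier M" using assms by (simp add: cocycles_def)
  then show thesis using that by blast
qed

lemma exact_Suc:
  assumes "z \<in> carrier (E (Suc i))" "\<delta> (Suc i) z = \<zero>\<^bsub>E (Suc (Suc i))\<^esub>"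
  obtains w where "w \<in> carrier (E i)" "\<delta> i w = z"
proof -
  have "\<delta> i ` carrier (E i) = cocycles E \<delta> (Suc i)" using resolution by (simp add: injective_resolution_def)
  then have "z \<in> \<delta> i ` carrier (E i)" using assms by (simp add: cocycles_def)
  then show thesis using that by blast
qed

lemma \<delta>_\<epsilon>: "m \<in> carrier M \<Longrightarrow> \<delta> 0 (\<epsilon> m) = \<zero>\<^bsub>E (Suc 0)\<^esub>"
  using resolution unfolding injective_resolution_def cocycles_def by blast

lemma \<delta>_\<delta>: "w \<in> carrier (E i) \<Longrightarrow> \<delta> (Suc i) (\<delta> i w) = \<zero>\<^bsub>E (Suc (Suc i))\<^esub>"
  using resolution unfolding injective_resolution_def cocycles_def by blast

abbreviation Gamma :: "'a set \<Rightarrow> nat \<Rightarrow> 'e set" where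
  "Gamma I i \<equiv> module.power_torsion R (E i) I"

lemma mem_Gamma_iff: "e \<in> Gamma I i \<longleftrightarrow> e \<in> carrier (E i) \<and> (\<forall>b\<in>I. \<exists>n::nat. b [^] n \<odot>\<^bsub>E i\<^esub> e = \<zero>\<^bsub>E i\<^esub>)"
  using module.power_torsion_def[OF module_E] by blast

lemma local_cohomology_Suc:
  assumes "ideal I R"
  shows "local_cohomology R I E \<delta> (Suc i) =
    quot_module ((E (Suc i))\<lparr>carrier := {z \<in> Gamma I (Suc i). \<delta> (Suc i) z = \<zero>\<^bsub>E (Suc (Suc i))\<^esub>}\<rparr>)
      (\<delta> i ` Gamma I i)"
proof -
  have c: "carrier (torsion_module R I (E j)) = Gamma I j" for j
    using module.carrier_torsion_module[OF module_E noetherian_ring_axioms assms] .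
  have z: "\<zero>\<^bsub>torsion_module R I (E j)\<^esub> = \<zero>\<^bsub>E j\<^esub>"
    and u: "(torsion_module R I (E j))\<lparr>carrier := W\<rparr> = (E j)\<lparr>carrier := W\<rparr>" for j W
    by (simp_all add: torsion_module_def)
  show ?thesis
    unfolding local_cohomology_def cohomology_module_def coboundaries_def cocycles_def c z u by simp
qed

lemma
  assumes I: "ideal I R"
  defines "Z \<equiv> \<lambda>i. {z \<in> Gamma I i. \<delta> i z = \<zero>\<^bsub>E (Suc i)\<^esub>}"
  shows module_cocycles: "module R ((E i)\<lparr>carrier := Z i\<rparr>)"
    and submodule_coboundaries: "submodule (\<delta> i ` Gamma I i) R ((E (Suc i))\<lparr>carrier := Z (Suc i)\<rparr>)"
proof -
  have G: "submodule (Gamma I j) R (E j)" for j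
    using module.submodule_power_torsion[OF module_E I] .
  have Z: "submodule (Z j) R (E j)" for j
    unfolding Z_def using module_hom_kernel_submodule[OF hom_\<delta> module_E module_E G] .
  show "module R ((E i)\<lparr>carrier := Z i\<rparr>)" using submodule.submodule_is_module[OF Z module_E] .
  have B: "submodule (\<delta> i ` Gamma I i) R (E (Suc i))"
    using module_hom_image_submodule[OF hom_\<delta> module_E module_E G] .
  have "\<delta> i ` Gamma I i \<subseteq> Z (Suc i)"
  proof
    fix z assume "z \<in> \<delta> i ` Gamma I i"
    then obtain w where w: "w \<in> Gamma I i" "z = \<delta> i w" by blast
    have wc: "w \<in> carrier (E i)" using w by (simp add: mem_Gamma_iff)
    have "\<exists>n::nat. b [^] n \<odot>\<^bsub>E (Suc i)\<^esub> \<delta> i w = \<zero>\<^bsub>E (Suc i)\<^esub>" if b: "b \<in> I" for b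
    proof -
      obtain n :: nat where "b [^] n \<odot>\<^bsub>E i\<^esub> w = \<zero>\<^bsub>E i\<^esub>" using w(1) b by (auto simp: mem_Gamma_iff)
      then have "b [^] n \<odot>\<^bsub>E (Suc i)\<^esub> \<delta> i w = \<zero>\<^bsub>E (Suc i)\<^esub>"
        using \<delta>(3)[of "b [^] n" w i] wc ideal.Icarr[OF I b] \<delta>_zero by simp
      then show ?thesis by blast
    qed
    then show "z \<in> Z (Suc i)" using w(2) wc \<delta>(1)[OF wc] \<delta>_\<delta>[OF wc] by (simp add: Z_def mem_Gamma_iff)
  qed
  then show "submodule (\<delta> i ` Gamma I i) R ((E (Suc i))\<lparr>carrier := Z (Suc i)\<rparr>)"
    using module.submodule_of_submodule[OF module_E Z B] by simp
qed

lemma local_cohomology_vanishes: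
  assumes I: "ideal I R"
    and "\<And>z. \<lbrakk> z \<in> Gamma I (Suc i); \<delta> (Suc i) z = \<zero>\<^bsub>E (Suc (Suc i))\<^esub> \<rbrakk> \<Longrightarrow> z \<in> \<delta> i ` Gamma I i"
  shows "carrier (local_cohomology R I E \<delta> (Suc i)) = {\<zero>\<^bsub>local_cohomology R I E \<delta> (Suc i)\<^esub>}"
proof -
  let ?Z = "{z \<in> Gamma I (Suc i). \<delta> (Suc i) z = \<zero>\<^bsub>E (Suc (Suc i))\<^esub>}" and ?B = "\<delta> i ` Gamma I i"
  interpret Z: module R "(E (Suc i))\<lparr>carrier := ?Z\<rparr>" using module_cocycles[OF I] .
  note B = submodule_coboundaries[OF I, of i]
  have "(\<lambda>x. ?B +>\<^bsub>(E (Suc i))\<lparr>carrier := ?Z\<rparr>\<^esub> x) ` ?Z = {?B}"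
  proof (intro equalityI subsetI)
    show "X' \<in> {?B}" if X': "X' \<in> (\<lambda>x. ?B +>\<^bsub>(E (Suc i))\<lparr>carrier := ?Z\<rparr>\<^esub> x) ` ?Z" for X'
      using X' assms(2) Z.coset_eq_self_iff[OF B] by auto
    have "\<zero>\<^bsub>E (Suc i)\<^esub> \<in> ?Z" using Z.M.zero_closed by simp
    then show "X' \<in> (\<lambda>x. ?B +>\<^bsub>(E (Suc i))\<lparr>carrier := ?Z\<rparr>\<^esub> x) ` ?Z" if "X' \<in> {?B}" for X'
      using that Z.coset_zero[OF B] by (intro image_eqI[of _ _ "\<zero>\<^bsub>E (Suc i)\<^esub>"]) auto
  qed
  then show ?thesis unfolding local_cohomology_Suc[OF I] Z.quot_module_carrier Z.quot_module_zero by simp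
qed

lemma local_cohomology_zero_ideal:
  "carrier (local_cohomology R {\<zero>} E \<delta> (Suc i)) = {\<zero>\<^bsub>local_cohomology R {\<zero>} E \<delta> (Suc i)\<^esub>}"
proof (rule local_cohomology_vanishes[OF zeroideal])
  fix z assume z: "z \<in> Gamma {\<zero>} (Suc i)" "\<delta> (Suc i) z = \<zero>\<^bsub>E (Suc (Suc i))\<^esub>"
  then obtain w where w: "w \<in> carrier (E i)" "\<delta> i w = z" using exact_Suc[of z i] by (auto simp: mem_Gamma_iff)
  interpret E: module R "E i" by (rule module_E)
  have "\<zero> [^] (1::nat) \<odot>\<^bsub>E i\<^esub> w = \<zero>\<^bsub>E i\<^esub>" using w by simp
  then have "w \<in> Gamma {\<zero>} i"
    unfolding mem_Gamma_iff using w(1) by (intro conjI ballI exI[of _ "1::nat"]) simp_all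
  then show "z \<in> \<delta> i ` Gamma {\<zero>} i" using w(2) by blast
qed

lemma local_cohomology_principal_radical:
  assumes I: "ideal I R" and f: "f \<in> carrier R" "f \<noteq> \<zero>" and "I \<subseteq> PIdl f" and "f [^] (N::nat) \<in> I"
  shows "carrier (local_cohomology R I E \<delta> (Suc (Suc i))) = {\<zero>\<^bsub>local_cohomology R I E \<delta> (Suc (Suc i))\<^esub>}"
proof (rule local_cohomology_vanishes[OF I])
  interpret E0: module R "E i" by (rule module_E)
  interpret E1: module R "E (Suc i)" by (rule module_E)
  interpret E2: module R "E (Suc (Suc i))" by (rule module_E)
  fix z assume z: "z \<in> Gamma I (Suc (Suc i))" "\<delta> (Suc (Suc i)) z = \<zero>\<^bsub>E (Suc (Suc (Suc i)))\<^esub>"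
  have zc: "z \<in> carrier (E (Suc (Suc i)))" using z by (simp add: mem_Gamma_iff)
  obtain n :: nat where "(f [^] N) [^] n \<odot>\<^bsub>E (Suc (Suc i))\<^esub> z = \<zero>\<^bsub>E (Suc (Suc i))\<^esub>"
    using z(1) assms(5) by (auto simp: mem_Gamma_iff)
  then have Fz: "f [^] (N * n) \<odot>\<^bsub>E (Suc (Suc i))\<^esub> z = \<zero>\<^bsub>E (Suc (Suc i))\<^esub>" using f(1) by (simp add: nat_pow_pow)
  define F where "F = f [^] (N * n)"
  have F: "F \<in> carrier R" "F \<noteq> \<zero>" unfolding F_def using f pow_not_zero by auto
  obtain w where w: "w \<in> carrier (E (Suc i))" "\<delta> (Suc i) w = z" using exact_Suc[OF zc z(2)] .
  have "\<delta> (Suc i) (F \<odot>\<^bsub>E (Suc i)\<^esub> w) = \<zero>\<^bsub>E (Suc (Suc i))\<^esub>"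
    using \<delta>(3)[OF F(1) w(1)] w(2) Fz by (simp add: F_def)
  then obtain v where v: "v \<in> carrier (E i)" "\<delta> i v = F \<odot>\<^bsub>E (Suc i)\<^esub> w"
    using exact_Suc[of "F \<odot>\<^bsub>E (Suc i)\<^esub> w" i] F(1) w(1) by auto
  obtain v' where v': "v' \<in> carrier (E i)" "F \<odot>\<^bsub>E i\<^esub> v' = v"
    using injective_module_divisible[OF injective F v(1)] .
  define w' where "w' = w \<oplus>\<^bsub>E (Suc i)\<^esub> \<ominus>\<^bsub>E (Suc i)\<^esub> \<delta> i v'"
  have dv': "\<delta> i v' \<in> carrier (E (Suc i))" using \<delta>(1)[OF v'(1)] .
  have w'c: "w' \<in> carrier (E (Suc i))" using w(1) dv' by (simp add: w'_def)
  have "F \<odot>\<^bsub>E (Suc i)\<^esub> \<delta> i v' = F \<odot>\<^bsub>E (Suc i)\<^esub> w" using \<delta>(3)[OF F(1) v'(1)] v' v by simp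
  then have Fw': "F \<odot>\<^bsub>E (Suc i)\<^esub> w' = \<zero>\<^bsub>E (Suc i)\<^esub>"
    using w(1) dv' F(1) by (simp add: w'_def E1.smult_r_distr E1.smult_r_minus E1.M.r_neg)
  have "\<delta> (Suc i) w' = z"
    using w dv' zc \<delta>_\<delta>[OF v'(1)] by (simp add: w'_def \<delta>(2) \<delta>_a_inv)
  moreover have "w' \<in> Gamma I (Suc i)"
    unfolding mem_Gamma_iff
  proof (intro conjI ballI w'c)
    fix b assume "b \<in> I"
    then have "f divides b" using assms(4) mem_cgenideal_iff[OF f(1)] by blast
    then obtain c where c: "c \<in> carrier R" "b = f \<otimes> c" by (auto simp: factor_def)
    have "b [^] (N * n) = c [^] (N * n) \<otimes> F"
      using c f(1) by (simp add: F_def nat_pow_distrib m_comm)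
    then have "b [^] (N * n) \<odot>\<^bsub>E (Suc i)\<^esub> w' = \<zero>\<^bsub>E (Suc i)\<^esub>"
      using c(1) F(1) w'c Fw' by (simp add: E1.smult_assoc1)
    then show "\<exists>n::nat. b [^] n \<odot>\<^bsub>E (Suc i)\<^esub> w' = \<zero>\<^bsub>E (Suc i)\<^esub>" by blast
  qed
  ultimately show "z \<in> \<delta> (Suc i) ` Gamma I (Suc i)" by blast
qed

end

context injective_resolution_over_noetherian_domain
begin

text \<open>The cocycle \<open>z\<close> represents the class of \<open>u / (x y)\<close> in
  \<open>H\<^sup>2\<^bsub>(x, y)\<^esub>(M) = M\<^bsub>x y\<^esub> / (M\<^sub>x + M\<^sub>y)\<close>.\<close>

lemma cech_class:
  assumes x: "x \<in> carrier R" "x \<noteq> \<zero>" and y: "y \<in> carrier R" "y \<noteq> \<zero>"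
    and rel: "relatively_prime R x y" and u: "u \<in> carrier M"
  obtains z where "z \<in> carrier (E 2)" "\<delta> 2 z = \<zero>\<^bsub>E 3\<^esub>"
    "x \<odot>\<^bsub>E 2\<^esub> z = \<zero>\<^bsub>E 2\<^esub>" "y \<odot>\<^bsub>E 2\<^esub> z = \<zero>\<^bsub>E 2\<^esub>"
    and "\<And>c v k. \<lbrakk> c \<in> carrier R; v \<in> carrier (E 1); x [^] Suc k \<odot>\<^bsub>E 1\<^esub> v = \<zero>\<^bsub>E 1\<^esub>;
           y [^] Suc k \<odot>\<^bsub>E 1\<^esub> v = \<zero>\<^bsub>E 1\<^esub>; c \<odot>\<^bsub>E 2\<^esub> z = \<delta> 1 v \<rbrakk> \<Longrightarrow>
         \<exists>m\<in>carrier M. \<exists>m'\<in>carrier M. (c \<otimes> (x [^] k \<otimes> y [^] k)) \<odot>\<^bsub>M\<^esub> u =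
           x [^] Suc k \<odot>\<^bsub>M\<^esub> m \<oplus>\<^bsub>M\<^esub> y [^] Suc k \<odot>\<^bsub>M\<^esub> m'"
proof -
  interpret M: module R M by (rule M)
  interpret E0: module R "E 0" by (rule module_E)
  interpret E1: module R "E 1" by (rule module_E)
  interpret E2: module R "E 2" by (rule module_E)
  note One_nat_def [simp del]
  note \<delta>_\<epsilon> = \<delta>_\<epsilon>[folded One_nat_def] and exact_0 = exact_0[folded One_nat_def]
  have exact1: "\<exists>w\<in>carrier (E 0). \<delta> 0 w = p" if "p \<in> carrier (E 1)" "\<delta> 1 p = \<zero>\<^bsub>E 2\<^esub>" for p
    using exact_Suc[of p 0] that by (auto simp: numeral_2_eq_2 One_nat_def)
  note d0 = \<delta>[where i = 0, folded One_nat_def]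
    and d0_inv = \<delta>_a_inv[where i = 0, folded One_nat_def]
  have d1: "\<And>v. v \<in> carrier (E 1) \<Longrightarrow> \<delta> 1 v \<in> carrier (E 2)"
    "\<And>v w. \<lbrakk> v \<in> carrier (E 1); w \<in> carrier (E 1) \<rbrakk> \<Longrightarrow> \<delta> 1 (v \<oplus>\<^bsub>E 1\<^esub> w) = \<delta> 1 v \<oplus>\<^bsub>E 2\<^esub> \<delta> 1 w"
    "\<And>a v. \<lbrakk> a \<in> carrier R; v \<in> carrier (E 1) \<rbrakk> \<Longrightarrow> \<delta> 1 (a \<odot>\<^bsub>E 1\<^esub> v) = a \<odot>\<^bsub>E 2\<^esub> \<delta> 1 v"
    and d1_zero: "\<delta> 1 \<zero>\<^bsub>E 1\<^esub> = \<zero>\<^bsub>E 2\<^esub>"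
    and d1_inv: "\<And>v. v \<in> carrier (E 1) \<Longrightarrow> \<delta> 1 (\<ominus>\<^bsub>E 1\<^esub> v) = \<ominus>\<^bsub>E 2\<^esub> \<delta> 1 v"
    using \<delta>[where i = 1] \<delta>_zero[where i = 1] \<delta>_a_inv[where i = 1] by (simp_all add: numeral_2_eq_2 One_nat_def)
  have d10: "\<delta> 1 (\<delta> 0 w) = \<zero>\<^bsub>E 2\<^esub>" if "w \<in> carrier (E 0)" for w
    using \<delta>_\<delta>[OF that] by (simp add: numeral_2_eq_2 One_nat_def)
  have d21: "\<delta> 2 (\<delta> 1 w) = \<zero>\<^bsub>E 3\<^esub>" if "w \<in> carrier (E 1)" for w
    using \<delta>_\<delta>[of w 1] that by (simp add: numeral_2_eq_2 numeral_3_eq_3 One_nat_def)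
  have xy: "x \<otimes> y \<in> carrier R" "x \<otimes> y \<noteq> \<zero>" using x y integral_iff by auto
  obtain w where w: "w \<in> carrier (E 0)" "(x \<otimes> y) \<odot>\<^bsub>E 0\<^esub> w = \<epsilon> u"
    using injective_module_divisible[OF injective xy \<epsilon>(1)[OF u]] .
  define g where "g = \<delta> 0 w"
  have g: "g \<in> carrier (E 1)" "(x \<otimes> y) \<odot>\<^bsub>E 1\<^esub> g = \<zero>\<^bsub>E 1\<^esub>"
    using d0(1)[OF w(1)] d0(3)[OF xy(1) w(1)] w(2) \<delta>_\<epsilon>[OF u] by (simp_all add: g_def)
  obtain g1 g2 where gs: "g1 \<in> carrier (E 1)" "g2 \<in> carrier (E 1)" "g = g1 \<oplus>\<^bsub>E 1\<^esub> g2"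
    "x \<odot>\<^bsub>E 1\<^esub> g1 = \<zero>\<^bsub>E 1\<^esub>" "y \<odot>\<^bsub>E 1\<^esub> g2 = \<zero>\<^bsub>E 1\<^esub>"
    using injective_module_split[OF injective x(1) y(1) rel g] .
  define z where "z = \<delta> 1 g1"
  have zc: "z \<in> carrier (E 2)" using d1(1) gs(1) by (simp add: z_def)
  have "z \<oplus>\<^bsub>E 2\<^esub> \<delta> 1 g2 = \<zero>\<^bsub>E 2\<^esub>"
    using d10[OF w(1)] d1(2)[OF gs(1,2)] gs(3) by (simp add: z_def g_def)
  then have zg2: "\<delta> 1 g2 = \<ominus>\<^bsub>E 2\<^esub> z"
    using E2.M.minus_equality[of "\<delta> 1 g2" z] zc d1(1)[OF gs(2)] E2.M.a_comm by simp
  show thesis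
  proof (rule that[of z])
    show "z \<in> carrier (E 2)" "\<delta> 2 z = \<zero>\<^bsub>E 3\<^esub>" using zc d21[OF gs(1)] by (simp_all add: z_def)
    show "x \<odot>\<^bsub>E 2\<^esub> z = \<zero>\<^bsub>E 2\<^esub>" using d1(3)[OF x(1) gs(1)] gs(4) d1_zero by (simp add: z_def)
    have "\<ominus>\<^bsub>E 2\<^esub> (y \<odot>\<^bsub>E 2\<^esub> z) = \<zero>\<^bsub>E 2\<^esub>"
      using d1(3)[OF y(1) gs(2)] gs(5) d1_zero zg2 zc y(1) by (simp add: E2.smult_r_minus)
    then show "y \<odot>\<^bsub>E 2\<^esub> z = \<zero>\<^bsub>E 2\<^esub>" using zc y(1) by simp
  next
    fix c v and k :: nat
    assume c: "c \<in> carrier R" and v: "v \<in> carrier (E 1)" and cz: "c \<odot>\<^bsub>E 2\<^esub> z = \<delta> 1 v"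
      and xv': "x [^] Suc k \<odot>\<^bsub>E 1\<^esub> v = \<zero>\<^bsub>E 1\<^esub>" and yv': "y [^] Suc k \<odot>\<^bsub>E 1\<^esub> v = \<zero>\<^bsub>E 1\<^esub>"
    define a b where "a = x [^] Suc k" and "b = y [^] Suc k"
    have ab: "a \<in> carrier R" "b \<in> carrier R" using x y by (simp_all add: a_def b_def)
    have xv: "a \<odot>\<^bsub>E 1\<^esub> v = \<zero>\<^bsub>E 1\<^esub>" and yv: "b \<odot>\<^bsub>E 1\<^esub> v = \<zero>\<^bsub>E 1\<^esub>"
      using xv' yv' by (simp_all only: a_def b_def)
    have ag: "a \<odot>\<^bsub>E 1\<^esub> g1 = \<zero>\<^bsub>E 1\<^esub>" using x(1) gs(1,4) by (simp add: a_def E1.smult_assoc1)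
    have bg: "b \<odot>\<^bsub>E 1\<^esub> g2 = \<zero>\<^bsub>E 1\<^esub>" using y(1) gs(2,5) by (simp add: b_def E1.smult_assoc1)
    define p where "p = c \<odot>\<^bsub>E 1\<^esub> g1 \<oplus>\<^bsub>E 1\<^esub> \<ominus>\<^bsub>E 1\<^esub> v"
    define q where "q = c \<odot>\<^bsub>E 1\<^esub> g2 \<oplus>\<^bsub>E 1\<^esub> v"
    have pq: "p \<in> carrier (E 1)" "q \<in> carrier (E 1)" using c gs(1,2) v by (simp_all add: p_def q_def)
    have "\<delta> 1 p = \<zero>\<^bsub>E 2\<^esub>"
      using c gs(1) v d1 d1_inv cz by (simp add: p_def z_def[symmetric] E2.M.r_neg)
    then obtain p0 where p0: "p0 \<in> carrier (E 0)" "\<delta> 0 p0 = p" using exact1 pq(1) by blast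
    have "\<delta> 1 q = \<zero>\<^bsub>E 2\<^esub>"
      using c gs(2) v d1 zg2 cz[symmetric] zc by (simp add: q_def E2.smult_r_minus E2.M.l_neg)
    then obtain q0 where q0: "q0 \<in> carrier (E 0)" "\<delta> 0 q0 = q" using exact1 pq(2) by blast
    have comm: "s \<odot>\<^bsub>E 1\<^esub> (c \<odot>\<^bsub>E 1\<^esub> h) = \<zero>\<^bsub>E 1\<^esub>"
      if "s \<in> carrier R" "h \<in> carrier (E 1)" "s \<odot>\<^bsub>E 1\<^esub> h = \<zero>\<^bsub>E 1\<^esub>" for s h
    proof -
      have "s \<odot>\<^bsub>E 1\<^esub> (c \<odot>\<^bsub>E 1\<^esub> h) = c \<odot>\<^bsub>E 1\<^esub> (s \<odot>\<^bsub>E 1\<^esub> h)"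
        using c that(1,2) by (simp add: E1.smult_assoc1[symmetric] m_comm)
      then show ?thesis using c that(3) by simp
    qed
    have "a \<odot>\<^bsub>E 1\<^esub> p = \<zero>\<^bsub>E 1\<^esub>"
      using comm[OF ab(1) gs(1) ag] xv ab(1) c gs(1) v
      by (simp add: p_def E1.smult_r_distr E1.smult_r_minus)
    then have "\<delta> 0 (a \<odot>\<^bsub>E 0\<^esub> p0) = \<zero>\<^bsub>E 1\<^esub>" using d0(3)[OF ab(1) p0(1)] p0(2) by simp
    then obtain mx where mx: "mx \<in> carrier M" "\<epsilon> mx = a \<odot>\<^bsub>E 0\<^esub> p0"
      using exact_0[of "a \<odot>\<^bsub>E 0\<^esub> p0"] ab(1) p0(1) by auto
    have "b \<odot>\<^bsub>E 1\<^esub> q = \<zero>\<^bsub>E 1\<^esub>"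
      using comm[OF ab(2) gs(2) bg] yv ab(2) c gs(2) v by (simp add: q_def E1.smult_r_distr)
    then have "\<delta> 0 (b \<odot>\<^bsub>E 0\<^esub> q0) = \<zero>\<^bsub>E 1\<^esub>" using d0(3)[OF ab(2) q0(1)] q0(2) by simp
    then obtain my where my: "my \<in> carrier M" "\<epsilon> my = b \<odot>\<^bsub>E 0\<^esub> q0"
      using exact_0[of "b \<odot>\<^bsub>E 0\<^esub> q0"] ab(2) q0(1) by auto
    have cg: "c \<odot>\<^bsub>E 1\<^esub> g1 \<in> carrier (E 1)" "c \<odot>\<^bsub>E 1\<^esub> g2 \<in> carrier (E 1)" using c gs(1,2) by simp_all
    have "p \<oplus>\<^bsub>E 1\<^esub> q = c \<odot>\<^bsub>E 1\<^esub> g1 \<oplus>\<^bsub>E 1\<^esub> (\<ominus>\<^bsub>E 1\<^esub> v \<oplus>\<^bsub>E 1\<^esub> (v \<oplus>\<^bsub>E 1\<^esub> c \<odot>\<^bsub>E 1\<^esub> g2))"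
      unfolding p_def q_def using cg v by (simp add: E1.M.a_assoc E1.M.a_comm[of _ v])
    also have "\<dots> = c \<odot>\<^bsub>E 1\<^esub> g" using cg v c gs(1-3) by (simp add: E1.M.r_neg1 E1.smult_r_distr)
    finally have pq_sum: "p \<oplus>\<^bsub>E 1\<^esub> q = \<delta> 0 (c \<odot>\<^bsub>E 0\<^esub> w)" using d0(3)[OF c w(1)] by (simp add: g_def)
    define r where "r = c \<odot>\<^bsub>E 0\<^esub> w \<oplus>\<^bsub>E 0\<^esub> \<ominus>\<^bsub>E 0\<^esub> (p0 \<oplus>\<^bsub>E 0\<^esub> q0)"
    have pq0: "p0 \<oplus>\<^bsub>E 0\<^esub> q0 \<in> carrier (E 0)" and cw: "c \<odot>\<^bsub>E 0\<^esub> w \<in> carrier (E 0)"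
      using p0 q0 c w by simp_all
    have r: "r \<in> carrier (E 0)" using pq0 cw by (simp add: r_def)
    have "\<delta> 0 r = \<zero>\<^bsub>E 1\<^esub>"
      using d0(2)[OF cw E0.M.a_inv_closed[OF pq0]] d0_inv[OF pq0] d0(2)[OF p0(1) q0(1)] p0(2) q0(2)
        pq_sum d0(1)[OF cw] by (simp add: r_def E1.M.r_neg)
    then obtain m0 where m0: "m0 \<in> carrier M" "\<epsilon> m0 = r" using exact_0[OF r] by blast
    have cw_eq: "c \<odot>\<^bsub>E 0\<^esub> w = r \<oplus>\<^bsub>E 0\<^esub> (p0 \<oplus>\<^bsub>E 0\<^esub> q0)"
      using pq0 cw by (simp add: r_def E0.M.a_assoc E0.M.l_neg)
    have m: "my \<oplus>\<^bsub>M\<^esub> b \<odot>\<^bsub>M\<^esub> m0 \<in> carrier M" using my m0 ab by simp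
    have coef: "c \<otimes> (x [^] k \<otimes> y [^] k) \<in> carrier R" using c x y by simp
    have ring: "(c \<otimes> (x [^] k \<otimes> y [^] k)) \<otimes> (x \<otimes> y) = (a \<otimes> b) \<otimes> c"
      unfolding a_def b_def using c x y by (simp add: m_ac)
    have "\<epsilon> ((c \<otimes> (x [^] k \<otimes> y [^] k)) \<odot>\<^bsub>M\<^esub> u) = (c \<otimes> (x [^] k \<otimes> y [^] k)) \<odot>\<^bsub>E 0\<^esub> ((x \<otimes> y) \<odot>\<^bsub>E 0\<^esub> w)"
      using \<epsilon>(3)[OF coef u] w(2) by simp
    also have "\<dots> = ((c \<otimes> (x [^] k \<otimes> y [^] k)) \<otimes> (x \<otimes> y)) \<odot>\<^bsub>E 0\<^esub> w"
      using E0.smult_assoc1[OF coef xy(1) w(1)] by simp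
    also have "\<dots> = (a \<otimes> b) \<odot>\<^bsub>E 0\<^esub> (c \<odot>\<^bsub>E 0\<^esub> w)"
      unfolding ring using ab c w(1) by (simp add: E0.smult_assoc1)
    also have "\<dots> = (a \<otimes> b) \<odot>\<^bsub>E 0\<^esub> r \<oplus>\<^bsub>E 0\<^esub> ((a \<otimes> b) \<odot>\<^bsub>E 0\<^esub> p0 \<oplus>\<^bsub>E 0\<^esub> (a \<otimes> b) \<odot>\<^bsub>E 0\<^esub> q0)"
      unfolding cw_eq using ab r p0(1) q0(1) by (simp add: E0.smult_r_distr)
    also have "(a \<otimes> b) \<odot>\<^bsub>E 0\<^esub> p0 = b \<odot>\<^bsub>E 0\<^esub> \<epsilon> mx"
      using ab p0(1) mx(2) by (simp add: m_comm[of a b] E0.smult_assoc1)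
    also have "(a \<otimes> b) \<odot>\<^bsub>E 0\<^esub> q0 = a \<odot>\<^bsub>E 0\<^esub> \<epsilon> my"
      using ab q0(1) my(2) by (simp add: E0.smult_assoc1)
    also have "(a \<otimes> b) \<odot>\<^bsub>E 0\<^esub> r = a \<odot>\<^bsub>E 0\<^esub> (b \<odot>\<^bsub>E 0\<^esub> \<epsilon> m0)"
      using ab r m0(2) by (simp add: E0.smult_assoc1)
    also have "a \<odot>\<^bsub>E 0\<^esub> (b \<odot>\<^bsub>E 0\<^esub> \<epsilon> m0) \<oplus>\<^bsub>E 0\<^esub> (b \<odot>\<^bsub>E 0\<^esub> \<epsilon> mx \<oplus>\<^bsub>E 0\<^esub> a \<odot>\<^bsub>E 0\<^esub> \<epsilon> my)
        = a \<odot>\<^bsub>E 0\<^esub> (\<epsilon> my \<oplus>\<^bsub>E 0\<^esub> b \<odot>\<^bsub>E 0\<^esub> \<epsilon> m0) \<oplus>\<^bsub>E 0\<^esub> b \<odot>\<^bsub>E 0\<^esub> \<epsilon> mx"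
      using ab \<epsilon>(1)[OF m0(1)] \<epsilon>(1)[OF mx(1)] \<epsilon>(1)[OF my(1)] by (simp add: E0.smult_r_distr E0.M.a_ac)
    also have "\<dots> = \<epsilon> (a \<odot>\<^bsub>M\<^esub> (my \<oplus>\<^bsub>M\<^esub> b \<odot>\<^bsub>M\<^esub> m0) \<oplus>\<^bsub>M\<^esub> b \<odot>\<^bsub>M\<^esub> mx)"
      using ab m0(1) mx(1) my(1) by (simp add: \<epsilon>)
    finally have "(c \<otimes> (x [^] k \<otimes> y [^] k)) \<odot>\<^bsub>M\<^esub> u = a \<odot>\<^bsub>M\<^esub> (my \<oplus>\<^bsub>M\<^esub> b \<odot>\<^bsub>M\<^esub> m0) \<oplus>\<^bsub>M\<^esub> b \<odot>\<^bsub>M\<^esub> mx"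
      using inj_\<epsilon> coef u m mx(1) ab by (auto dest: inj_onD)
    then show "\<exists>m\<in>carrier M. \<exists>m'\<in>carrier M. (c \<otimes> (x [^] k \<otimes> y [^] k)) \<odot>\<^bsub>M\<^esub> u =
        x [^] Suc k \<odot>\<^bsub>M\<^esub> m \<oplus>\<^bsub>M\<^esub> y [^] Suc k \<odot>\<^bsub>M\<^esub> m'"
      using m mx(1) unfolding a_def b_def by blast
  qed
qed

end

lemma (in domain) cancel_relatively_prime_powers:
  assumes x: "x \<in> carrier R" "x \<noteq> \<zero>" and y: "y \<in> carrier R" "y \<noteq> \<zero>"
    and rel: "relatively_prime R x y" and carr: "c \<in> carrier R" "r \<in> carrier R" "s \<in> carrier R"
    and eq: "(x [^] (k::nat) \<otimes> y [^] k) \<otimes> c = x [^] Suc k \<otimes> r \<oplus> y [^] Suc k \<otimes> s"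
  shows "\<exists>r\<in>carrier R. \<exists>s\<in>carrier R. c = x \<otimes> r \<oplus> y \<otimes> s"
proof -
  define a b where "a = x [^] k" and "b = y [^] k"
  have ab: "a \<in> carrier R" "a \<noteq> \<zero>" "b \<in> carrier R" "b \<noteq> \<zero>"
    using x y pow_not_zero by (simp_all add: a_def b_def)
  have eq': "(a \<otimes> b) \<otimes> c = (a \<otimes> x) \<otimes> r \<oplus> (b \<otimes> y) \<otimes> s" using eq by (simp add: a_def b_def)
  have "a divides ((a \<otimes> x) \<otimes> r)" "a divides ((a \<otimes> b) \<otimes> c)"
    using ab x y carr divides_mult_self by (simp_all add: m_assoc)
  then have "a divides ((b \<otimes> y) \<otimes> s)"
    using divides_addD[OF ab(1), of "(a \<otimes> x) \<otimes> r" "(b \<otimes> y) \<otimes> s"] eq' ab x y carr by simp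
  then have "x [^] k divides (y [^] Suc k \<otimes> s)" by (simp add: a_def b_def)
  then have "a divides s" unfolding a_def
    by (rule pow_divides_pow_mult_relatively_prime[OF x(1) y(1) x(2) rel carr(3)])
  then obtain s' where s': "s' \<in> carrier R" "s = a \<otimes> s'" by (auto simp: factor_def)
  have "a \<otimes> (b \<otimes> c) = a \<otimes> (x \<otimes> r \<oplus> (b \<otimes> y) \<otimes> s')"
  proof -
    have "a \<otimes> (b \<otimes> c) = (a \<otimes> x) \<otimes> r \<oplus> (b \<otimes> y) \<otimes> s" using eq' ab carr by (simp add: m_assoc)
    also have "\<dots> = a \<otimes> (x \<otimes> r \<oplus> (b \<otimes> y) \<otimes> s')" unfolding s'(2) using ab x y carr s'(1) by algebra
    finally show ?thesis .
  qed
  then have eq2: "b \<otimes> c = x \<otimes> r \<oplus> (b \<otimes> y) \<otimes> s'"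
    using m_lcancel[OF ab(2,1)] ab x y carr s'(1) by simp
  have "b divides ((b \<otimes> y) \<otimes> s')" "b divides (b \<otimes> c)"
    using ab y carr s' divides_mult_self by (simp_all add: m_assoc)
  then have "b divides (x \<otimes> r)"
    using divides_addD[OF ab(3), of "(b \<otimes> y) \<otimes> s'" "x \<otimes> r"] eq2 ab x y carr s'(1) by (simp add: a_comm)
  then have "b divides r"
    using pow_divides_relatively_prime[OF y(1) x(1) y(2) relatively_prime_sym[OF x(1) y(1) x(2) rel] carr(2)]
    by (simp add: b_def)
  then obtain r' where r': "r' \<in> carrier R" "r = b \<otimes> r'" by (auto simp: factor_def)
  have "x \<otimes> r \<oplus> (b \<otimes> y) \<otimes> s' = b \<otimes> (x \<otimes> r' \<oplus> y \<otimes> s')" unfolding r'(2) using ab x y r'(1) s'(1) by algebra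
  then have "c = x \<otimes> r' \<oplus> y \<otimes> s'"
    using eq2 m_lcancel[OF ab(4,3)] x y carr r'(1) s'(1) by simp
  then show ?thesis using r'(1) s'(1) by blast
qed

lemma (in primeideal) common_multiplier_outside_prime:
  assumes "finite S" and "\<And>b. b \<in> S \<Longrightarrow> \<exists>s\<in>carrier R - I. Q s b"
    and "\<And>s t b. \<lbrakk> t \<in> carrier R; s \<in> carrier R; b \<in> S; Q s b \<rbrakk> \<Longrightarrow> Q (t \<otimes> s) b"
  shows "\<exists>s\<in>carrier R - I. \<forall>b\<in>S. Q s b"
  using assms
proof (induction S)
  case empty
  have "\<one> \<notin> I" using one_imp_carrier I_notcarr by auto
  then show ?case by blast
next
  case (insert b S)
  have "\<exists>s\<in>carrier R - I. \<forall>b\<in>S. Q s b"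
    by (rule insert.IH) (auto intro: insert.prems)
  then obtain s where s: "s \<in> carrier R - I" "\<forall>b\<in>S. Q s b" by blast
  obtain t where t: "t \<in> carrier R - I" "Q t b" using insert.prems(1)[of b] by blast
  have "s \<otimes> t \<in> carrier R - I" using s t I_prime by blast
  moreover have "Q (s \<otimes> t) b" using insert.prems(2)[of s t b] s t by simp
  moreover have "Q (s \<otimes> t) c" if "c \<in> S" for c
    using insert.prems(2)[of t s c] s t that m_comm[of s t] by simp
  ultimately show ?case by blast
qed

locale injective_resolution_over_noetherian_factorial_domain =
  noetherian_factorial_domain R + injective_resolution_over_noetherian_domain R M \<epsilon> E \<delta>
  for R :: "('a, 'r) ring_scheme" (structure)
    and M :: "('a, 'b, 'm) module_scheme" and \<epsilon> :: "'b \<Rightarrow> 'e"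
    and E :: "nat \<Rightarrow> ('a, 'e) module" and \<delta> :: "nat \<Rightarrow> 'e \<Rightarrow> 'e"
begin

lemma local_cohomology_2_not_artinian:
  assumes loc: "local_ring R \<mm>" and dim: "\<not> krull_dim R \<ge> 4"
    and fg: "finitely_generated_module R M" and faithful: "faithful_module R M"
    and I: "ideal I R" and J: "ideal J R" and f: "f \<in> \<mm>"
    and fJ: "\<And>a. a \<in> J \<Longrightarrow> f \<otimes> a \<in> I" and IJ: "I \<subseteq> J" and J0: "J \<noteq> {\<zero>}"
    and Jp: "\<And>p. \<lbrakk> p \<in> carrier R; ring_prime p \<rbrakk> \<Longrightarrow> \<not> J \<subseteq> PIdl p"
    and P: "primeideal P R" "J \<subseteq> P" "f \<notin> P"
  shows "\<not> artinian_module R (local_cohomology R I E \<delta> 2)"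
proof
  assume art: "artinian_module R (local_cohomology R I E \<delta> 2)"
  have m: "maximalideal \<mm> R" using loc by (auto simp: local_ring_def)
  interpret m: ideal \<mm> R using m by (simp add: maximalideal_def)
  interpret P: primeideal P R by (rule P(1))
  interpret M: module R M by (rule M)
  interpret E1: module R "E 1" by (rule module_E)
  interpret E2: module R "E 2" by (rule module_E)
  note One_nat_def [simp del]
  have fc: "f \<in> carrier R" using f by (rule m.Icarr)
  obtain \<phi> u where \<phi>: "\<phi> \<in> carrier M \<rightarrow> carrier R"
    "\<And>x y. \<lbrakk> x \<in> carrier M; y \<in> carrier M \<rbrakk> \<Longrightarrow> \<phi> (x \<oplus>\<^bsub>M\<^esub> y) = \<phi> x \<oplus> \<phi> y"
    "\<And>a x. \<lbrakk> a \<in> carrier R; x \<in> carrier M \<rbrakk> \<Longrightarrow> \<phi> (a \<odot>\<^bsub>M\<^esub> x) = a \<otimes> \<phi> x"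
    and u: "u \<in> carrier M" "\<phi> u \<noteq> \<zero>"
    using exists_nonzero_functional[OF M fg faithful] by metis
  define a where "a = \<phi> u"
  have a: "a \<in> carrier R" "a \<noteq> \<zero>" using \<phi>(1) u by (auto simp: a_def)
  have "\<zero> \<in> J" using additive_subgroup.zero_closed[OF ideal.axioms(1)[OF J]] .
  then obtain x' where x': "x' \<in> J" "x' \<noteq> \<zero>" using J0 by blast
  have x'c: "x' \<in> carrier R" using ideal.Icarr[OF J x'(1)] .
  \<comment> \<open>Choosing \<open>x\<close> to be a multiple of \<open>\<phi> u\<close> makes \<open>\<phi> u\<close> survive modulo \<open>(x, y)\<close> locally at \<open>P\<close>.\<close>
  define x where "x = a \<otimes> x'"
  have x: "x \<in> carrier R" "x \<noteq> \<zero>" using a x'c x'(2) integral_iff by (auto simp: x_def)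
  have xJ: "x \<in> J" using ideal.I_l_closed[OF J x'(1) a(1)] by (simp add: x_def)
  obtain y where y: "y \<in> J" "relatively_prime R x y"
    using exists_relatively_prime_in_ideal[OF J Jp x] by blast
  have yc: "y \<in> carrier R" using ideal.Icarr[OF J y(1)] .
  have xP: "x \<in> P" "x' \<in> P" and yP: "y \<in> P" using xJ x'(1) y(1) P(2) by auto
  have y0: "y \<noteq> \<zero>"
  proof
    assume "y = \<zero>"
    then have "x divides \<one>" using y(2) divides_zero[OF x(1)] by (simp add: relatively_prime_def)
    then obtain t where "t \<in> carrier R" "\<one> = x \<otimes> t" by (auto simp: factor_def)
    then have "\<one> \<in> P" using P.I_r_closed[OF xP(1)] by simp
    then show False using P.one_imp_carrier P.I_notcarr by simp
  qed
  have mprime: "primeideal \<mm> R" using maximalideal_prime[OF m] .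
  have "P \<subseteq> \<mm>"
    using proper_ideal_subset_maximal_ideal[OF loc P.ideal_axioms] P.I_notcarr by auto
  then have Pm: "P \<subset> \<mm>" using f P(3) by auto
  obtain S where S: "S \<subseteq> carrier R" "finite S" "I = Idl S" using finetely_gen[OF I] by auto
  have SI: "S \<subseteq> I" using genideal_self[OF S(1)] S(3) by simp
  have "\<exists>s\<in>carrier R - P. \<forall>b\<in>S. \<exists>n::nat. \<exists>r\<in>carrier R. \<exists>t\<in>carrier R. s \<otimes> b [^] n = r \<otimes> x \<oplus> t \<otimes> y"
  proof (rule P.common_multiplier_outside_prime[OF S(2)])
    fix b assume "b \<in> S"
    then have "b \<in> P" using SI IJ P(2) by blast
    then show "\<exists>s\<in>carrier R - P. \<exists>n::nat. \<exists>r\<in>carrier R. \<exists>t\<in>carrier R. s \<otimes> b [^] n = r \<otimes> x \<oplus> t \<otimes> y"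
      using power_in_two_generated_ideal_outside_prime[OF dim P(1) mprime Pm xP(1) yP x(2) y(2)] by simp
  next
    fix s c b assume c: "c \<in> carrier R" "s \<in> carrier R" "b \<in> S"
      and "\<exists>n::nat. \<exists>r\<in>carrier R. \<exists>t\<in>carrier R. s \<otimes> b [^] n = r \<otimes> x \<oplus> t \<otimes> y"
    then obtain n :: nat and r t where r: "r \<in> carrier R" "t \<in> carrier R" "s \<otimes> b [^] n = r \<otimes> x \<oplus> t \<otimes> y"
      by blast
    have "b \<in> carrier R" using c(3) S(1) by blast
    then have "(c \<otimes> s) \<otimes> b [^] n = c \<otimes> (s \<otimes> b [^] n)" using c(1,2) by (simp add: m_assoc)
    also have "\<dots> = (c \<otimes> r) \<otimes> x \<oplus> (c \<otimes> t) \<otimes> y" unfolding r(3) using c r(1,2) x(1) yc by algebra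
    finally show "\<exists>n::nat. \<exists>r\<in>carrier R. \<exists>t\<in>carrier R. (c \<otimes> s) \<otimes> b [^] n = r \<otimes> x \<oplus> t \<otimes> y"
      using c(1) r(1,2) by (intro exI[of _ n] bexI[of _ "c \<otimes> r"] bexI[of _ "c \<otimes> t"]) auto
  qed
  then obtain s where s: "s \<in> carrier R" "s \<notin> P"
    and sb: "\<And>b. b \<in> S \<Longrightarrow> \<exists>n::nat. \<exists>r\<in>carrier R. \<exists>t\<in>carrier R. s \<otimes> b [^] n = r \<otimes> x \<oplus> t \<otimes> y" by auto
  obtain z where z: "z \<in> carrier (E 2)" "\<delta> 2 z = \<zero>\<^bsub>E 3\<^esub>"
    "x \<odot>\<^bsub>E 2\<^esub> z = \<zero>\<^bsub>E 2\<^esub>" "y \<odot>\<^bsub>E 2\<^esub> z = \<zero>\<^bsub>E 2\<^esub>"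
    and descend: "\<And>c v k. \<lbrakk> c \<in> carrier R; v \<in> carrier (E 1); x [^] Suc k \<odot>\<^bsub>E 1\<^esub> v = \<zero>\<^bsub>E 1\<^esub>;
           y [^] Suc k \<odot>\<^bsub>E 1\<^esub> v = \<zero>\<^bsub>E 1\<^esub>; c \<odot>\<^bsub>E 2\<^esub> z = \<delta> 1 v \<rbrakk> \<Longrightarrow>
         \<exists>m\<in>carrier M. \<exists>m'\<in>carrier M. (c \<otimes> (x [^] k \<otimes> y [^] k)) \<odot>\<^bsub>M\<^esub> u =
           x [^] Suc k \<odot>\<^bsub>M\<^esub> m \<oplus>\<^bsub>M\<^esub> y [^] Suc k \<odot>\<^bsub>M\<^esub> m'"
    using cech_class[OF x yc y0 y(2) u(1)] by metis
  have d2: "\<delta> 2 (s \<odot>\<^bsub>E 2\<^esub> z) = \<zero>\<^bsub>E (Suc 2)\<^esub>"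
    using \<delta>(3)[OF s(1) z(1)] z(2) s(1) module.smult_r_null[OF module_E] by (simp add: numeral_3_eq_3 numeral_2_eq_2)
  have "s \<odot>\<^bsub>E 2\<^esub> z \<in> Gamma I 2"
  proof (rule E2.power_torsion_of_generators(2)[OF I S(2,1,3)])
    show "s \<odot>\<^bsub>E 2\<^esub> z \<in> carrier (E 2)" using s z by simp
    fix b assume "b \<in> S"
    then obtain n :: nat and r t where r: "r \<in> carrier R" "t \<in> carrier R" "s \<otimes> b [^] n = r \<otimes> x \<oplus> t \<otimes> y"
      using sb by blast
    have bc: "b \<in> carrier R" using \<open>b \<in> S\<close> S(1) by blast
    have "b [^] n \<odot>\<^bsub>E 2\<^esub> (s \<odot>\<^bsub>E 2\<^esub> z) = (s \<otimes> b [^] n) \<odot>\<^bsub>E 2\<^esub> z"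
      using bc s(1) z(1) by (simp add: m_comm[of s] E2.smult_assoc1)
    also have "\<dots> = \<zero>\<^bsub>E 2\<^esub>"
      unfolding r(3) using r(1,2) x(1) yc z by (simp add: E2.smult_l_distr E2.smult_assoc1)
    finally show "\<exists>n::nat. b [^] n \<odot>\<^bsub>E 2\<^esub> (s \<odot>\<^bsub>E 2\<^esub> z) = \<zero>\<^bsub>E 2\<^esub>" by blast
  qed
  then have cocycle: "s \<odot>\<^bsub>E 2\<^esub> z \<in> {z \<in> Gamma I 2. \<delta> 2 z = \<zero>\<^bsub>E (Suc 2)\<^esub>}" using d2 by simp
  have two: "Suc 1 = 2" by simp
  interpret Z: module R "(E 2)\<lparr>carrier := {z \<in> Gamma I 2. \<delta> 2 z = \<zero>\<^bsub>E (Suc 2)\<^esub>}\<rparr>"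
    using module_cocycles[OF I, of 2] .
  note B = submodule_coboundaries[OF I, of 1, unfolded two]
  have unit: "\<one> \<ominus> r \<otimes> f \<in> Units R" if r: "r \<in> carrier R" for r
  proof (rule ccontr)
    assume "\<one> \<ominus> r \<otimes> f \<notin> Units R"
    then have "\<one> \<ominus> r \<otimes> f \<in> \<mm>"
      using mem_maximal_ideal_iff[OF noetherian_ring_axioms loc, of "\<one> \<ominus> r \<otimes> f"] r fc by simp
    then have "(\<one> \<ominus> r \<otimes> f) \<oplus> r \<otimes> f \<in> \<mm>" using m.a_closed m.I_l_closed[OF f r] by simp
    then have "\<one> \<in> \<mm>" using r fc by (simp add: a_minus_def a_assoc l_neg)
    then show False using m.one_imp_carrier maximalideal.I_notcarr[OF m] by simp
  qed
  have "\<exists>k::nat. f [^] k \<odot>\<^bsub>E 2\<^esub> (s \<odot>\<^bsub>E 2\<^esub> z) \<in> \<delta> 1 ` Gamma I 1"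
    using Z.artinian_quotient_killed_by_pow[OF B _ fc unit, of "s \<odot>\<^bsub>E 2\<^esub> z"] cocycle art
    unfolding local_cohomology_Suc[OF I, of 1, unfolded two] by simp
  then obtain k :: nat and v where v: "v \<in> Gamma I 1" "f [^] k \<odot>\<^bsub>E 2\<^esub> (s \<odot>\<^bsub>E 2\<^esub> z) = \<delta> 1 v" by blast
  have vc: "v \<in> carrier (E 1)" using v by (simp add: mem_Gamma_iff)
  have kill: "\<exists>n::nat. b [^] n \<odot>\<^bsub>E 1\<^esub> (f [^] n \<odot>\<^bsub>E 1\<^esub> v) = \<zero>\<^bsub>E 1\<^esub>" if b: "b \<in> J" for b
  proof -
    have bc: "b \<in> carrier R" using ideal.Icarr[OF J b] .
    obtain n :: nat where "(f \<otimes> b) [^] n \<odot>\<^bsub>E 1\<^esub> v = \<zero>\<^bsub>E 1\<^esub>"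
      using v(1) fJ[OF b] by (auto simp: mem_Gamma_iff)
    then have "b [^] n \<odot>\<^bsub>E 1\<^esub> (f [^] n \<odot>\<^bsub>E 1\<^esub> v) = \<zero>\<^bsub>E 1\<^esub>"
      using bc fc vc by (simp add: nat_pow_distrib m_comm[of "f [^] n"] E1.smult_assoc1)
    then show ?thesis by blast
  qed
  obtain n1 n2 :: nat where n1: "x [^] n1 \<odot>\<^bsub>E 1\<^esub> (f [^] n1 \<odot>\<^bsub>E 1\<^esub> v) = \<zero>\<^bsub>E 1\<^esub>"
    and n2: "y [^] n2 \<odot>\<^bsub>E 1\<^esub> (f [^] n2 \<odot>\<^bsub>E 1\<^esub> v) = \<zero>\<^bsub>E 1\<^esub>"
    using kill[OF xJ] kill[OF y(1)] by blast
  define N where "N = n1 + n2"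
  have killN: "b [^] Suc N \<odot>\<^bsub>E 1\<^esub> (f [^] N \<odot>\<^bsub>E 1\<^esub> v) = \<zero>\<^bsub>E 1\<^esub>"
    if "b \<in> carrier R" "b [^] n \<odot>\<^bsub>E 1\<^esub> (f [^] n \<odot>\<^bsub>E 1\<^esub> v) = \<zero>\<^bsub>E 1\<^esub>" "n \<le> N" for b and n :: nat
  proof -
    have "f [^] N \<odot>\<^bsub>E 1\<^esub> v = f [^] (N - n) \<odot>\<^bsub>E 1\<^esub> (f [^] n \<odot>\<^bsub>E 1\<^esub> v)"
      using fc vc that(3) by (simp add: E1.smult_assoc1[symmetric] nat_pow_mult)
    moreover have "b [^] n \<odot>\<^bsub>E 1\<^esub> (f [^] (N - n) \<odot>\<^bsub>E 1\<^esub> (f [^] n \<odot>\<^bsub>E 1\<^esub> v))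
        = f [^] (N - n) \<odot>\<^bsub>E 1\<^esub> (b [^] n \<odot>\<^bsub>E 1\<^esub> (f [^] n \<odot>\<^bsub>E 1\<^esub> v))"
      using fc vc that(1) by (simp add: E1.smult_assoc1[symmetric] m_ac)
    ultimately have "b [^] n \<odot>\<^bsub>E 1\<^esub> (f [^] N \<odot>\<^bsub>E 1\<^esub> v) = \<zero>\<^bsub>E 1\<^esub>" using that(2) fc by simp
    from E1.pow_smult_zero_mono[OF that(1) _ this, of "Suc N"] show ?thesis
      using fc vc that(3) by simp
  qed
  define c where "c = f [^] N \<otimes> (f [^] k \<otimes> s)"
  have cc: "c \<in> carrier R" using fc s(1) by (simp add: c_def)
  have fP: "f [^] j \<notin> P" for j :: nat
  proof (induction j)
    case 0
    then show ?case using P.one_imp_carrier P.I_notcarr by auto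
  next
    case (Suc j)
    then show ?case using P.I_prime[of "f [^] j" f] fc P(3) by auto
  qed
  have cP: "c \<notin> P"
    using P.I_prime[of "f [^] N" "f [^] k \<otimes> s"] P.I_prime[of "f [^] k" s] fP s fc by (auto simp: c_def)
  have "c \<odot>\<^bsub>E 2\<^esub> z = f [^] N \<odot>\<^bsub>E 2\<^esub> \<delta> 1 v"
    using v(2) fc s(1) z(1) by (simp add: c_def E2.smult_assoc1)
  also have "\<dots> = \<delta> 1 (f [^] N \<odot>\<^bsub>E 1\<^esub> v)"
    using \<delta>(3)[of "f [^] N" v 1] fc vc unfolding two by simp
  finally have cz: "c \<odot>\<^bsub>E 2\<^esub> z = \<delta> 1 (f [^] N \<odot>\<^bsub>E 1\<^esub> v)" .
  obtain m m' where mm: "m \<in> carrier M" "m' \<in> carrier M"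
    "(c \<otimes> (x [^] N \<otimes> y [^] N)) \<odot>\<^bsub>M\<^esub> u = x [^] Suc N \<odot>\<^bsub>M\<^esub> m \<oplus>\<^bsub>M\<^esub> y [^] Suc N \<odot>\<^bsub>M\<^esub> m'"
    using descend[OF cc _ killN[OF x(1) n1] killN[OF yc n2] cz] fc vc unfolding N_def by auto
  have "(x [^] N \<otimes> y [^] N) \<otimes> (c \<otimes> a) = (c \<otimes> (x [^] N \<otimes> y [^] N)) \<otimes> a"
    using x yc a cc by (simp add: m_ac)
  also have "\<dots> = \<phi> ((c \<otimes> (x [^] N \<otimes> y [^] N)) \<odot>\<^bsub>M\<^esub> u)" using \<phi>(3)[OF _ u(1)] x yc cc by (simp add: a_def)
  also have "\<dots> = x [^] Suc N \<otimes> \<phi> m \<oplus> y [^] Suc N \<otimes> \<phi> m'"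
    unfolding mm(3) using \<phi>(2,3) mm(1,2) x(1) yc by simp
  finally obtain r t where rt: "r \<in> carrier R" "t \<in> carrier R" "c \<otimes> a = x \<otimes> r \<oplus> y \<otimes> t"
    using cancel_relatively_prime_powers[OF x yc y0 y(2), of "c \<otimes> a" "\<phi> m" "\<phi> m'" N] cc a \<phi>(1) mm(1,2)
    by (auto simp: Pi_iff)
  have "x \<otimes> (c \<ominus> x' \<otimes> r) = y \<otimes> (t \<otimes> x')"
  proof -
    have "x \<otimes> (c \<ominus> x' \<otimes> r) = (c \<otimes> a \<ominus> x \<otimes> r) \<otimes> x'"
      unfolding x_def using a x'c cc rt(1) by algebra
    also have "c \<otimes> a \<ominus> x \<otimes> r = y \<otimes> t" unfolding rt(3) using x(1) yc rt(1,2) by algebra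
    finally show ?thesis using yc x'c rt(2) by (simp add: m_assoc)
  qed
  then have "x divides (y \<otimes> (t \<otimes> x'))" using divides_mult_self[OF x(1), of "c \<ominus> x' \<otimes> r"] cc x'c rt(1) by simp
  then have "x divides (t \<otimes> x')" using y(2) rt(2) x'c by (simp add: relatively_prime_def)
  then obtain w where w: "w \<in> carrier R" "t \<otimes> x' = x \<otimes> w" by (auto simp: factor_def)
  have "x \<otimes> (c \<ominus> x' \<otimes> r) = x \<otimes> (y \<otimes> w)"
    using \<open>x \<otimes> (c \<ominus> x' \<otimes> r) = y \<otimes> (t \<otimes> x')\<close> w x(1) yc by (simp add: m_lcomm)
  then have "c \<ominus> x' \<otimes> r = y \<otimes> w"
    using m_lcancel[OF x(2,1)] cc x'c rt(1) yc w(1) by simp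
  then have "c = x' \<otimes> r \<oplus> y \<otimes> w" using cc x'c rt(1) by (metis a_minus_def add.inv_solve_right a_comm m_closed yc w(1) minus_closed)
  also have "\<dots> \<in> P" using P.a_closed P.I_r_closed xP(2) yP rt(1) w(1) by simp
  finally show False using cP by simp
qed

end

lemma SUP_ereal_of_nat_attained:
  assumes "(SUP i\<in>S. ereal (real i)) = ereal (real (Suc c))"
  shows "Suc c \<in> S"
proof (rule ccontr)
  assume no: "Suc c \<notin> S"
  have "ereal (real i) \<le> ereal (real c)" if i: "i \<in> S" for i
  proof -
    have "ereal (real i) \<le> ereal (real (Suc c))"
      unfolding assms[symmetric] using i by (intro SUP_upper)
    then have "i \<le> Suc c" by simp
    then show ?thesis using i no by (cases "i = Suc c") auto
  qed
  then have "(SUP i\<in>S. ereal (real i)) \<le> ereal (real c)" by (intro SUP_least)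
  then show False using assms by simp
qed

lemma (in injective_resolution_over_noetherian_factorial_domain) top_local_cohomology_not_artinian:
  assumes loc: "local_ring R \<mm>" and dim3: "krull_dim R = 3"
    and fg: "finitely_generated_module R M" and faithful: "faithful_module R M"
    and n_def: "n = module_dim R M" and I: "ideal I R"
    and d_def: "d = module_dim R (quot_module M (ideal_smult R I M))" and d1: "d > 1"
    and cdim: "cohomological_dim R I E \<delta> = n - d + 1"
  shows "\<exists>c :: nat. cohomological_dim R I E \<delta> = ereal (real c) \<and>
           \<not> artinian_module R (local_cohomology R I E \<delta> c)"
proof -
  interpret M: module R M by (rule M)
  interpret I: ideal I R by (rule I)
  define H where "H i = local_cohomology R I E \<delta> i" for i
  have cd: "cohomological_dim R I E \<delta> = (SUP i\<in>{i. carrier (H i) \<noteq> {\<zero>\<^bsub>H i\<^esub>}}. ereal (real i))"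
    by (simp add: cohomological_dim_def H_def)
  have dim: "\<not> krull_dim R \<ge> 4" using dim3 by simp
  have n: "n = 3"
    using dim3 faithful n_def krull_dim_quot_zero by (simp add: module_dim_def faithful_module_def)
  define K where "K = annihilator R (quot_module M (ideal_smult R I M))"
  have K: "ideal K R" "I \<subseteq> K"
    unfolding K_def using M.ideal_annihilator_quot_module[OF M.ideal_smult_submodule[OF I]]
      M.ideal_subset_annihilator[OF I] by simp_all
  have d: "d = krull_dim (R Quot K)" using d_def by (simp add: module_dim_def K_def)
  have "d \<le> 3"
    using krull_dim_surjective_hom[OF ideal.rcos_ring_hom_ring[OF K(1)] is_cring] dim3
    by (auto simp: d FactRing_def A_RCOSETS_def')
  then obtain d' where d': "d = ereal d'" "d' \<le> 3" using d1 by (cases d) auto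
  have I0: "I \<noteq> {\<zero>}"
  proof
    assume "I = {\<zero>}"
    then have "carrier (H (Suc i)) = {\<zero>\<^bsub>H (Suc i)\<^esub>}" for i
      using local_cohomology_zero_ideal by (simp add: H_def)
    then have "i = 0" if "carrier (H i) \<noteq> {\<zero>\<^bsub>H i\<^esub>}" for i using that by (cases i) auto
    then have "cohomological_dim R I E \<delta> \<le> 0"
      unfolding cd by (intro SUP_least) (auto simp: zero_ereal_def)
    then show False using cdim n d' by (simp add: one_ereal_def zero_ereal_def)
  qed
  have K0: "K \<noteq> {\<zero>}" using I0 K(2) I.zero_closed by auto
  note two = two_dimensional_quotient[OF dim K(1) K0]
  have "d = 2" using two(1) d1 d by simp
  then have cd2: "cohomological_dim R I E \<delta> = ereal (real 2)"
    using cdim n by (simp add: one_ereal_def)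
  then have H2: "carrier (local_cohomology R I E \<delta> 2) \<noteq> {\<zero>\<^bsub>local_cohomology R I E \<delta> 2\<^esub>}"
    using SUP_ereal_of_nat_attained[of "{i. carrier (H i) \<noteq> {\<zero>\<^bsub>H i\<^esub>}}" 1] unfolding cd
    by (simp add: H_def numeral_2_eq_2)
  obtain A B C where chain: "primeideal A R" "primeideal B R" "primeideal C R" "K \<subseteq> A" "A \<subset> B" "B \<subset> C"
    using two(2) d1 d by auto
  obtain f J where f: "f \<in> carrier R" "f \<noteq> \<zero>" and J: "ideal J R"
    and fJ: "\<And>a. a \<in> J \<Longrightarrow> f \<otimes> a \<in> I" and If: "\<And>b. b \<in> I \<Longrightarrow> \<exists>a\<in>J. b = f \<otimes> a"
    and Jp: "\<And>p. \<lbrakk> p \<in> carrier R; ring_prime p \<rbrakk> \<Longrightarrow> \<not> J \<subseteq> PIdl p"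
    using content_factorization[OF I I0] by metis
  interpret J: ideal J R by (rule J)
  have "f \<notin> Units R"
  proof
    assume fU: "f \<in> Units R"
    have "A \<noteq> {\<zero>}" using chain(4) K(2) I0 I.zero_closed by auto
    then obtain p where p: "p \<in> A" "ring_prime p" using prime_ideal_contains_prime chain(1) by blast
    have A: "ideal A R" using chain(1) by (simp add: primeideal_def)
    have pc: "p \<in> carrier R" using ideal.Icarr[OF A p(1)] .
    obtain a where a: "a \<in> J" "\<not> p divides a" using Jp[OF pc p(2)] mem_cgenideal_iff[OF pc] by blast
    have "\<not> p divides f"
    proof
      assume "p divides f"
      then obtain t where t: "t \<in> carrier R" "f = p \<otimes> t" by (auto simp: factor_def)
      have "p \<otimes> (t \<otimes> inv f) = \<one>" using t pc fU Units_inv_closed[OF fU] Units_r_inv[OF fU]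
        by (simp add: m_assoc[symmetric])
      then have "p divides \<one>" using divides_mult_self[OF pc, of "t \<otimes> inv f"] t Units_inv_closed[OF fU] by simp
      then show False using divides_one[OF pc] prime_not_unit[OF pc p(2)] by simp
    qed
    then have "\<not> p divides (f \<otimes> a)"
      using prime_divides_mult[OF pc p(2) f(1) J.Icarr[OF a(1)]] a(2) by blast
    then have "PIdl p \<noteq> A" using fJ[OF a(1)] K(2) chain(4) mem_cgenideal_iff[OF pc] by auto
    moreover have "PIdl p \<subseteq> A" using cgenideal_minimal[OF A p(1)] .
    moreover have "{\<zero>} \<subset> PIdl p"
      using ring_primeE(1)[OF pc p(2)] cgenideal_self[OF pc]
        additive_subgroup.zero_closed[OF ideal.axioms(1)[OF cgenideal_ideal[OF pc]]] by auto
    ultimately show False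
      using dim krull_dim_ge_4[OF zeroprimeideal primeideal_cgenideal[OF pc p(2)] chain(1-3)] chain(5,6)
      by auto
  qed
  then have fm: "f \<in> \<mm>" using mem_maximal_ideal_iff[OF noetherian_ring_axioms loc f(1)] by simp
  have "I \<subseteq> PIdl f"
    using If mem_cgenideal_iff[OF f(1)] divides_mult_self[OF f(1)] J.Icarr by fastforce
  have fJ_pow: "f [^] k \<notin> J" for k :: nat
  proof
    assume "f [^] k \<in> J"
    then have "f [^] Suc k \<in> I" using fJ f(1) m_comm[of f "f [^] k"] by fastforce
    then show False
      using local_cohomology_principal_radical[OF I f \<open>I \<subseteq> PIdl f\<close>, of "Suc k" 0] H2
      by (simp add: numeral_2_eq_2)
  qed
  obtain P where P: "primeideal P R" "J \<subseteq> P" "P \<inter> range (\<lambda>k::nat. f [^] k) = {}"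
  proof (rule prime_ideal_avoiding_mult_closed[OF noetherian_ring_axioms J, of "range (\<lambda>k::nat. f [^] k)"])
    show "\<one> \<in> range (\<lambda>k::nat. f [^] k)" by (rule range_eqI[of _ _ 0]) simp
    show "s \<otimes> t \<in> range (\<lambda>k::nat. f [^] k)"
      if "s \<in> range (\<lambda>k::nat. f [^] k)" "t \<in> range (\<lambda>k::nat. f [^] k)" for s t
      using that f(1) by (auto simp: nat_pow_mult)
  qed (use f(1) fJ_pow in auto)
  have "f [^] (1::nat) \<notin> P" using P(3) by blast
  then have "f \<notin> P" using f(1) by simp
  have "I \<subseteq> J" using If J.I_l_closed f(1) by fastforce
  moreover have "J \<noteq> {\<zero>}" using \<open>I \<subseteq> J\<close> I0 I.zero_closed by auto
  ultimately have "\<not> artinian_module R (local_cohomology R I E \<delta> 2)"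
    using local_cohomology_2_not_artinian[OF loc dim fg faithful I J fm fJ _ _ Jp P(1,2) \<open>f \<notin> P\<close>] by blast
  then show ?thesis using cd2 by blast
qed

theorem theorem3p1:
  fixes R :: "('a, 'r) ring_scheme" and \<mm> :: "'a set"
    and M :: "('a, 'b, 'm) module_scheme"
    and \<epsilon> :: "'b \<Rightarrow> 'e" and E :: "nat \<Rightarrow> ('a, 'e) module" and \<delta> :: "nat \<Rightarrow> 'e \<Rightarrow> 'e"
    and I :: "'a set" and n d :: ereal
  assumes "noetherian_ring R" and "local_ring R \<mm>" and "factorial_domain R"
    and "krull_dim R = 3"
    and "module R M" and "finitely_generated_module R M" and "faithful_module R M"
    and "injective_resolution R M \<epsilon> E \<delta>"
    and "n = module_dim R M"
    and "ideal I R"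
    and "d = module_dim R (quot_module M (ideal_smult R I M))"
    and "d > 1"
    and "cohomological_dim R I E \<delta> = n - d + 1"
  shows "\<exists>c :: nat. cohomological_dim R I E \<delta> = ereal (real c) \<and>
           \<not> artinian_module R (local_cohomology R I E \<delta> c)"
proof -
  interpret injective_resolution_over_noetherian_factorial_domain R M \<epsilon> E \<delta>
    using assms(1,3,5,8)
    by (simp add: injective_resolution_over_noetherian_factorial_domain_def
        noetherian_factorial_domain_def injective_resolution_over_noetherian_domain_def
        injective_resolution_over_noetherian_domain_axioms_def factorial_domain_def)
  show ?thesis using top_local_cohomology_not_artinian[OF assms(2,4,6,7,9-13)] .
qed

end
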